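(* Let $A=\begin{bmatrix}2&0\\0&1\end{bmatrix}$, $B=\begin{bmatrix}1&0\\0&2\end{bmatrix}$. Then there exist a nonseparable biscaled multiresolution analysis $(\phi,\mathfrak{V})$ in $L^2(\mathbb{R}^2)$ with respect to $(A,B)$ and a real-valued nonseparable function $\psi\in L^2(\mathbb{R}^2)$ which is a wavelet for dilation by $(A,B)$ associated with $(\phi,\mathfrak{V})$, such that the Fourier transform $\hat\psi$ has compact support.
   Context: For $M\in\mathrm{GL}_2(\mathbb{R})$, $D_M$ is the unitary operator on $L^2(\mathbb{R}^2)$ given by $(D_Mf)(x)=|\det M|^{1/2}f(Mx)$. A biscaled multiresolution analysis (BMRA) with respect to $(A,B)$ is a pair $(\phi,\mathfrak{V})$ where $\phi\in L^2(\mathbb{R}^2)$ and $\mathfrak{V}=\{V_{i,j}:(i,j)\in\mathbb{Z}^2\}$ is a family of closed subspaces of $L^2(\mathbb{R}^2)$ such that: (i) $V_{i,j}\subseteq V_{l,m}$ for $i\le l$, $j\le m$; (ii) $D_A^iD_B^jV_{0,0}=V_{i,j}$ for all $i,j$; (iii) $\bigcap_{(i,j)\in\mathbb{Z}^2}V_{i,j}=\{0\}$; (iv) $\overline{\bigcup_{(i,j)\in\mathbb{Z}^2}V_{i,j}}=L^2(\mathbb{R}^2)$; (v) the orthogonal projections $P_{i,j}$ onto $V_{i,j}$ commute pairwise; (vi) $\{\phi(x-k):k\in\mathbb{Z}^2\}$ is an orthonormal basis of $V_{0,0}$. Wavelet: $\psi\in L^2(\mathbb{R}^2)$ is a wavelet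 for dilation by $(A,B)$ if $\{2^{(m+n)/2}\psi(A^mB^nx+k):(m,n)\in\mathbb{Z}^2,k\in\mathbb{Z}^2\}$ is an orthonormal basis of $L^2(\mathbb{R}^2)$. It is associated with the BMRA $(\phi,\mathfrak{V})$ if $\{\psi(x-k):k\in\mathbb{Z}^2\}$ is an orthonormal basis of $W_{0,0}=V_{1,1}\ominus\left((V_{1,0}\ominus V_{0,0})\oplus(V_{0,1}\ominus V_{0,0})\oplus V_{0,0}\right)$. Separability: a function $f\in L^2(\mathbb{R}^2)$ is separable if $f(x,y)=f_1(x)f_2(y)$ a.e. for some $f_1,f_2\in L^2(\mathbb{R})$, and nonseparable otherwise. A (dyadic, one-variable) MRA $(\phi_1,\{V_i\}_{i\in\mathbb{Z}})$ in $L^2(\mathbb{R})$ consists of nested closed subspaces $V_i\subseteq V_{i+1}$ with trivial intersection and dense union, with $V_i=D^iV_0$ for $(Df)(x)=\sqrt2f(2x)$, and with $\{\phi_1(x-k):k\in\mathbb{Z}\}$ an orthonormal basis of $V_0$. The tensor product of two MRAs $(\phi_1,\{V^{(1)}_i\})$, $(\phi_2,\{V^{(2)}_j\})$ is the BMRA with scaling function $\phi_1(x)\phi_2(y)$ and subspaces $V^{(1)}_i\otimes V^{(2)}_j$. A BMRA is separable if it is unitarily equivalent to such a tensor product, i.e. if there is a unitary operator on $L^2(\mathbb{R}^2)$ commuting with $D_A$, $D_B$ and all translations by elements of $\mathbb{Z}^2$ which carries the scaling function and each subspace $V_{i,j}$ to the corresponding scaling function and subspace of the tensor product; it is nonseparable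 otherwise. *)

theory Defs
  imports "HOL-Analysis.Analysis"
begin

text \<open>
  Elements of \<open>L\<^sup>2\<close> are represented by square-integrable Borel functions; equality of elements
  is equality almost everywhere. A subspace is a set of such representatives. By
  \<open>l2_closure S \<subseteq> S\<close>, a closed subspace contains, with a function, every function in \<open>L2\<close> equal
  to it almost everywhere.
\<close>

definition L2 :: "('a::euclidean_space \<Rightarrow> complex) set" where
  "L2 = {f. f \<in> borel_measurable lborel \<and> integrable lborel (\<lambda>x. (cmod (f x))\<^sup>2)}"

definition l2_eq :: "('a::euclidean_space \<Rightarrow> complex) \<Rightarrow> ('a \<Rightarrow> complex) \<Rightarrow> bool" where
  "l2_eq f g \<longleftrightarrow> (AE x in lborel. f x = g x)"

definition l2_inner :: "('a::euclidean_space \<Rightarrow> complex) \<Rightarrow> ('a \<Rightarrow> complex) \<Rightarrow> complex" where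
  "l2_inner f g = (\<integral>x. f x * cnj (g x) \<partial>lborel)"

definition l2_norm :: "('a::euclidean_space \<Rightarrow> complex) \<Rightarrow> real" where
  "l2_norm f = sqrt (\<integral>x. (cmod (f x))\<^sup>2 \<partial>lborel)"

definition l2_zero :: "('a::euclidean_space \<Rightarrow> complex) set" where
  "l2_zero = {f \<in> L2. l2_eq f (\<lambda>_. 0)}"

definition l2_closure :: "('a::euclidean_space \<Rightarrow> complex) set \<Rightarrow> ('a \<Rightarrow> complex) set" where
  "l2_closure S = {f \<in> L2. \<forall>\<epsilon>>0. \<exists>g\<in>S. l2_norm (\<lambda>x. f x - g x) < \<epsilon>}"

definition closed_l2_subspace :: "('a::euclidean_space \<Rightarrow> complex) set \<Rightarrow> bool" where
  "closed_l2_subspace S \<longleftrightarrow>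
     S \<subseteq> L2 \<and> (\<lambda>_. 0) \<in> S \<and>
     (\<forall>f\<in>S. \<forall>g\<in>S. (\<lambda>x. f x + g x) \<in> S) \<and>
     (\<forall>c. \<forall>f\<in>S. (\<lambda>x. c * f x) \<in> S) \<and>
     l2_closure S \<subseteq> S"

definition l2_span :: "('i \<Rightarrow> 'a::euclidean_space \<Rightarrow> complex) \<Rightarrow> 'i set \<Rightarrow> ('a \<Rightarrow> complex) set" where
  "l2_span e I = {(\<lambda>x. \<Sum>i\<in>F. c i * e i x) | F c. finite F \<and> F \<subseteq> I}"

definition l2_orthonormal_basis ::
    "('i \<Rightarrow> 'a::euclidean_space \<Rightarrow> complex) \<Rightarrow> 'i set \<Rightarrow> ('a \<Rightarrow> complex) set \<Rightarrow> bool" where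
  "l2_orthonormal_basis e I S \<longleftrightarrow>
     (\<forall>i\<in>I. e i \<in> L2) \<and>
     (\<forall>i\<in>I. \<forall>j\<in>I. l2_inner (e i) (e j) = (if i = j then 1 else 0)) \<and>
     l2_closure (l2_span e I) = S"

definition l2_orthogonal :: "('a::euclidean_space \<Rightarrow> complex) set \<Rightarrow> ('a \<Rightarrow> complex) set \<Rightarrow> bool" where
  "l2_orthogonal S T \<longleftrightarrow> (\<forall>f\<in>S. \<forall>g\<in>T. l2_inner f g = 0)"

definition l2_ominus ::
    "('a::euclidean_space \<Rightarrow> complex) set \<Rightarrow> ('a \<Rightarrow> complex) set \<Rightarrow> ('a \<Rightarrow> complex) set" where
  "l2_ominus S T = {f \<in> S. \<forall>g\<in>T. l2_inner f g = 0}"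

definition l2_sum ::
    "('a::euclidean_space \<Rightarrow> complex) set \<Rightarrow> ('a \<Rightarrow> complex) set \<Rightarrow> ('a \<Rightarrow> complex) set" where
  "l2_sum S T = {(\<lambda>x. f x + g x) | f g. f \<in> S \<and> g \<in> T}"

text \<open>The choice is unique up to equality almost everywhere when \<open>S\<close> is a closed subspace.\<close>

definition l2_proj ::
    "('a::euclidean_space \<Rightarrow> complex) set \<Rightarrow> ('a \<Rightarrow> complex) \<Rightarrow> ('a \<Rightarrow> complex)" where
  "l2_proj S f = (SOME g. g \<in> S \<and> (\<forall>h\<in>S. l2_inner (\<lambda>x. f x - g x) h = 0))"

text \<open>
  A linear isometry of representatives automatically respects equality almost everywhere, so
  this describes exactly the unitary operators on the Hilbert space \<open>L\<^sup>2\<close>.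
\<close>

definition l2_unitary :: "(('a::euclidean_space \<Rightarrow> complex) \<Rightarrow> ('a \<Rightarrow> complex)) \<Rightarrow> bool" where
  "l2_unitary U \<longleftrightarrow>
     (\<forall>f\<in>L2. U f \<in> L2) \<and>
     (\<forall>f\<in>L2. \<forall>g\<in>L2. l2_eq (U (\<lambda>x. f x + g x)) (\<lambda>x. U f x + U g x)) \<and>
     (\<forall>c. \<forall>f\<in>L2. l2_eq (U (\<lambda>x. c * f x)) (\<lambda>x. c * U f x)) \<and>
     (\<forall>f\<in>L2. \<forall>g\<in>L2. l2_inner (U f) (U g) = l2_inner f g) \<and>
     (\<forall>g\<in>L2. \<exists>f\<in>L2. l2_eq (U f) g)"

definition l2_image ::
    "(('a::euclidean_space \<Rightarrow> complex) \<Rightarrow> ('a \<Rightarrow> complex)) \<Rightarrow> ('a \<Rightarrow> complex) set \<Rightarrow> ('a \<Rightarrow> complex) set" where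
  "l2_image U S = {g \<in> L2. \<exists>f\<in>S. l2_eq (U f) g}"

text \<open>Integer powers \<open>T\<^sup>i\<close> of a bijection \<open>T\<close>.\<close>

definition fun_powi :: "('a \<Rightarrow> 'a) \<Rightarrow> int \<Rightarrow> 'a \<Rightarrow> 'a" where
  "fun_powi T i = (if 0 \<le> i then T ^^ nat i else inv T ^^ nat (- i))"

definition translate :: "'a::euclidean_space \<Rightarrow> ('a \<Rightarrow> complex) \<Rightarrow> 'a \<Rightarrow> complex" where
  "translate k f = (\<lambda>x. f (x - k))"

definition dilate :: "real^2^2 \<Rightarrow> (real^2 \<Rightarrow> complex) \<Rightarrow> real^2 \<Rightarrow> complex" where
  "dilate M f = (\<lambda>x. complex_of_real (sqrt \<bar>det M\<bar>) * f (M *v x))"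

definition dilate1 :: "(real \<Rightarrow> complex) \<Rightarrow> real \<Rightarrow> complex" where
  "dilate1 f = (\<lambda>x. complex_of_real (sqrt 2) * f (2 * x))"

definition int_lattice :: "(real^2) set" where
  "int_lattice = {k. \<forall>i. k $ i \<in> \<int>}"

definition bmra ::
    "real^2^2 \<Rightarrow> real^2^2 \<Rightarrow> (real^2 \<Rightarrow> complex) \<Rightarrow> (int \<Rightarrow> int \<Rightarrow> (real^2 \<Rightarrow> complex) set) \<Rightarrow> bool" where
  "bmra A B \<phi> V \<longleftrightarrow>
     \<phi> \<in> L2 \<and>
     (\<forall>i j. closed_l2_subspace (V i j)) \<and>
     (\<forall>i j l m. i \<le> l \<longrightarrow> j \<le> m \<longrightarrow> V i j \<subseteq> V l m) \<and>
     (\<forall>i j. fun_powi (dilate A) i ` (fun_powi (dilate B) j ` V 0 0) = V i j) \<and>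
     (\<Inter>i. \<Inter>j. V i j) = l2_zero \<and>
     l2_closure (\<Union>i. \<Union>j. V i j) = L2 \<and>
     (\<forall>i j l m. \<forall>f\<in>L2.
        l2_eq (l2_proj (V i j) (l2_proj (V l m) f)) (l2_proj (V l m) (l2_proj (V i j) f))) \<and>
     l2_orthonormal_basis (\<lambda>k. translate k \<phi>) int_lattice (V 0 0)"

definition bmra_wavelet_space ::
    "(int \<Rightarrow> int \<Rightarrow> (real^2 \<Rightarrow> complex) set) \<Rightarrow> (real^2 \<Rightarrow> complex) set" where
  "bmra_wavelet_space V =
     l2_ominus (V 1 1)
       (l2_sum (l2_sum (l2_ominus (V 1 0) (V 0 0)) (l2_ominus (V 0 1) (V 0 0))) (V 0 0))"

definition is_wavelet :: "real^2^2 \<Rightarrow> real^2^2 \<Rightarrow> (real^2 \<Rightarrow> complex) \<Rightarrow> bool" where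
  "is_wavelet A B \<psi> \<longleftrightarrow>
     \<psi> \<in> L2 \<and>
     l2_orthonormal_basis
       (\<lambda>(m, n, k) x. complex_of_real (2 powr (real_of_int (m + n) / 2)) *
          \<psi> (fun_powi ((*v) A) m (fun_powi ((*v) B) n x) + k))
       (UNIV \<times> UNIV \<times> int_lattice) L2"

text \<open>
  The orthogonality clause makes the sum inside \<^const>\<open>bmra_wavelet_space\<close> an orthogonal direct
  sum; the other pairs of summands are orthogonal by construction.
\<close>

definition associated_wavelet ::
    "(int \<Rightarrow> int \<Rightarrow> (real^2 \<Rightarrow> complex) set) \<Rightarrow> (real^2 \<Rightarrow> complex) \<Rightarrow> bool" where
  "associated_wavelet V \<psi> \<longleftrightarrow>
     l2_orthogonal (l2_ominus (V 1 0) (V 0 0)) (l2_ominus (V 0 1) (V 0 0)) \<and>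
     l2_orthonormal_basis (\<lambda>k. translate k \<psi>) int_lattice (bmra_wavelet_space V)"

definition tensor_fun :: "(real \<Rightarrow> complex) \<Rightarrow> (real \<Rightarrow> complex) \<Rightarrow> real^2 \<Rightarrow> complex" where
  "tensor_fun f g = (\<lambda>x. f (x $ 1) * g (x $ 2))"

definition separable_fun :: "(real^2 \<Rightarrow> complex) \<Rightarrow> bool" where
  "separable_fun f \<longleftrightarrow> (\<exists>f\<^sub>1\<in>L2. \<exists>f\<^sub>2\<in>L2. l2_eq f (tensor_fun f\<^sub>1 f\<^sub>2))"

definition tensor_space ::
    "(real \<Rightarrow> complex) set \<Rightarrow> (real \<Rightarrow> complex) set \<Rightarrow> (real^2 \<Rightarrow> complex) set" where
  "tensor_space S T = l2_closure (l2_span (\<lambda>(f, g). tensor_fun f g) (S \<times> T))"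

definition mra :: "(real \<Rightarrow> complex) \<Rightarrow> (int \<Rightarrow> (real \<Rightarrow> complex) set) \<Rightarrow> bool" where
  "mra \<phi> V \<longleftrightarrow>
     \<phi> \<in> L2 \<and>
     (\<forall>i. closed_l2_subspace (V i)) \<and>
     (\<forall>i. V i \<subseteq> V (i + 1)) \<and>
     (\<Inter>i. V i) = l2_zero \<and>
     l2_closure (\<Union>i. V i) = L2 \<and>
     (\<forall>i. V i = fun_powi dilate1 i ` V 0) \<and>
     l2_orthonormal_basis (\<lambda>k. translate k \<phi>) \<int> (V 0)"

definition bmra_unitarily_equivalent ::
    "real^2^2 \<Rightarrow> real^2^2 \<Rightarrow>
     (real^2 \<Rightarrow> complex) \<Rightarrow> (int \<Rightarrow> int \<Rightarrow> (real^2 \<Rightarrow> complex) set) \<Rightarrow>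
     (real^2 \<Rightarrow> complex) \<Rightarrow> (int \<Rightarrow> int \<Rightarrow> (real^2 \<Rightarrow> complex) set) \<Rightarrow> bool" where
  "bmra_unitarily_equivalent A B \<phi> V \<phi>' V' \<longleftrightarrow>
     (\<exists>U. l2_unitary U \<and>
        (\<forall>f\<in>L2. l2_eq (U (dilate A f)) (dilate A (U f))) \<and>
        (\<forall>f\<in>L2. l2_eq (U (dilate B f)) (dilate B (U f))) \<and>
        (\<forall>k\<in>int_lattice. \<forall>f\<in>L2. l2_eq (U (translate k f)) (translate k (U f))) \<and>
        l2_eq (U \<phi>) \<phi>' \<and>
        (\<forall>i j. l2_image U (V i j) = V' i j))"

definition separable_bmra ::
    "real^2^2 \<Rightarrow> real^2^2 \<Rightarrow> (real^2 \<Rightarrow> complex) \<Rightarrow> (int \<Rightarrow> int \<Rightarrow> (real^2 \<Rightarrow> complex) set) \<Rightarrow> bool" where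
  "separable_bmra A B \<phi> V \<longleftrightarrow>
     (\<exists>\<phi>\<^sub>1 V\<^sub>1 \<phi>\<^sub>2 V\<^sub>2. mra \<phi>\<^sub>1 V\<^sub>1 \<and> mra \<phi>\<^sub>2 V\<^sub>2 \<and>
        bmra_unitarily_equivalent A B \<phi> V
          (tensor_fun \<phi>\<^sub>1 \<phi>\<^sub>2) (\<lambda>i j. tensor_space (V\<^sub>1 i) (V\<^sub>2 j)))"

definition fourier_integral :: "('a::euclidean_space \<Rightarrow> complex) \<Rightarrow> 'a \<Rightarrow> complex" where
  "fourier_integral f \<xi> = (\<integral>x. f x * cis (- (2 * pi * (x \<bullet> \<xi>))) \<partial>lborel)"

text \<open>
  The graph of the Fourier transform on \<open>L\<^sup>2\<close>, the continuous extension of the Fourier integral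
  from \<open>L\<^sup>1 \<inter> L\<^sup>2\<close>. It determines \<open>g\<close> up to equality almost everywhere.
\<close>

definition has_fourier_transform ::
    "('a::euclidean_space \<Rightarrow> complex) \<Rightarrow> ('a \<Rightarrow> complex) \<Rightarrow> bool" where
  "has_fourier_transform f g \<longleftrightarrow>
     f \<in> L2 \<and> g \<in> L2 \<and>
     (\<exists>s :: nat \<Rightarrow> 'a \<Rightarrow> complex.
        (\<forall>n. s n \<in> L2 \<and> integrable lborel (s n) \<and> fourier_integral (s n) \<in> L2) \<and>
        (\<lambda>n. l2_norm (\<lambda>x. s n x - f x)) \<longlonglongrightarrow> 0 \<and>
        (\<lambda>n. l2_norm (\<lambda>\<xi>. fourier_integral (s n) \<xi> - g \<xi>)) \<longlonglongrightarrow> 0)"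

definition ae_compactly_supported :: "('a::euclidean_space \<Rightarrow> complex) \<Rightarrow> bool" where
  "ae_compactly_supported g \<longleftrightarrow> (\<exists>K. compact K \<and> (AE \<xi> in lborel. \<xi> \<notin> K \<longrightarrow> g \<xi> = 0))"

end

theory Submission
  imports Defs "HOL-Probability.Levy"
begin

text \<open>
  On the Fourier side put \<open>\<rho>(x, y) = 4/3 \<bar>x\<bar>\<close> if \<open>x y > 0\<close> and \<open>\<rho>(x, y) = 4 \<bar>x\<bar>\<close> otherwise, and let
  \<open>V i j\<close> consist of the functions whose Fourier transform lives on \<open>\<rho> < 2 ^ i\<close>, \<open>2 \<bar>y\<bar> < 2 ^ j\<close>.
  All conditions on the subspaces become statements about these sets, which are scaled by the two
  dilations because \<open>\<rho>\<close> is homogeneous in \<open>x\<close> and depends on \<open>y\<close> only through its sign. The set for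
  \<open>i = j = 0\<close> and the set \<open>1 \<le> \<rho> < 2\<close>, \<open>1 \<le> 2 \<bar>y\<bar> < 2\<close> are both unions of rectangles that tile the plane
  under integer translations, so the exponentials form orthonormal bases on them; their inverse
  Fourier transforms are the scaling function and the wavelet. The dyadic dilates of the second set
  tile the plane. Both sets are symmetric under \<open>v \<mapsto> - v\<close>, so the functions are real.

  For a product \<open>f\<close> the autocorrelation \<open>R(t) = \<langle>f, f(\<cdot> - t)\<rangle>\<close> factorizes, hence
  \<open>R(1/2, 1) R(0, 0) = R(1/2, 0) R(0, 1)\<close>, where \<open>R(0, 1) = 0\<close> by orthonormality. Here
  \<open>R(1/2, 1) \<noteq> 0\<close> for both functions. A unitary operator that commutes with the dilations and the
  integer translations commutes with the translation by \<open>(1/2, 1)\<close> too, so it preserves these values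
  of \<open>R\<close>.
\<close>

section \<open>The space of square-integrable functions\<close>

text \<open>The factors 4/3 and 4 come from the tiling conditions. Over the upper half-plane let rho
  < 1 cut out the x-interval (a - 1, a), and over the lower one its mirror image. Its length is 1
  for every a in (0, 1). Over the upper half-plane 1 \<le> rho < 2 has the pieces
  [a, 2 a) and (2 a - 2, a - 1], and shifting the second by 1 completes the first to an interval of
  length 1. So all these a give tilings, and both functions take the value 4 cos (pi a) / pi^2 at
  (1/2, 1). It vanishes only for a = 1/2, the tensor product of two Shannon analyses; the proof
  takes a = 3/4. The shift in the test must leave the lattice: at integer points the autocorrelation
  of an orthonormal system of translates is 1 at 0 and 0 elsewhere, separable or not. Half-integer
  shifts are still within reach of the equivalence because a dilation conjugates integer
  translations into them. The main labour is the Fourier transform on L2 of the plane. It is the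
  isometric extension of explicit values on box indicators, and so is its inverse; identities for it
  are checked on boxes and extended by density.\<close>

lemma L2I:
  assumes "f \<in> borel_measurable lborel" "integrable lborel (\<lambda>x. (cmod (f x))\<^sup>2)"
  shows "f \<in> L2"
  using assms by (simp add: L2_def)

lemma L2_measurable: "f \<in> L2 \<Longrightarrow> f \<in> borel_measurable lborel"
  by (simp add: L2_def)

lemma L2_measurable_borel [measurable_dest]: "f \<in> L2 \<Longrightarrow> f \<in> borel_measurable borel"
  using L2_measurable by simp

lemma L2_integrable: "f \<in> L2 \<Longrightarrow> integrable lborel (\<lambda>x. (cmod (f x))\<^sup>2)"
  by (simp add: L2_def)

lemma L2_dominated:
  assumes "f \<in> borel_measurable lborel" "g \<in> L2" "AE x in lborel. cmod (f x) \<le> cmod (g x)"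
  shows "f \<in> L2"
proof (rule L2I[OF assms(1)])
  show "integrable lborel (\<lambda>x. (cmod (f x))\<^sup>2)"
    by (rule Bochner_Integration.integrable_bound[OF L2_integrable[OF assms(2)]])
      (use assms in \<open>auto intro!: borel_measurable_power elim!: AE_mp intro!: AE_I2 power_mono\<close>)
qed

lemma L2_cmult: "f \<in> L2 \<Longrightarrow> (\<lambda>x. c * f x) \<in> L2"
  by (auto simp: L2_def norm_mult power_mult_distrib)

lemma L2_add:
  assumes f: "f \<in> L2" and g: "g \<in> L2"
  shows "(\<lambda>x. f x + g x) \<in> L2"
proof (rule L2I)
  note [measurable] = f g
  show "(\<lambda>x. f x + g x) \<in> borel_measurable lborel" by measurable
  have "integrable lborel (\<lambda>x. 2 * (cmod (f x))\<^sup>2 + 2 * (cmod (g x))\<^sup>2)"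
    using f g by (auto intro!: Bochner_Integration.integrable_add simp: L2_def)
  then show "integrable lborel (\<lambda>x. (cmod (f x + g x))\<^sup>2)"
  proof (rule Bochner_Integration.integrable_bound)
    show "(\<lambda>x. (cmod (f x + g x))\<^sup>2) \<in> borel_measurable lborel" by measurable
    have "(cmod (f x + g x))\<^sup>2 \<le> 2 * (cmod (f x))\<^sup>2 + 2 * (cmod (g x))\<^sup>2" for x
    proof -
      have "(cmod (f x + g x))\<^sup>2 \<le> (cmod (f x) + cmod (g x))\<^sup>2"
        by (intro power_mono norm_triangle_ineq) auto
      also have "\<dots> \<le> 2 * (cmod (f x))\<^sup>2 + 2 * (cmod (g x))\<^sup>2"
        using sum_squares_bound[of "cmod (f x)" "cmod (g x)"] by (simp add: power2_sum)
      finally show ?thesis .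
    qed
    then show "AE x in lborel. norm ((cmod (f x + g x))\<^sup>2) \<le> norm (2 * (cmod (f x))\<^sup>2 + 2 * (cmod (g x))\<^sup>2)"
      by (auto intro!: AE_I2 order_trans[OF _ abs_ge_self])
  qed
qed

lemma L2_zero [simp]: "(\<lambda>_. 0) \<in> L2"
  by (auto simp: L2_def)

lemma L2_diff: "f \<in> L2 \<Longrightarrow> g \<in> L2 \<Longrightarrow> (\<lambda>x. f x - g x) \<in> L2"
  using L2_add[OF _ L2_cmult[of g "-1"], of f] by simp

lemma L2_sum: "(\<And>i. i \<in> I \<Longrightarrow> f i \<in> L2) \<Longrightarrow> (\<lambda>x. \<Sum>i\<in>I. f i x) \<in> L2"
  by (induction I rule: infinite_finite_induct) (auto intro: L2_add)

lemma L2_mult_bounded: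
  assumes f: "f \<in> L2" and h: "h \<in> borel_measurable lborel" "\<And>x. cmod (h x) \<le> C"
  shows "(\<lambda>x. h x * f x) \<in> L2"
proof (rule L2_dominated[OF _ L2_cmult[OF f, of "of_real C"]])
  note [measurable] = f h(1)
  show "(\<lambda>x. h x * f x) \<in> borel_measurable lborel" by measurable
  show "AE x in lborel. cmod (h x * f x) \<le> cmod (of_real C * f x)"
    by (intro AE_I2) (auto simp: norm_mult intro!: mult_right_mono order_trans[OF h(2)])
qed

lemma L2_cnj: "f \<in> L2 \<Longrightarrow> (\<lambda>x. cnj (f x)) \<in> L2"
  unfolding L2_def by (auto intro: borel_measurable_continuous_on[OF continuous_on_cnj[OF continuous_on_id]])

section \<open>Inner product and norm\<close>

lemma integrable_mult_L2:
  assumes f: "f \<in> L2" and g: "g \<in> L2"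
  shows "integrable lborel (\<lambda>x. f x * g x)"
proof -
  note [measurable] = f g
  have "integrable lborel (\<lambda>x. (cmod (f x))\<^sup>2 + (cmod (g x))\<^sup>2)"
    using f g by (auto simp: L2_def)
  then show ?thesis
  proof (rule Bochner_Integration.integrable_bound)
    show "(\<lambda>x. f x * g x) \<in> borel_measurable lborel" by measurable
    have "cmod (f x * g x) \<le> (cmod (f x))\<^sup>2 + (cmod (g x))\<^sup>2" for x
    proof -
      have "2 * (cmod (f x) * cmod (g x)) \<le> (cmod (f x))\<^sup>2 + (cmod (g x))\<^sup>2"
        using sum_squares_bound[of "cmod (f x)" "cmod (g x)"] by simp
      moreover have "0 \<le> cmod (f x) * cmod (g x)" by simp
      ultimately show ?thesis unfolding norm_mult by linarith
    qed
    then show "AE x in lborel. cmod (f x * g x) \<le> norm ((cmod (f x))\<^sup>2 + (cmod (g x))\<^sup>2)"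
      by (auto intro!: AE_I2 order_trans[OF _ abs_ge_self])
  qed
qed

lemma integrable_L2_inner: "f \<in> L2 \<Longrightarrow> g \<in> L2 \<Longrightarrow> integrable lborel (\<lambda>x. f x * cnj (g x))"
  by (intro integrable_mult_L2 L2_cnj)

lemma l2_inner_add_left:
  "f \<in> L2 \<Longrightarrow> g \<in> L2 \<Longrightarrow> h \<in> L2 \<Longrightarrow> l2_inner (\<lambda>x. f x + g x) h = l2_inner f h + l2_inner g h"
  unfolding l2_inner_def by (simp add: distrib_right integrable_L2_inner)

lemma l2_inner_diff_left:
  "f \<in> L2 \<Longrightarrow> g \<in> L2 \<Longrightarrow> h \<in> L2 \<Longrightarrow> l2_inner (\<lambda>x. f x - g x) h = l2_inner f h - l2_inner g h"
  unfolding l2_inner_def by (simp add: left_diff_distrib integrable_L2_inner)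

lemma l2_inner_add_right:
  "f \<in> L2 \<Longrightarrow> g \<in> L2 \<Longrightarrow> h \<in> L2 \<Longrightarrow> l2_inner h (\<lambda>x. f x + g x) = l2_inner h f + l2_inner h g"
  unfolding l2_inner_def by (simp add: distrib_left integrable_L2_inner)

lemma l2_inner_diff_right:
  "f \<in> L2 \<Longrightarrow> g \<in> L2 \<Longrightarrow> h \<in> L2 \<Longrightarrow> l2_inner h (\<lambda>x. f x - g x) = l2_inner h f - l2_inner h g"
  unfolding l2_inner_def by (simp add: right_diff_distrib integrable_L2_inner)

lemma l2_inner_cmult_left: "l2_inner (\<lambda>x. c * f x) h = c * l2_inner f h"
  unfolding l2_inner_def by (simp add: mult.assoc)

lemma l2_inner_cmult_right: "l2_inner h (\<lambda>x. c * f x) = cnj c * l2_inner h f"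
  unfolding l2_inner_def by (simp add: mult.left_commute)

lemma l2_inner_zero [simp]: "l2_inner (\<lambda>_. 0) h = 0" "l2_inner h (\<lambda>_. 0) = 0"
  unfolding l2_inner_def by simp_all

lemma l2_inner_sum_left:
  "(\<And>i. i \<in> I \<Longrightarrow> f i \<in> L2) \<Longrightarrow> h \<in> L2 \<Longrightarrow> l2_inner (\<lambda>x. \<Sum>i\<in>I. f i x) h = (\<Sum>i\<in>I. l2_inner (f i) h)"
  by (induction I rule: infinite_finite_induct) (auto simp: l2_inner_add_left L2_sum)

lemma l2_inner_sum_right:
  "(\<And>i. i \<in> I \<Longrightarrow> f i \<in> L2) \<Longrightarrow> h \<in> L2 \<Longrightarrow> l2_inner h (\<lambda>x. \<Sum>i\<in>I. f i x) = (\<Sum>i\<in>I. l2_inner h (f i))"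
  by (induction I rule: infinite_finite_induct) (auto simp: l2_inner_add_right L2_sum)

lemma l2_inner_commute: "l2_inner g f = cnj (l2_inner f g)"
proof -
  have "cnj (l2_inner f g) = (\<integral>x. cnj (f x * cnj (g x)) \<partial>lborel)"
    unfolding l2_inner_def by (rule Bochner_Integration.integral_cnj[symmetric])
  then show ?thesis by (simp add: l2_inner_def mult.commute)
qed

lemma l2_norm_nonneg [simp]: "0 \<le> l2_norm f"
  by (simp add: l2_norm_def)

lemma l2_norm_sq: "(l2_norm f)\<^sup>2 = (\<integral>x. (cmod (f x))\<^sup>2 \<partial>lborel)"
  by (simp add: l2_norm_def)

lemma l2_inner_self: "l2_inner f f = of_real ((l2_norm f)\<^sup>2)"
  unfolding l2_inner_def l2_norm_sq integral_complex_of_real[symmetric]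
  by (intro Bochner_Integration.integral_cong) (simp_all add: complex_norm_square del: of_real_power)

text \<open>The two functions may live on different spaces, so that this serves isometries from one
  space to another.\<close>

lemma l2_norm_eq_if_inner_eq:
  fixes f :: "'a::euclidean_space \<Rightarrow> complex" and g :: "'b::euclidean_space \<Rightarrow> complex"
  shows "l2_inner f f = l2_inner g g \<Longrightarrow> l2_norm f = l2_norm g"
  by (simp add: l2_inner_self of_real_eq_iff power2_eq_iff_nonneg del: of_real_power)

lemma l2_inner_cong:
  assumes "l2_eq f f'" "l2_eq g g'" "f \<in> L2" "f' \<in> L2" "g \<in> L2" "g' \<in> L2"
  shows "l2_inner f g = l2_inner f' g'"
  unfolding l2_inner_def
proof (rule integral_cong_AE)
  show "(\<lambda>x. f x * cnj (g x)) \<in> borel_measurable lborel" "(\<lambda>x. f' x * cnj (g' x)) \<in> borel_measurable lborel"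
    by (rule borel_measurable_integrable[OF integrable_L2_inner[OF assms(3,5)]])
       (rule borel_measurable_integrable[OF integrable_L2_inner[OF assms(4,6)]])
  show "AE x in lborel. f x * cnj (g x) = f' x * cnj (g' x)"
    using assms(1,2) unfolding l2_eq_def by eventually_elim simp
qed

lemma l2_norm_cong:
  assumes "l2_eq f f'" "f \<in> L2" "f' \<in> L2"
  shows "l2_norm f = l2_norm f'"
  using l2_norm_eq_if_inner_eq[OF l2_inner_cong[OF assms(1,1)]] assms by blast

lemma l2_norm_zero [simp]: "l2_norm (\<lambda>_. 0) = 0"
  by (simp add: l2_norm_def)

lemma l2_norm_eq_0_iff:
  assumes "f \<in> L2" shows "l2_norm f = 0 \<longleftrightarrow> l2_eq f (\<lambda>_. 0)"
proof -
  have "l2_norm f = 0 \<longleftrightarrow> (AE x in lborel. (cmod (f x))\<^sup>2 = 0)"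
    unfolding l2_norm_def using integral_nonneg_eq_0_iff_AE[OF L2_integrable[OF assms]] by simp
  then show ?thesis by (simp add: l2_eq_def)
qed

lemma l2_norm_cmult: "l2_norm (\<lambda>x. c * f x) = cmod c * l2_norm f"
  by (simp add: l2_norm_def norm_mult power_mult_distrib real_sqrt_mult)

lemma l2_norm_minus_commute: "l2_norm (\<lambda>x. f x - g x) = l2_norm (\<lambda>x. g x - f x)"
  by (simp add: l2_norm_def norm_minus_commute)

lemma l2_Cauchy_Schwarz:
  assumes f: "f \<in> L2" and g: "g \<in> L2"
  shows "cmod (l2_inner f g) \<le> l2_norm f * l2_norm g"
proof (cases "l2_norm g = 0")
  case True
  then have "l2_eq g (\<lambda>_. 0)" using l2_norm_eq_0_iff[OF g] by simp
  then have "l2_inner f g = l2_inner f (\<lambda>_. 0)"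
    using f g by (intro l2_inner_cong) (auto simp: l2_eq_def)
  then show ?thesis by simp
next
  case False
  define b where "b = (l2_norm g)\<^sup>2"
  \<comment> \<open>\<open>c\<close> is the coefficient of the projection of \<open>f\<close> onto
    \<open>g\<close>; the inequality says that the squared norm of the remainder is
    nonnegative.\<close>
  define c where "c = l2_inner f g / of_real b"
  have b: "b > 0" using False by (auto simp: b_def)
  have cg: "(\<lambda>x. c * g x) \<in> L2" by (rule L2_cmult[OF g])
  have "of_real ((l2_norm (\<lambda>x. f x - c * g x))\<^sup>2) = l2_inner (\<lambda>x. f x - c * g x) (\<lambda>x. f x - c * g x)"
    by (rule l2_inner_self[symmetric])
  also have "\<dots> = l2_inner f f - cnj c * l2_inner f g - c * l2_inner g f + c * cnj c * l2_inner g g"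
    by (simp add: l2_inner_diff_left l2_inner_diff_right f g cg L2_diff l2_inner_cmult_left
        l2_inner_cmult_right algebra_simps)
  also have "\<dots> = of_real ((l2_norm f)\<^sup>2 - (cmod (l2_inner f g))\<^sup>2 / b)"
  proof -
    have 1: "l2_inner g g = of_real b" by (simp add: l2_inner_self b_def)
    have 2: "l2_inner g f = cnj (l2_inner f g)" by (rule l2_inner_commute)
    have 3: "l2_inner f g * cnj (l2_inner f g) = (of_real (cmod (l2_inner f g)))\<^sup>2"
      using complex_norm_square by simp
    show ?thesis using b
      by (simp add: 1 2 c_def l2_inner_self[of f] 3 mult.commute)
  qed
  finally have "(l2_norm f)\<^sup>2 - (cmod (l2_inner f g))\<^sup>2 / b \<ge> 0"
    unfolding of_real_eq_iff by (metis zero_le_power2)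
  then have "(cmod (l2_inner f g))\<^sup>2 \<le> (l2_norm f * l2_norm g)\<^sup>2"
    using b by (simp add: field_simps b_def power_mult_distrib)
  then show ?thesis by (rule power2_le_imp_le) simp
qed

lemma l2_norm_triangle:
  assumes f: "f \<in> L2" and g: "g \<in> L2"
  shows "l2_norm (\<lambda>x. f x + g x) \<le> l2_norm f + l2_norm g"
proof (rule power2_le_imp_le)
  have "of_real ((l2_norm (\<lambda>x. f x + g x))\<^sup>2) = l2_inner (\<lambda>x. f x + g x) (\<lambda>x. f x + g x)"
    by (rule l2_inner_self[symmetric])
  also have "\<dots> = l2_inner f f + l2_inner g g + (l2_inner f g + cnj (l2_inner f g))"
    by (simp add: l2_inner_add_left l2_inner_add_right f g L2_add l2_inner_commute[of g f])
  also have "\<dots> = of_real ((l2_norm f)\<^sup>2 + (l2_norm g)\<^sup>2 + 2 * Re (l2_inner f g))"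
    by (simp add: l2_inner_self complex_add_cnj)
  finally have "(l2_norm (\<lambda>x. f x + g x))\<^sup>2 = (l2_norm f)\<^sup>2 + (l2_norm g)\<^sup>2 + 2 * Re (l2_inner f g)"
    unfolding of_real_eq_iff .
  also have "Re (l2_inner f g) \<le> l2_norm f * l2_norm g"
    using l2_Cauchy_Schwarz[OF f g] complex_Re_le_cmod order_trans by blast
  finally show "(l2_norm (\<lambda>x. f x + g x))\<^sup>2 \<le> (l2_norm f + l2_norm g)\<^sup>2"
    by (simp add: power2_sum)
qed simp

lemma l2_norm_diff_triangle:
  assumes "f \<in> L2" "g \<in> L2" "h \<in> L2"
  shows "l2_norm (\<lambda>x. f x - h x) \<le> l2_norm (\<lambda>x. f x - g x) + l2_norm (\<lambda>x. g x - h x)"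
  using l2_norm_triangle[OF L2_diff[of f g] L2_diff[of g h]] assms by simp

lemma l2_norm_sum_le:
  "(\<And>i. i \<in> I \<Longrightarrow> f i \<in> L2) \<Longrightarrow> l2_norm (\<lambda>x. \<Sum>i\<in>I. f i x) \<le> (\<Sum>i\<in>I. l2_norm (f i))"
proof (induction I rule: infinite_finite_induct)
  case (insert i I)
  then have "l2_norm (\<lambda>x. f i x + (\<Sum>i\<in>I. f i x)) \<le> l2_norm (f i) + l2_norm (\<lambda>x. \<Sum>i\<in>I. f i x)"
    by (intro l2_norm_triangle L2_sum) auto
  then show ?case using insert by fastforce
qed auto

section \<open>Dominated convergence and completeness\<close>

lemma l2_dominated_convergence:
  fixes f :: "'a::euclidean_space \<Rightarrow> complex"
  assumes s: "\<And>n. s n \<in> borel_measurable lborel" and f: "f \<in> borel_measurable lborel"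
    and w: "integrable lborel (\<lambda>x. (w x)\<^sup>2)"
    and b: "\<And>n. AE x in lborel. cmod (s n x) \<le> w x"
    and l: "AE x in lborel. (\<lambda>n. s n x) \<longlonglongrightarrow> f x"
  shows "f \<in> L2" "\<And>n. s n \<in> L2" "(\<lambda>n. l2_norm (\<lambda>x. s n x - f x)) \<longlonglongrightarrow> 0"
proof -
  note [measurable] = s f
  have b': "AE x in lborel. \<forall>n. cmod (s n x) \<le> w x"
    using b by (simp add: AE_all_countable)
  have fb: "AE x in lborel. cmod (f x) \<le> w x"
    using b' l
  proof eventually_elim
    case (elim x)
    show ?case
      by (rule tendsto_upperbound[OF tendsto_norm[OF elim(2)]]) (use elim(1) in auto)
  qed
  have *: "g \<in> L2" if [measurable]: "g \<in> borel_measurable lborel" and g: "AE x in lborel. cmod (g x) \<le> w x" for g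
  proof (rule L2I)
    show "integrable lborel (\<lambda>x. (cmod (g x))\<^sup>2)"
    proof (rule Bochner_Integration.integrable_bound[OF w])
      show "AE x in lborel. norm ((cmod (g x))\<^sup>2) \<le> norm ((w x)\<^sup>2)"
        using g by eventually_elim (auto intro!: power_mono)
    qed measurable
  qed fact
  show fL: "f \<in> L2" by (rule *[OF f fb])
  show "s n \<in> L2" for n by (rule *[OF s b])
  have "(\<lambda>n. \<integral>x. (cmod (s n x - f x))\<^sup>2 \<partial>lborel) \<longlonglongrightarrow> (\<integral>x. 0 \<partial>(lborel :: 'a measure))"
  \<comment> \<open>Both \<open>s n\<close> and the limit are bounded by \<open>w\<close>, so their
    difference is bounded by \<open>2 * w\<close>.\<close>
  proof (rule integral_dominated_convergence[where w = "\<lambda>x. 4 * (w x)\<^sup>2"])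
    show "integrable lborel (\<lambda>x. 4 * (w x)\<^sup>2)" using w by simp
    show "AE x in lborel. (\<lambda>n. (cmod (s n x - f x))\<^sup>2) \<longlonglongrightarrow> 0"
      using l
    proof eventually_elim
      case (elim x)
      have "(\<lambda>n. (cmod (s n x - f x))\<^sup>2) \<longlonglongrightarrow> (cmod (f x - f x))\<^sup>2"
        by (intro tendsto_intros elim)
      then show ?case by simp
    qed
    fix n
    show "AE x in lborel. norm ((cmod (s n x - f x))\<^sup>2) \<le> 4 * (w x)\<^sup>2"
      using b[of n] fb
    proof eventually_elim
      case (elim x)
      have "cmod (s n x - f x) \<le> 2 * w x"
        using norm_triangle_ineq4[of "s n x" "f x"] elim by linarith
      then have "(cmod (s n x - f x))\<^sup>2 \<le> (2 * w x)\<^sup>2" by (intro power_mono) auto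
      then show ?case by (simp add: power_mult_distrib)
    qed
  qed measurable
  then have "(\<lambda>n. sqrt (\<integral>x. (cmod (s n x - f x))\<^sup>2 \<partial>lborel)) \<longlonglongrightarrow> sqrt 0"
    by (intro tendsto_real_sqrt) simp
  then show "(\<lambda>n. l2_norm (\<lambda>x. s n x - f x)) \<longlonglongrightarrow> 0"
    by (simp add: l2_norm_def)
qed

lemma nn_integral_L2: "f \<in> L2 \<Longrightarrow> (\<integral>\<^sup>+x. ennreal ((cmod (f x))\<^sup>2) \<partial>lborel) = ennreal ((l2_norm f)\<^sup>2)"
  unfolding l2_norm_sq by (rule nn_integral_eq_integral) (auto simp: L2_integrable)

text \<open>Fatou's lemma bounds a nonnegative integral before integrability is known, hence this
  form.\<close>

lemma L2_nn_integral_le: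
  assumes f: "f \<in> borel_measurable lborel" and c: "0 \<le> c"
    and le: "(\<integral>\<^sup>+x. ennreal ((cmod (f x))\<^sup>2) \<partial>lborel) \<le> ennreal (c\<^sup>2)"
  shows "f \<in> L2" "l2_norm f \<le> c"
proof -
  note [measurable] = f
  show L: "f \<in> L2"
  proof (rule L2I[OF f])
    show "integrable lborel (\<lambda>x. (cmod (f x))\<^sup>2)"
      unfolding integrable_iff_bounded using le by (auto simp: le_less_trans)
  qed
  have "ennreal ((l2_norm f)\<^sup>2) \<le> ennreal (c\<^sup>2)"
    using le nn_integral_L2[OF L] by simp
  then show "l2_norm f \<le> c" using c by (simp add: power2_le_iff_abs_le)
qed

text \<open>The Riesz-Fischer argument. The increments are summable in norm, so by monotone
  convergence the sum of their absolute values is finite almost everywhere and the sequence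
  converges pointwise; Fatou's lemma turns this into convergence in norm. The geometric rate is no
  restriction where approximants can be chosen as close as desired.\<close>

lemma l2_complete:
  fixes s :: "nat \<Rightarrow> 'a::euclidean_space \<Rightarrow> complex"
  assumes s: "\<And>n. s n \<in> L2" and fast: "\<And>n. l2_norm (\<lambda>x. s (Suc n) x - s n x) \<le> (1/2)^n"
  obtains f where "f \<in> L2" "(\<lambda>n. l2_norm (\<lambda>x. s n x - f x)) \<longlonglongrightarrow> 0"
proof -
  note [measurable] = s
  define d where "d n x = s (Suc n) x - s n x" for n x
  have d[measurable]: "d n \<in> L2" for n unfolding d_def by (intro L2_diff s)
  define h where "h N x = (\<Sum>n<N. cmod (d n x))" for N x
  have hL: "(\<lambda>x. of_real (h N x) :: complex) \<in> L2" for N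
    unfolding h_def of_real_sum by (intro L2_sum L2_dominated[OF _ d]) auto
  have hn: "l2_norm (\<lambda>x. of_real (h N x)) \<le> 2" for N
  proof -
    have "l2_norm (\<lambda>x. of_real (h N x)) \<le> (\<Sum>n<N. l2_norm (\<lambda>x. of_real (cmod (d n x))))"
      unfolding h_def of_real_sum by (intro l2_norm_sum_le L2_dominated[OF _ d]) auto
    also have "\<dots> = (\<Sum>n<N. l2_norm (d n))" by (simp add: l2_norm_def)
    also have "\<dots> \<le> (\<Sum>n<N. (1/2)^n)" unfolding d_def by (intro sum_mono fast)
    also have "\<dots> \<le> 2" by (simp add: sum_gp_strict)
    finally show ?thesis .
  qed
  have h0: "0 \<le> h N x" for N x by (simp add: h_def sum_nonneg)
  have "(\<integral>\<^sup>+x. (SUP N. ennreal ((h N x)\<^sup>2)) \<partial>lborel) = (SUP N. (\<integral>\<^sup>+x. ennreal ((h N x)\<^sup>2) \<partial>lborel))"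
  proof (rule nn_integral_monotone_convergence_SUP)
    have "h N x \<le> h (Suc N) x" for N x by (simp add: h_def)
    then show "incseq (\<lambda>N x. ennreal ((h N x)\<^sup>2))"
      using h0 by (intro incseq_SucI le_funI ennreal_leI power_mono) auto
    show "(\<lambda>x. ennreal ((h N x)\<^sup>2)) \<in> borel_measurable lborel" for N
      unfolding h_def by measurable
  qed
  also have "\<dots> \<le> 4"
  proof (rule SUP_least)
    fix N
    have "(\<integral>\<^sup>+x. ennreal ((h N x)\<^sup>2) \<partial>lborel) = ennreal ((l2_norm (\<lambda>x. of_real (h N x)))\<^sup>2)"
      using nn_integral_L2[OF hL[of N]] by simp
    also have "\<dots> \<le> ennreal (2\<^sup>2)" by (intro ennreal_leI power_mono hn) simp
    finally show "(\<integral>\<^sup>+x. ennreal ((h N x)\<^sup>2) \<partial>lborel) \<le> 4" by simp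
  qed
  finally have "(\<integral>\<^sup>+x. (SUP N. ennreal ((h N x)\<^sup>2)) \<partial>lborel) \<noteq> \<infinity>"
    by (auto simp: top_unique)
  then have "AE x in lborel. (SUP N. ennreal ((h N x)\<^sup>2)) \<noteq> \<infinity>"
    by (intro nn_integral_PInf_AE) (unfold h_def, measurable)
  then have conv: "AE x in lborel. (\<lambda>n. s n x) \<longlonglongrightarrow> lim (\<lambda>n. s n x)"
  proof eventually_elim
    case (elim x)
    then obtain B where B: "B \<ge> 0" "(SUP N. ennreal ((h N x)\<^sup>2)) = ennreal B"
      by (metis ennreal_cases infinity_ennreal_def)
    have "summable (\<lambda>n. cmod (d n x))"
    proof (rule bounded_imp_summable)
      fix N
      have "ennreal ((h (Suc N) x)\<^sup>2) \<le> ennreal B" unfolding B(2)[symmetric] by (rule SUP_upper) simp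
      then have "(h (Suc N) x)\<^sup>2 \<le> B" using B(1) by simp
      then have "h (Suc N) x \<le> sqrt B" by (rule real_le_rsqrt)
      then show "(\<Sum>n\<le>N. cmod (d n x)) \<le> sqrt B"
        by (simp add: h_def lessThan_Suc_atMost)
    qed simp
    then have "summable (\<lambda>n. d n x)" by (rule summable_norm_cancel)
    then have "convergent (\<lambda>N. \<Sum>n<N. d n x)" by (simp add: summable_iff_convergent)
    moreover have "(\<Sum>n<N. d n x) = s N x - s 0 x" for N
      unfolding d_def by (rule sum_lessThan_telescope)
    ultimately have "convergent (\<lambda>N. s N x - s 0 x)" by simp
    then obtain L where "(\<lambda>N. s N x - s 0 x) \<longlonglongrightarrow> L" by (auto simp: convergent_def)
    from tendsto_add[OF this tendsto_const[of "s 0 x"]] have "convergent (\<lambda>N. s N x)"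
      by (auto simp: convergent_def)
    then show ?case by (simp add: convergent_LIMSEQ_iff)
  qed
  define f where "f x = lim (\<lambda>n. s n x)" for x
  have [measurable]: "f \<in> borel_measurable lborel"
    unfolding f_def by (intro borel_measurable_lim_metric) measurable
  have tail: "l2_norm (\<lambda>x. s m x - s N x) \<le> 2 * (1/2)^N" if "N \<le> m" for N m
  proof -
    have "s m x - s N x = (\<Sum>n\<in>{N..<m}. d n x)" for x
      unfolding d_def using that by (rule sum_Suc_diff'[symmetric])
    then have "l2_norm (\<lambda>x. s m x - s N x) \<le> (\<Sum>n\<in>{N..<m}. l2_norm (d n))"
      by (simp add: l2_norm_sum_le[OF d])
    also have "\<dots> \<le> (\<Sum>n\<in>{N..<m}. (1/2)^n)" unfolding d_def by (intro sum_mono fast)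
    also have "\<dots> \<le> 2 * (1/2)^N"
    proof -
      have "(\<Sum>n\<in>{N..<N + k}. (1/2::real)^n) = 2 * (1/2)^N - 2 * (1/2)^(N+k)" for k
        by (induction k) (simp_all add: algebra_simps)
      from this[of "m - N"] that show ?thesis by simp
    qed
    finally show ?thesis .
  qed
  \<comment> \<open>With \<open>N\<close> fixed and \<open>m\<close> tending to infinity, Fatou's
    lemma bounds the distance of the pointwise limit from \<open>s N\<close> by the tail of the
    geometric series.\<close>
  have F: "(\<lambda>x. f x - s N x) \<in> L2 \<and> l2_norm (\<lambda>x. f x - s N x) \<le> 2 * (1/2)^N" for N
  proof -
    have "(\<integral>\<^sup>+x. ennreal ((cmod (f x - s N x))\<^sup>2) \<partial>lborel)
        = (\<integral>\<^sup>+x. liminf (\<lambda>m. ennreal ((cmod (s m x - s N x))\<^sup>2)) \<partial>lborel)"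
    proof (rule nn_integral_cong_AE, use conv in eventually_elim)
      case (elim x)
      have "(\<lambda>m. ennreal ((cmod (s m x - s N x))\<^sup>2)) \<longlonglongrightarrow> ennreal ((cmod (f x - s N x))\<^sup>2)"
        using elim unfolding f_def[symmetric] by (intro tendsto_intros)
      from lim_imp_Liminf[OF _ this] show ?case by simp
    qed
    also have "\<dots> \<le> liminf (\<lambda>m. \<integral>\<^sup>+x. ennreal ((cmod (s m x - s N x))\<^sup>2) \<partial>lborel)"
      by (rule nn_integral_liminf) measurable
    also have "\<dots> \<le> ennreal ((2 * (1/2)^N)\<^sup>2)"
    proof (rule order_trans[OF Liminf_le_Limsup Limsup_bounded], simp, rule eventually_sequentiallyI[of N])
      fix m assume "N \<le> m"
      then show "(\<integral>\<^sup>+x. ennreal ((cmod (s m x - s N x))\<^sup>2) \<partial>lborel) \<le> ennreal ((2 * (1/2)^N)\<^sup>2)"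
        unfolding nn_integral_L2[OF L2_diff[OF s s]] by (intro ennreal_leI power_mono tail) auto
    qed
    finally show ?thesis
      using L2_nn_integral_le[of "\<lambda>x. f x - s N x" "2 * (1/2)^N"] by simp
  qed
  have "f \<in> L2" using L2_add[OF conjunct1[OF F[of 0]] s[of 0]] by simp
  moreover have "(\<lambda>n. l2_norm (\<lambda>x. s n x - f x)) \<longlonglongrightarrow> 0"
  proof (rule tendsto_sandwich[of "\<lambda>_. 0" _ _ "\<lambda>n. 2 * (1/2)^n"])
    show "\<forall>\<^sub>F n in sequentially. l2_norm (\<lambda>x. s n x - f x) \<le> 2 * (1/2)^n"
      using F by (subst l2_norm_minus_commute) simp
    have "(\<lambda>n. 2 * (1/2::real)^n) \<longlonglongrightarrow> 2 * 0" by (intro tendsto_intros LIMSEQ_power_zero) auto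
    then show "(\<lambda>n. 2 * (1/2::real)^n) \<longlonglongrightarrow> 0" by simp
  qed auto
  ultimately show thesis by (rule that)
qed

section \<open>Closed subspaces, closures and spans\<close>

lemma closed_l2_subspaceD:
  assumes "closed_l2_subspace C"
  shows "f \<in> C \<Longrightarrow> f \<in> L2" "(\<lambda>_. 0) \<in> C" "f \<in> C \<Longrightarrow> g \<in> C \<Longrightarrow> (\<lambda>x. f x + g x) \<in> C"
    "f \<in> C \<Longrightarrow> (\<lambda>x. c * f x) \<in> C" "l2_closure C \<subseteq> C"
  using assms unfolding closed_l2_subspace_def by blast+

lemma closed_l2_subspace_diff:
  "closed_l2_subspace C \<Longrightarrow> f \<in> C \<Longrightarrow> g \<in> C \<Longrightarrow> (\<lambda>x. f x - g x) \<in> C"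
  using closed_l2_subspaceD(3)[of C f "\<lambda>x. -1 * g x"] closed_l2_subspaceD(4)[of C g "-1"] by simp

lemma closed_l2_subspace_sum:
  "closed_l2_subspace C \<Longrightarrow> (\<And>i. i \<in> I \<Longrightarrow> f i \<in> C) \<Longrightarrow> (\<lambda>x. \<Sum>i\<in>I. f i x) \<in> C"
  by (induction I rule: infinite_finite_induct)
    (auto intro: closed_l2_subspaceD(3) simp: closed_l2_subspaceD(2))

lemma l2_closure_limI:
  assumes "f \<in> L2" "\<And>n. s n \<in> C" "(\<lambda>n. l2_norm (\<lambda>x. s n x - f x)) \<longlonglongrightarrow> 0"
  shows "f \<in> l2_closure C"
  unfolding l2_closure_def
proof (clarsimp simp: assms(1))
  fix e :: real assume "e > 0"
  from order_tendstoD(2)[OF assms(3) this] obtain n where "l2_norm (\<lambda>x. s n x - f x) < e"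
    by (auto simp: eventually_sequentially)
  then show "\<exists>g\<in>C. l2_norm (\<lambda>x. f x - g x) < e"
    using assms(2)[of n] l2_norm_minus_commute[of "s n" f] by auto
qed

lemma closed_l2_subspace_lim:
  "closed_l2_subspace C \<Longrightarrow> f \<in> L2 \<Longrightarrow> (\<And>n. s n \<in> C) \<Longrightarrow>
    (\<lambda>n. l2_norm (\<lambda>x. s n x - f x)) \<longlonglongrightarrow> 0 \<Longrightarrow> f \<in> C"
  using l2_closure_limI closed_l2_subspaceD(5) by blast

lemma l2_norm_diff_eq_0: "f \<in> L2 \<Longrightarrow> g \<in> L2 \<Longrightarrow> l2_eq f g \<longleftrightarrow> l2_norm (\<lambda>x. f x - g x) = 0"
  by (simp add: l2_norm_eq_0_iff L2_diff l2_eq_def)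

text \<open>A constant sequence \<open>f\<close> converges in norm to every function equal to it
  almost everywhere, so closedness includes independence of the representative.\<close>

lemma closed_l2_subspace_cong:
  assumes "closed_l2_subspace C" "f \<in> C" "g \<in> L2" "l2_eq f g"
  shows "g \<in> C"
  using closed_l2_subspace_lim[OF assms(1,3), of "\<lambda>_. f"] assms
  by (simp add: l2_norm_diff_eq_0 closed_l2_subspaceD(1))

text \<open>Pointwise convergence under a square-integrable majorant is convergence in norm; most
  limit passages below take this form.\<close>

lemma closed_l2_subspace_dominated:
  fixes f :: "'a::euclidean_space \<Rightarrow> complex"
  assumes C: "closed_l2_subspace C" and s: "\<And>n. s n \<in> C" and f: "f \<in> borel_measurable lborel"
    and w: "integrable lborel (\<lambda>x. (w x)\<^sup>2)"
    and b: "\<And>n. AE x in lborel. cmod (s n x) \<le> w x"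
    and l: "AE x in lborel. (\<lambda>n. s n x) \<longlonglongrightarrow> f x"
  shows "f \<in> C"
proof -
  have "s n \<in> borel_measurable lborel" for n
    using closed_l2_subspaceD(1)[OF C s] by (rule L2_measurable)
  note l2_dominated_convergence[OF this f w b l]
  then show ?thesis by (intro closed_l2_subspace_lim[OF C _ s])
qed

lemma l2_eq_refl [simp]: "l2_eq f f"
  by (simp add: l2_eq_def)

lemma l2_eq_sym: "l2_eq f g \<Longrightarrow> l2_eq g f"
  unfolding l2_eq_def by (auto elim: AE_mp)

lemma l2_eq_trans [trans]: "l2_eq f g \<Longrightarrow> l2_eq g h \<Longrightarrow> l2_eq f h"
  unfolding l2_eq_def by (auto elim: AE_mp)

lemma closed_l2_subspace_closure:
  assumes L: "S \<subseteq> L2" and z: "(\<lambda>_. 0) \<in> S"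
    and a: "\<And>f g. f \<in> S \<Longrightarrow> g \<in> S \<Longrightarrow> (\<lambda>x. f x + g x) \<in> S"
    and c: "\<And>c f. f \<in> S \<Longrightarrow> (\<lambda>x. c * f x) \<in> S"
  shows "closed_l2_subspace (l2_closure S)"
  unfolding closed_l2_subspace_def
proof (intro conjI ballI allI)
  show "l2_closure S \<subseteq> L2" by (auto simp: l2_closure_def)
  show "(\<lambda>_. 0) \<in> l2_closure S"
    using z by (auto simp: l2_closure_def intro!: bexI[of _ "\<lambda>_. 0"])
next
  fix f g assume f: "f \<in> l2_closure S" and g: "g \<in> l2_closure S"
  then have fL: "f \<in> L2" "g \<in> L2" by (auto simp: l2_closure_def)
  {
    fix e :: real assume "e > 0"
    then have e: "e / 2 > 0" by simp
    obtain f' where f': "f' \<in> S" "l2_norm (\<lambda>x. f x - f' x) < e / 2"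
      using f e unfolding l2_closure_def by blast
    obtain g' where g': "g' \<in> S" "l2_norm (\<lambda>x. g x - g' x) < e / 2"
      using g e unfolding l2_closure_def by blast
    have "l2_norm (\<lambda>x. (f x - f' x) + (g x - g' x)) \<le> l2_norm (\<lambda>x. f x - f' x) + l2_norm (\<lambda>x. g x - g' x)"
      using fL f'(1) g'(1) L by (intro l2_norm_triangle L2_diff) auto
    then have "l2_norm (\<lambda>x. (f x + g x) - (f' x + g' x)) < e"
      using f' g' by (simp add: algebra_simps)
    then have "\<exists>h\<in>S. l2_norm (\<lambda>x. (f x + g x) - h x) < e"
      using a[OF f'(1) g'(1)] by (intro bexI[of _ "\<lambda>x. f' x + g' x"])
  }
  then show "(\<lambda>x. f x + g x) \<in> l2_closure S"
    using fL by (auto simp: l2_closure_def intro: L2_add)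
next
  fix k f assume f: "f \<in> l2_closure S"
  then have fL: "f \<in> L2" by (auto simp: l2_closure_def)
  {
    fix e :: real assume "e > 0"
    \<comment> \<open>Adding 1 keeps the divisor positive also for \<open>k = 0\<close>.\<close>
    then have e: "e / (cmod k + 1) > 0" by (auto intro!: divide_pos_pos add_nonneg_pos)
    obtain f' where f': "f' \<in> S" "l2_norm (\<lambda>x. f x - f' x) < e / (cmod k + 1)"
      using f e unfolding l2_closure_def by blast
    have "l2_norm (\<lambda>x. k * (f x - f' x)) = cmod k * l2_norm (\<lambda>x. f x - f' x)"
      by (rule l2_norm_cmult)
    also have "\<dots> \<le> (cmod k + 1) * l2_norm (\<lambda>x. f x - f' x)"
      by (intro mult_right_mono) auto
    also have "\<dots> < e"
      using f'(2) by (subst (asm) pos_less_divide_eq) (auto simp: add_nonneg_pos mult.commute)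
    finally have "\<exists>h\<in>S. l2_norm (\<lambda>x. k * f x - h x) < e"
      using c[OF f'(1), of k] by (auto simp: right_diff_distrib)
  }
  then show "(\<lambda>x. k * f x) \<in> l2_closure S"
    using fL by (auto simp: l2_closure_def intro: L2_cmult)
next
  show "l2_closure (l2_closure S) \<subseteq> l2_closure S"
  proof
    fix f assume f: "f \<in> l2_closure (l2_closure S)"
    then have fL: "f \<in> L2" by (auto simp: l2_closure_def)
    {
      fix e :: real assume "e > 0"
      then have e: "e / 2 > 0" by simp
      obtain f' where f': "f' \<in> l2_closure S" "l2_norm (\<lambda>x. f x - f' x) < e / 2"
        using f e unfolding l2_closure_def[of "l2_closure S"] by blast
      obtain g where g: "g \<in> S" "l2_norm (\<lambda>x. f' x - g x) < e / 2"
        using f'(1) e unfolding l2_closure_def by blast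
      have "l2_norm (\<lambda>x. f x - g x) \<le> l2_norm (\<lambda>x. f x - f' x) + l2_norm (\<lambda>x. f' x - g x)"
        using fL f'(1) g(1) L by (intro l2_norm_diff_triangle) (auto simp: l2_closure_def)
      then have "\<exists>h\<in>S. l2_norm (\<lambda>x. f x - h x) < e"
        using f' g by (intro bexI[of _ g]) auto
    }
    then show "f \<in> l2_closure S" using fL by (auto simp: l2_closure_def)
  qed
qed

lemma l2_span_memI: "i \<in> I \<Longrightarrow> e i \<in> l2_span e I"
  unfolding l2_span_def by (intro CollectI exI[of _ "{i}"] exI[of _ "\<lambda>_. 1"]) auto

lemma closed_l2_subspace_span:
  assumes e: "\<And>i. i \<in> I \<Longrightarrow> e i \<in> L2"
  shows "closed_l2_subspace (l2_closure (l2_span e I))"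
proof (rule closed_l2_subspace_closure)
  show "l2_span e I \<subseteq> L2"
    unfolding l2_span_def using e by (auto intro!: L2_sum L2_cmult)
  show "(\<lambda>_. 0) \<in> l2_span e I"
    unfolding l2_span_def by (intro CollectI exI[of _ "{}"]) auto
next
  fix f g assume "f \<in> l2_span e I" "g \<in> l2_span e I"
  then obtain F c G d where f: "f = (\<lambda>x. \<Sum>i\<in>F. c i * e i x)" "finite F" "F \<subseteq> I"
    and g: "g = (\<lambda>x. \<Sum>i\<in>G. d i * e i x)" "finite G" "G \<subseteq> I"
    unfolding l2_span_def by blast
  \<comment> \<open>The index sets may overlap, so both coefficient families are extended by zero to
    the union and added there.\<close>
  define k where "k i = (if i \<in> F then c i else 0) + (if i \<in> G then d i else 0)" for i
  have "(\<Sum>i\<in>F. c i * e i x) = (\<Sum>i\<in>F \<union> G. (if i \<in> F then c i else 0) * e i x)" for x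
    using f(2) g(2) by (intro sum.mono_neutral_cong_left) auto
  moreover have "(\<Sum>i\<in>G. d i * e i x) = (\<Sum>i\<in>F \<union> G. (if i \<in> G then d i else 0) * e i x)" for x
    using f(2) g(2) by (intro sum.mono_neutral_cong_left) auto
  ultimately have "(\<lambda>x. f x + g x) = (\<lambda>x. \<Sum>i\<in>F \<union> G. k i * e i x)"
    by (simp add: f(1) g(1) k_def distrib_right sum.distrib)
  then show "(\<lambda>x. f x + g x) \<in> l2_span e I"
    unfolding l2_span_def using f g by (intro CollectI exI[of _ "F \<union> G"] exI[of _ k]) auto
next
  fix k f assume "f \<in> l2_span e I"
  then obtain F c where f: "f = (\<lambda>x. \<Sum>i\<in>F. c i * e i x)" "finite F" "F \<subseteq> I"
    unfolding l2_span_def by blast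
  then show "(\<lambda>x. k * f x) \<in> l2_span e I"
    unfolding l2_span_def
    by (intro CollectI exI[of _ F] exI[of _ "\<lambda>i. k * c i"]) (auto simp: sum_distrib_left mult.assoc)
qed

lemma l2_closure_superset: "S \<subseteq> L2 \<Longrightarrow> S \<subseteq> l2_closure S"
  unfolding l2_closure_def by (auto intro!: bexI)

lemma l2_closure_span_memI:
  assumes "\<And>i. i \<in> I \<Longrightarrow> e i \<in> L2" "i \<in> I"
  shows "e i \<in> l2_closure (l2_span e I)"
proof -
  have "l2_span e I \<subseteq> L2" unfolding l2_span_def using assms(1) by (auto intro!: L2_sum L2_cmult)
  then show ?thesis using l2_closure_superset l2_span_memI[OF assms(2), of e] by blast
qed

lemma l2_closure_span_subset:
  assumes C: "closed_l2_subspace C" and e: "\<And>i. i \<in> I \<Longrightarrow> e i \<in> C"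
  shows "l2_closure (l2_span e I) \<subseteq> C"
proof -
  have "l2_span e I \<subseteq> C"
    unfolding l2_span_def using e
    by (auto intro!: closed_l2_subspace_sum[OF C] closed_l2_subspaceD(4)[OF C])
  then have "l2_closure (l2_span e I) \<subseteq> l2_closure C"
    unfolding l2_closure_def by blast
  then show ?thesis using closed_l2_subspaceD(5)[OF C] by blast
qed

section \<open>Functions supported on a set, and density of box indicators\<close>

definition L2_on :: "'a::euclidean_space set \<Rightarrow> ('a \<Rightarrow> complex) set" where
  "L2_on S = {f \<in> L2. AE x in lborel. x \<notin> S \<longrightarrow> f x = 0}"

lemma L2_indicator_mult:
  assumes "f \<in> L2" "S \<in> sets borel"
  shows "(\<lambda>x. indicator S x * f x) \<in> L2"
  using assms by (intro L2_mult_bounded[where C = 1]) (auto simp: indicator_def)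

lemma L2_on_indicator_mult:
  assumes "f \<in> L2" "S \<in> sets borel"
  shows "(\<lambda>x. indicator S x * f x) \<in> L2_on S"
  using L2_indicator_mult[OF assms] by (auto simp: L2_on_def)

text \<open>For \<open>g\<close> supported in \<open>S\<close>, the part of \<open>f\<close> outside
  \<open>S\<close> is also the part of \<open>f - g\<close> there. Its norm is therefore at most the
  distance from \<open>f\<close> to the space.\<close>

lemma closed_l2_subspace_L2_on:
  assumes S: "S \<in> sets borel"
  shows "closed_l2_subspace (L2_on S)"
  unfolding closed_l2_subspace_def
proof (intro conjI ballI allI)
  fix f g assume "f \<in> L2_on S" "g \<in> L2_on S"
  then show "(\<lambda>x. f x + g x) \<in> L2_on S"
    unfolding L2_on_def by (auto intro: L2_add)
next
  show "l2_closure (L2_on S) \<subseteq> L2_on S"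
  proof
    fix f assume f: "f \<in> l2_closure (L2_on S)"
    then have fL: "f \<in> L2" by (auto simp: l2_closure_def)
    have cS: "- S \<in> sets borel" using S by auto
    have "l2_norm (\<lambda>x. indicator (- S) x * f x) \<le> 0 + e" if e: "e > 0" for e
    proof -
      obtain g where g: "g \<in> L2_on S" "l2_norm (\<lambda>x. f x - g x) < e"
        using f e unfolding l2_closure_def by blast
      have gL: "g \<in> L2" using g by (simp add: L2_on_def)
      have "l2_norm (\<lambda>x. indicator (- S) x * f x) \<le> l2_norm (\<lambda>x. f x - g x)"
        unfolding l2_norm_def real_sqrt_le_iff
      proof (rule integral_mono_AE)
        show "AE x in lborel. (cmod (indicator (- S) x * f x))\<^sup>2 \<le> (cmod (f x - g x))\<^sup>2"
          using g(1) unfolding L2_on_def by (auto elim!: AE_mp simp: indicator_def)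
      qed (intro L2_integrable L2_indicator_mult[OF fL cS] L2_diff fL gL)+
      then show ?thesis using g(2) by simp
    qed
    then have "l2_norm (\<lambda>x. indicator (- S) x * f x) \<le> 0" by (rule field_le_epsilon)
    then have "l2_norm (\<lambda>x. indicator (- S) x * f x) = 0" by (simp add: antisym)
    then have "AE x in lborel. indicator (- S) x * f x = 0"
      using l2_norm_eq_0_iff[OF L2_indicator_mult[OF fL cS]] by (simp add: l2_eq_def)
    then show "f \<in> L2_on S" using fL by (auto simp: L2_on_def indicator_def elim!: AE_mp)
  qed
qed (auto simp: L2_on_def L2_cmult)

lemma L2_indicator_finite:
  assumes "S \<in> sets borel" "emeasure lborel S < \<infinity>"
  shows "(indicator S :: 'a::euclidean_space \<Rightarrow> complex) \<in> L2"
proof (rule L2I)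
  have "(\<lambda>x. (cmod (indicator S x))\<^sup>2) = (indicator S :: 'a \<Rightarrow> real)"
    by (auto simp: indicator_def)
  then show "integrable lborel (\<lambda>x. (cmod (indicator S x))\<^sup>2)"
    using assms by simp
qed (use assms in auto)

lemma L2_indicator_bounded: "S \<in> sets borel \<Longrightarrow> bounded S \<Longrightarrow> (indicator S :: 'a::euclidean_space \<Rightarrow> complex) \<in> L2"
  using emeasure_bounded_finite[of S] by (intro L2_indicator_finite) auto

text \<open>Boxes are closed under intersection and generate the Borel sets, so a Dynkin class
  argument passes from boxes to Borel sets; simple functions and dominated convergence then reach
  all of L2. The extra set \<open>M\<close> lets the same argument prove completeness of a system
  that lives on a part of the space.\<close>

lemma closed_l2_subspace_contains_L2_on:
  fixes C :: "('a::euclidean_space \<Rightarrow> complex) set"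
  assumes C: "closed_l2_subspace C" and M: "M \<in> sets borel"
    and box: "\<And>a b. (indicator (box a b \<inter> M) :: 'a \<Rightarrow> complex) \<in> C"
    and f: "f \<in> L2"
  shows "(\<lambda>x. indicator M x * f x) \<in> C"
proof -
  note [measurable] = M f
  \<comment> \<open>The bounded cubes \<open>Q n\<close> keep the indicators square-integrable and
    give the complement step a set of finite measure to subtract from.\<close>
  define Q where "Q n = box (- (real n *\<^sub>R One)) (real n *\<^sub>R One :: 'a)" for n
  have [measurable]: "Q n \<in> sets borel" for n by (simp add: Q_def)
  have QL: "(indicator (Q n) :: 'a \<Rightarrow> complex) \<in> L2" for n
    by (rule L2_indicator_bounded) (auto simp: Q_def)
  have ind: "(indicator (A \<inter> Q n \<inter> M) :: 'a \<Rightarrow> complex) \<in> C" if "A \<in> sets borel" for A n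
  proof -
    have gen: "range (\<lambda>(a, b). box a b :: 'a set) \<subseteq> Pow UNIV" by simp
    have int: "Int_stable (range (\<lambda>(a, b). box a b :: 'a set))"
      by (auto simp: Int_stable_def box_Int_box)
    have "A \<in> sigma_sets UNIV (range (\<lambda>(a, b). box a b))"
      using that by (subst (asm) borel_eq_box) (simp add: case_prod_unfold)
    then show ?thesis
    proof (induction A rule: sigma_sets_induct_disjoint[OF int gen, consumes 1, case_names basic empty compl union])
      case (basic A)
      then obtain a b where "A = box a b" by auto
      then have "\<exists>c d. A \<inter> Q n = box c d" by (auto simp: Q_def box_Int_box)
      then show ?case using box by auto
    next
      case empty
      then show ?case using closed_l2_subspaceD(2)[OF C] by (simp add: indicator_def[abs_def])
    next
      case (compl A)
      have "(\<lambda>x. indicator (Q n \<inter> M) x - indicator (A \<inter> Q n \<inter> M) x :: complex) \<in> C"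
        by (intro closed_l2_subspace_diff[OF C] compl) (simp add: Q_def box)
      moreover have "(\<lambda>x. indicator (Q n \<inter> M) x - indicator (A \<inter> Q n \<inter> M) x :: complex)
          = indicator ((UNIV - A) \<inter> Q n \<inter> M)"
        by (auto simp: indicator_def)
      ultimately show ?case by simp
    next
      case (union A)
      have A[measurable]: "A i \<in> sets borel" for i
        using union(2) by (subst borel_eq_box) (auto simp: case_prod_unfold)
      show ?case
      proof (rule closed_l2_subspace_dominated[OF C, where w = "\<lambda>x. cmod (indicator (Q n) x)"])
        show "(\<lambda>x. \<Sum>i<N. indicator (A i \<inter> Q n \<inter> M) x) \<in> C" for N
          by (intro closed_l2_subspace_sum[OF C] union)
        have *: "(\<Sum>i<N. indicator (A i \<inter> Q n \<inter> M) x) = (indicator ((\<Union>i<N. A i) \<inter> Q n \<inter> M) x :: complex)" for N x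
        proof -
          have "(\<Sum>i<N. indicator (A i \<inter> Q n \<inter> M) x) = (indicator (\<Union>i<N. A i \<inter> Q n \<inter> M) x :: complex)"
            using union(1) by (intro indicator_UN_disjoint[symmetric]) (auto simp: disjoint_family_on_def)
          also have "(\<Union>i<N. A i \<inter> Q n \<inter> M) = (\<Union>i<N. A i) \<inter> Q n \<inter> M" by auto
          finally show ?thesis .
        qed
        show "AE x in lborel. cmod (\<Sum>i<N. indicator (A i \<inter> Q n \<inter> M) x) \<le> cmod (indicator (Q n) x)" for N
          unfolding * by (auto simp: indicator_def)
        have "(\<lambda>N. indicator ((\<Union>i<N. A i) \<inter> Q n \<inter> M) x :: complex) \<longlonglongrightarrow> indicator (\<Union> (range A) \<inter> Q n \<inter> M) x" for x
        proof (rule tendsto_eventually)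
          show "\<forall>\<^sub>F N in sequentially. indicator ((\<Union>i<N. A i) \<inter> Q n \<inter> M) x = (indicator (\<Union> (range A) \<inter> Q n \<inter> M) x :: complex)"
          proof (cases "\<exists>i. x \<in> A i")
            case True
            then obtain i where "x \<in> A i" ..
            then have "\<forall>N\<ge>Suc i. indicator ((\<Union>i<N. A i) \<inter> Q n \<inter> M) x = (indicator (\<Union> (range A) \<inter> Q n \<inter> M) x :: complex)"
              by (auto simp: indicator_def dest: Suc_le_lessD)
            then show ?thesis by (auto simp: eventually_sequentially)
          qed (auto simp: indicator_def)
        qed
        then show "AE x in lborel. (\<lambda>N. \<Sum>i<N. indicator (A i \<inter> Q n \<inter> M) x :: complex) \<longlonglongrightarrow> indicator (\<Union> (range A) \<inter> Q n \<inter> M) x"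
          unfolding * by simp
        show "integrable lborel (\<lambda>x. (cmod (indicator (Q n) x))\<^sup>2)" by (rule L2_integrable[OF QL])
        show "indicator (\<Union> (range A) \<inter> Q n \<inter> M) \<in> borel_measurable lborel" by measurable
      qed
    qed
  qed
  have "f \<in> borel_measurable borel" by measurable
  from borel_measurable_implies_sequence_metric[OF this, of 0]
  obtain F where F: "\<And>i. simple_function borel (F i)" "\<And>x. (\<lambda>i. F i x) \<longlonglongrightarrow> f x"
    "\<And>i x. cmod (F i x) \<le> 2 * cmod (f x)"
    by auto
  have simple: "(\<lambda>x. indicator (Q n \<inter> M) x * F i x) \<in> C" for n i
  proof -
    have fin: "finite (range (F i))" using F(1)[of i] by (simp add: simple_function_def)
    have s: "F i -` {y} \<in> sets borel" for y
    proof (cases "y \<in> range (F i)")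
      case True
      then show ?thesis using F(1)[of i] by (auto simp: simple_function_def)
    next
      case False
      then have "F i -` {y} = {}" by auto
      then show ?thesis by simp
    qed
    have "(\<lambda>x. \<Sum>y\<in>range (F i). y * indicator (F i -` {y} \<inter> Q n \<inter> M) x) \<in> C"
      by (intro closed_l2_subspace_sum[OF C] closed_l2_subspaceD(4)[OF C] ind s)
    moreover have "(\<Sum>y\<in>range (F i). y * indicator (F i -` {y} \<inter> Q n \<inter> M) x) = indicator (Q n \<inter> M) x * F i x" for x
    proof -
      have "(\<Sum>y\<in>range (F i). y * indicator (F i -` {y} \<inter> Q n \<inter> M) x)
          = (\<Sum>y\<in>range (F i). if y = F i x then y * indicator (Q n \<inter> M) x else 0)"
        by (intro sum.cong) (auto simp: indicator_def)
      also have "\<dots> = indicator (Q n \<inter> M) x * F i x" using fin by simp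
      finally show ?thesis .
    qed
    ultimately show ?thesis by simp
  qed
  show ?thesis
  proof (rule closed_l2_subspace_dominated[OF C, where w = "\<lambda>x. 2 * cmod (f x)"])
    \<comment> \<open>One index drives both the cut-off and the simple approximation, so a single
      limit removes both.\<close>
    show "(\<lambda>x. indicator (Q n \<inter> M) x * F n x) \<in> C" for n by (rule simple)
    show "AE x in lborel. cmod (indicator (Q n \<inter> M) x * F n x) \<le> 2 * cmod (f x)" for n
      using F(3) by (auto simp: indicator_def)
    show "integrable lborel (\<lambda>x. (2 * cmod (f x))\<^sup>2)"
      using L2_integrable[OF f] by (simp add: power_mult_distrib)
    have "(\<lambda>n. indicator (Q n \<inter> M) x * F n x) \<longlonglongrightarrow> indicator M x * f x" for x
    proof (rule tendsto_mult[OF tendsto_eventually F(2)])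
      obtain N where N: "norm x < real N" using reals_Archimedean2 by blast
      have "x \<in> Q n" if "n \<ge> N" for n
      proof -
        have "- real n < x \<bullet> i \<and> x \<bullet> i < real n" if "i \<in> Basis" for i
          using Basis_le_norm[OF that, of x] N \<open>n \<ge> N\<close> by auto
        then show ?thesis by (auto simp: Q_def mem_box)
      qed
      then show "\<forall>\<^sub>F n in sequentially. indicator (Q n \<inter> M) x = indicator M x"
        by (auto simp: eventually_sequentially indicator_def intro!: exI[of _ N])
    qed
    then show "AE x in lborel. (\<lambda>n. indicator (Q n \<inter> M) x * F n x) \<longlonglongrightarrow> indicator M x * f x" by simp
  qed measurable
qed

lemma closed_l2_subspace_eq_L2:
  fixes C :: "('a::euclidean_space \<Rightarrow> complex) set"
  assumes C: "closed_l2_subspace C" and box: "\<And>a b. (indicator (box a b) :: 'a \<Rightarrow> complex) \<in> C"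
  shows "C = L2"
  using closed_l2_subspace_contains_L2_on[OF C, of UNIV] box closed_l2_subspaceD(1)[OF C] by auto

section \<open>Isometries\<close>

definition l2_isometry :: "(('a::euclidean_space \<Rightarrow> complex) \<Rightarrow> ('b::euclidean_space \<Rightarrow> complex)) \<Rightarrow> bool" where
  "l2_isometry T \<longleftrightarrow> (\<forall>f\<in>L2. T f \<in> L2) \<and> (\<forall>f\<in>L2. \<forall>g\<in>L2. l2_inner (T f) (T g) = l2_inner f g)"

lemma l2_isometryD:
  assumes "l2_isometry T"
  shows "f \<in> L2 \<Longrightarrow> T f \<in> L2" "f \<in> L2 \<Longrightarrow> g \<in> L2 \<Longrightarrow> l2_inner (T f) (T g) = l2_inner f g"
  using assms by (auto simp: l2_isometry_def)

lemma l2_isometry_comp: "l2_isometry T \<Longrightarrow> l2_isometry U \<Longrightarrow> l2_isometry (\<lambda>f. T (U f))"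
  by (auto simp: l2_isometry_def)

lemma l2_isometry_norm: "l2_isometry T \<Longrightarrow> f \<in> L2 \<Longrightarrow> l2_norm (T f) = l2_norm f"
  by (intro l2_norm_eq_if_inner_eq l2_isometryD(2))

text \<open>Linearity comes for free, as the inner products determine the norms of the defects.\<close>

lemma l2_isometry_add:
  assumes T: "l2_isometry T" and f: "f \<in> L2" and g: "g \<in> L2"
  shows "l2_eq (T (\<lambda>x. f x + g x)) (\<lambda>x. T f x + T g x)"
proof -
  note D = l2_isometryD[OF T]
  have h: "(\<lambda>x. f x + g x) \<in> L2" by (intro L2_add f g)
  have Th: "(\<lambda>x. T f x + T g x) \<in> L2" by (intro L2_add D f g)
  let ?d = "\<lambda>x. T (\<lambda>x. f x + g x) x - (T f x + T g x)"
  have "l2_inner ?d ?d = 0"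
    by (simp add: l2_inner_diff_left l2_inner_diff_right l2_inner_add_left l2_inner_add_right
        D f g h Th L2_add L2_diff)
  then show ?thesis
    by (simp add: l2_norm_diff_eq_0 D h Th l2_inner_self)
qed

lemma l2_isometry_cmult:
  assumes T: "l2_isometry T" and f: "f \<in> L2"
  shows "l2_eq (T (\<lambda>x. c * f x)) (\<lambda>x. c * T f x)"
proof -
  note D = l2_isometryD[OF T]
  have h: "(\<lambda>x. c * f x) \<in> L2" by (intro L2_cmult f)
  have Th: "(\<lambda>x. c * T f x) \<in> L2" by (intro L2_cmult D f)
  let ?d = "\<lambda>x. T (\<lambda>x. c * f x) x - c * T f x"
  have "l2_inner ?d ?d = 0"
    by (simp add: l2_inner_diff_left l2_inner_diff_right l2_inner_cmult_left l2_inner_cmult_right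
        D f h Th L2_diff)
  then show ?thesis
    by (simp add: l2_norm_diff_eq_0 D h Th l2_inner_self)
qed

lemma l2_eq_add: "l2_eq f f' \<Longrightarrow> l2_eq g g' \<Longrightarrow> l2_eq (\<lambda>x. f x + g x) (\<lambda>x. f' x + g' x)"
  unfolding l2_eq_def by (auto elim: AE_mp)

lemma l2_eq_diff: "l2_eq f f' \<Longrightarrow> l2_eq g g' \<Longrightarrow> l2_eq (\<lambda>x. f x - g x) (\<lambda>x. f' x - g' x)"
  unfolding l2_eq_def by (auto elim: AE_mp)

lemma l2_eq_mult: "l2_eq f f' \<Longrightarrow> l2_eq (\<lambda>x. h x * f x) (\<lambda>x. h x * f' x)"
  unfolding l2_eq_def by (auto elim: AE_mp)

lemma l2_isometry_diff:
  assumes T: "l2_isometry T" and f: "f \<in> L2" and g: "g \<in> L2"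
  shows "l2_eq (T (\<lambda>x. f x - g x)) (\<lambda>x. T f x - T g x)"
proof -
  have "l2_eq (T (\<lambda>x. f x + (-1) * g x)) (\<lambda>x. T f x + T (\<lambda>x. (-1) * g x) x)"
    by (intro l2_isometry_add[OF T] f L2_cmult g)
  also have "l2_eq \<dots> (\<lambda>x. T f x + (-1) * T g x)"
    by (intro l2_eq_add l2_isometry_cmult[OF T g] l2_eq_refl)
  finally show ?thesis by simp
qed

lemma l2_isometry_zero: "l2_isometry T \<Longrightarrow> l2_eq (T (\<lambda>_. 0)) (\<lambda>_. 0)"
  using l2_isometry_cmult[of T "\<lambda>_. 0" 0] by simp

lemma l2_isometry_sum:
  assumes T: "l2_isometry T" and "\<And>i. i \<in> I \<Longrightarrow> f i \<in> L2"
  shows "l2_eq (T (\<lambda>x. \<Sum>i\<in>I. f i x)) (\<lambda>x. \<Sum>i\<in>I. T (f i) x)"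
  using assms(2)
proof (induction I rule: infinite_finite_induct)
  case (insert i I)
  have "l2_eq (T (\<lambda>x. f i x + (\<Sum>i\<in>I. f i x))) (\<lambda>x. T (f i) x + T (\<lambda>x. \<Sum>i\<in>I. f i x) x)"
    by (intro l2_isometry_add[OF T] L2_sum insert) auto
  also have "l2_eq \<dots> (\<lambda>x. T (f i) x + (\<Sum>i\<in>I. T (f i) x))"
    by (intro l2_eq_add l2_eq_refl insert) auto
  finally show ?case using insert by simp
qed (use l2_isometry_zero[OF T] in auto)

lemma l2_isometry_norm_diff:
  assumes T: "l2_isometry T" and f: "f \<in> L2" and g: "g \<in> L2"
  shows "l2_norm (\<lambda>x. T f x - T g x) = l2_norm (\<lambda>x. f x - g x)"
  using l2_norm_cong[OF l2_isometry_diff[OF assms]] l2_isometry_norm[OF T L2_diff[OF f g]] l2_isometryD(1)[OF T] f g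
  by (simp add: L2_diff)

lemma l2_isometry_cong:
  assumes T: "l2_isometry T" and f: "f \<in> L2" and g: "g \<in> L2" and "l2_eq f g"
  shows "l2_eq (T f) (T g)"
  using l2_isometry_norm_diff[OF T f g] assms(4) by (simp add: l2_norm_diff_eq_0 f g l2_isometryD(1)[OF T])

lemma l2_isometry_inj:
  assumes T: "l2_isometry T" and f: "f \<in> L2" and g: "g \<in> L2" and "l2_eq (T f) (T g)"
  shows "l2_eq f g"
  using l2_isometry_norm_diff[OF T f g] assms(4) by (simp add: l2_norm_diff_eq_0 f g l2_isometryD(1)[OF T])

text \<open>Isometries preserve distances, so agreement passes to limits. Together with the density
  of box indicators this reduces an identity between two isometries to its check on boxes.\<close>

lemma closed_l2_subspace_isometry_agree:
  fixes T U :: "('a::euclidean_space \<Rightarrow> complex) \<Rightarrow> ('b::euclidean_space \<Rightarrow> complex)"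
  assumes T: "l2_isometry T" and U: "l2_isometry U"
  shows "closed_l2_subspace {f \<in> L2. l2_eq (T f) (U f)}"
  unfolding closed_l2_subspace_def
proof (intro conjI ballI allI)
  show "(\<lambda>_. 0) \<in> {f \<in> L2. l2_eq (T f) (U f)}"
    using l2_eq_trans[OF l2_isometry_zero[OF T] l2_eq_sym[OF l2_isometry_zero[OF U]]] by simp
next
  fix f g assume fg: "f \<in> {f \<in> L2. l2_eq (T f) (U f)}" "g \<in> {f \<in> L2. l2_eq (T f) (U f)}"
  then have "l2_eq (T (\<lambda>x. f x + g x)) (\<lambda>x. T f x + T g x)" by (intro l2_isometry_add[OF T]) auto
  also have "l2_eq \<dots> (\<lambda>x. U f x + U g x)" using fg by (intro l2_eq_add) auto
  also have "l2_eq \<dots> (U (\<lambda>x. f x + g x))" using fg by (intro l2_isometry_add[OF U, THEN l2_eq_sym]) auto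
  finally show "(\<lambda>x. f x + g x) \<in> {f \<in> L2. l2_eq (T f) (U f)}" using fg by (simp add: L2_add)
next
  fix c f assume f: "f \<in> {f \<in> L2. l2_eq (T f) (U f)}"
  then have "l2_eq (T (\<lambda>x. c * f x)) (\<lambda>x. c * T f x)" by (intro l2_isometry_cmult[OF T]) auto
  also have "l2_eq \<dots> (\<lambda>x. c * U f x)" using f by (intro l2_eq_mult) auto
  also have "l2_eq \<dots> (U (\<lambda>x. c * f x))" using f by (intro l2_isometry_cmult[OF U, THEN l2_eq_sym]) auto
  finally show "(\<lambda>x. c * f x) \<in> {f \<in> L2. l2_eq (T f) (U f)}" using f by (simp add: L2_cmult)
next
  show "l2_closure {f \<in> L2. l2_eq (T f) (U f)} \<subseteq> {f \<in> L2. l2_eq (T f) (U f)}"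
  proof
    fix f assume f: "f \<in> l2_closure {f \<in> L2. l2_eq (T f) (U f)}"
    then have fL: "f \<in> L2" by (auto simp: l2_closure_def)
    note TL = l2_isometryD(1)[OF T] and UL = l2_isometryD(1)[OF U]
    have "l2_norm (\<lambda>x. T f x - U f x) \<le> 0 + e" if e: "e > 0" for e
    proof -
      obtain g where g: "g \<in> L2" "l2_eq (T g) (U g)" "l2_norm (\<lambda>x. f x - g x) < e / 2"
        using f half_gt_zero[OF e] unfolding l2_closure_def by blast
      have "l2_norm (\<lambda>x. T f x - U f x) \<le> l2_norm (\<lambda>x. T f x - T g x) + l2_norm (\<lambda>x. T g x - U f x)"
        by (intro l2_norm_diff_triangle TL UL fL g)
      also have "l2_norm (\<lambda>x. T g x - U f x) = l2_norm (\<lambda>x. U g x - U f x)"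
        using g fL by (intro l2_norm_cong l2_eq_diff L2_diff TL UL) auto
      also have "\<dots> = l2_norm (\<lambda>x. f x - g x)"
        using g fL l2_norm_minus_commute[of g f] by (simp add: l2_isometry_norm_diff[OF U])
      also have "l2_norm (\<lambda>x. T f x - T g x) = l2_norm (\<lambda>x. f x - g x)"
        using g fL by (simp add: l2_isometry_norm_diff[OF T])
      finally show ?thesis using g(3) by simp
    qed
    then have "l2_norm (\<lambda>x. T f x - U f x) \<le> 0" by (rule field_le_epsilon)
    then show "f \<in> {f \<in> L2. l2_eq (T f) (U f)}"
      using fL by (simp add: l2_norm_diff_eq_0 TL UL antisym)
  qed
qed auto

lemma l2_isometry_agree_on_boxes:
  fixes T U :: "('a::euclidean_space \<Rightarrow> complex) \<Rightarrow> ('b::euclidean_space \<Rightarrow> complex)"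
  assumes T: "l2_isometry T" and U: "l2_isometry U"
    and "\<And>a b. l2_eq (T (indicator (box a b))) (U (indicator (box a b)))" and "f \<in> L2"
  shows "l2_eq (T f) (U f)"
proof -
  have "{f \<in> L2. l2_eq (T f) (U f)} = L2"
    by (rule closed_l2_subspace_eq_L2[OF closed_l2_subspace_isometry_agree[OF T U]])
      (use assms(3) in \<open>auto simp: L2_indicator_bounded\<close>)
  then show ?thesis using assms(4) by blast
qed

lemma l2_inner_tendsto:
  fixes f g :: "'a::euclidean_space \<Rightarrow> complex"
  assumes p: "\<And>n. p n \<in> L2" "f \<in> L2" "(\<lambda>n. l2_norm (\<lambda>x. p n x - f x)) \<longlonglongrightarrow> 0"
    and q: "\<And>n. q n \<in> L2" "g \<in> L2" "(\<lambda>n. l2_norm (\<lambda>x. q n x - g x)) \<longlonglongrightarrow> 0"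
  shows "(\<lambda>n. l2_inner (p n) (q n)) \<longlonglongrightarrow> l2_inner f g"
proof (rule Lim_transform)
  show "(\<lambda>n. l2_inner f g) \<longlonglongrightarrow> l2_inner f g" by simp
  show "(\<lambda>n. l2_inner (p n) (q n) - l2_inner f g) \<longlonglongrightarrow> 0"
  proof (rule Lim_null_comparison)
    show "\<forall>\<^sub>F n in sequentially. cmod (l2_inner (p n) (q n) - l2_inner f g)
      \<le> l2_norm (\<lambda>x. p n x - f x) * (l2_norm (\<lambda>x. q n x - g x) + l2_norm g) + l2_norm f * l2_norm (\<lambda>x. q n x - g x)"
    proof (intro always_eventually allI)
      fix n
      have "l2_inner (p n) (q n) - l2_inner f g
          = l2_inner (\<lambda>x. p n x - f x) (q n) + l2_inner f (\<lambda>x. q n x - g x)"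
        by (simp add: l2_inner_diff_left l2_inner_diff_right p q)
      also have "cmod \<dots> \<le> cmod (l2_inner (\<lambda>x. p n x - f x) (q n)) + cmod (l2_inner f (\<lambda>x. q n x - g x))"
        by (rule norm_triangle_ineq)
      also have "\<dots> \<le> l2_norm (\<lambda>x. p n x - f x) * l2_norm (q n) + l2_norm f * l2_norm (\<lambda>x. q n x - g x)"
        by (intro add_mono l2_Cauchy_Schwarz L2_diff p q)
      also have "l2_norm (q n) \<le> l2_norm (\<lambda>x. q n x - g x) + l2_norm g"
        using l2_norm_triangle[OF L2_diff[OF q(1,2)] q(2), of n] by simp
      finally show "cmod (l2_inner (p n) (q n) - l2_inner f g)
        \<le> l2_norm (\<lambda>x. p n x - f x) * (l2_norm (\<lambda>x. q n x - g x) + l2_norm g) + l2_norm f * l2_norm (\<lambda>x. q n x - g x)"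
        by (simp add: mult_left_mono)
    qed
    have "(\<lambda>n. l2_norm (\<lambda>x. p n x - f x) * (l2_norm (\<lambda>x. q n x - g x) + l2_norm g) + l2_norm f * l2_norm (\<lambda>x. q n x - g x))
      \<longlonglongrightarrow> 0 * (0 + l2_norm g) + l2_norm f * 0"
      by (intro tendsto_intros p q)
    then show "(\<lambda>n. l2_norm (\<lambda>x. p n x - f x) * (l2_norm (\<lambda>x. q n x - g x) + l2_norm g) + l2_norm f * l2_norm (\<lambda>x. q n x - g x))
      \<longlonglongrightarrow> 0" by simp
  qed
qed

text \<open>Equal Gram matrices make the correspondence between finite combinations of
  \<open>e\<close> and of \<open>e'\<close> isometric, and completeness of the target extends it to
  the closure. The Fourier transform and its inverse are constructed by this.\<close>

lemma l2_isometry_extension: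
  fixes e :: "'i \<Rightarrow> 'a::euclidean_space \<Rightarrow> complex" and e' :: "'i \<Rightarrow> 'b::euclidean_space \<Rightarrow> complex"
  assumes e: "\<And>i. e i \<in> L2" and e': "\<And>i. e' i \<in> L2"
    and gram: "\<And>i j. l2_inner (e' i) (e' j) = l2_inner (e i) (e j)"
    and total: "l2_closure (l2_span e UNIV) = L2"
  obtains T where "l2_isometry T" "\<And>i. l2_eq (T (e i)) (e' i)"
proof -
  \<comment> \<open>A combination is represented by an index set with coefficients, so that one
    object names the corresponding elements on both sides and no question of well-definedness
    arises.\<close>
  define lc where "lc p x = (\<Sum>i\<in>fst p. snd p i * e i x)" for p :: "'i set \<times> ('i \<Rightarrow> complex)" and x
  define lc' where "lc' p x = (\<Sum>i\<in>fst p. snd p i * e' i x)" for p :: "'i set \<times> ('i \<Rightarrow> complex)" and x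
  have lcL: "lc p \<in> L2" for p unfolding lc_def by (intro L2_sum L2_cmult e)
  have lcL': "lc' p \<in> L2" for p unfolding lc'_def by (intro L2_sum L2_cmult e')
  have inner: "l2_inner (lc' p) (lc' q) = l2_inner (lc p) (lc q)" for p q
    unfolding lc_def lc'_def
    by (simp add: l2_inner_sum_left l2_inner_sum_right L2_sum L2_cmult e e' l2_inner_cmult_left l2_inner_cmult_right gram)
  have norm_diff: "l2_norm (\<lambda>x. lc' p x - lc' q x) = l2_norm (\<lambda>x. lc p x - lc q x)" for p q
    by (rule l2_norm_eq_if_inner_eq)
      (simp add: l2_inner_diff_left l2_inner_diff_right lcL lcL' L2_diff inner)
  \<comment> \<open>\<open>R f g\<close> says that one sequence of combinations approaches
    \<open>f\<close> on one side and \<open>g\<close> on the other. Inner products pass to the limit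
    along such sequences, which is why any choice of \<open>g\<close> for each \<open>f\<close>
    gives an isometry.\<close>
  define R where "R f g \<longleftrightarrow> f \<in> L2 \<and> g \<in> L2 \<and> (\<exists>p. (\<lambda>n. l2_norm (\<lambda>x. lc (p n) x - f x)) \<longlonglongrightarrow> 0
      \<and> (\<lambda>n. l2_norm (\<lambda>x. lc' (p n) x - g x)) \<longlonglongrightarrow> 0)" for f g
  have ex: "\<exists>g. R f g" if f: "f \<in> L2" for f
  proof -
    \<comment> \<open>Consecutive approximants are compared through \<open>f\<close>; the additional
      factor 1/2 keeps the sum of the two distances below \<open>(1/2)^n\<close>.\<close>
    have "\<exists>p. l2_norm (\<lambda>x. f x - lc p x) < (1/2)^n / 2" for n :: nat
    proof -
      have "f \<in> l2_closure (l2_span e UNIV)" using f total by simp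
      moreover have "(1/2)^n / 2 > (0::real)" by simp
      ultimately obtain h where h: "h \<in> l2_span e UNIV" "l2_norm (\<lambda>x. f x - h x) < (1/2)^n / 2"
        unfolding l2_closure_def by blast
      then obtain F c where "h = (\<lambda>x. \<Sum>i\<in>F. c i * e i x)" unfolding l2_span_def by blast
      then show ?thesis using h(2) by (intro exI[of _ "(F, c)"]) (simp add: lc_def)
    qed
    then obtain p where p: "\<And>n. l2_norm (\<lambda>x. f x - lc (p n) x) < (1/2)^n / 2" by metis
    have "l2_norm (\<lambda>x. lc' (p (Suc n)) x - lc' (p n) x) \<le> (1/2)^n" for n
    proof -
      have "l2_norm (\<lambda>x. lc' (p (Suc n)) x - lc' (p n) x) = l2_norm (\<lambda>x. lc (p (Suc n)) x - lc (p n) x)"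
        by (rule norm_diff)
      also have "\<dots> \<le> l2_norm (\<lambda>x. lc (p (Suc n)) x - f x) + l2_norm (\<lambda>x. f x - lc (p n) x)"
        by (intro l2_norm_diff_triangle lcL f)
      also have "\<dots> \<le> (1/2)^Suc n / 2 + (1/2)^n / 2"
        using p[of n] p[of "Suc n"] by (simp add: l2_norm_minus_commute[of f])
      also have "\<dots> \<le> (1/2)^n" by simp
      finally show ?thesis .
    qed
    then obtain g where g: "g \<in> L2" "(\<lambda>n. l2_norm (\<lambda>x. lc' (p n) x - g x)) \<longlonglongrightarrow> 0"
      using l2_complete[of "\<lambda>n. lc' (p n)"] lcL' by blast
    have "(\<lambda>n. l2_norm (\<lambda>x. lc (p n) x - f x)) \<longlonglongrightarrow> 0"
    proof (rule tendsto_sandwich[of "\<lambda>_. 0" _ _ "\<lambda>n. (1/2)^n / 2"])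
      show "\<forall>\<^sub>F n in sequentially. l2_norm (\<lambda>x. lc (p n) x - f x) \<le> (1/2)^n / 2"
        using p by (subst l2_norm_minus_commute) (auto intro!: always_eventually less_imp_le)
      have "(\<lambda>n. (1/2::real)^n / 2) \<longlonglongrightarrow> 0 / 2" by (intro tendsto_intros LIMSEQ_power_zero) auto
      then show "(\<lambda>n. (1/2::real)^n / 2) \<longlonglongrightarrow> 0" by simp
    qed auto
    then show ?thesis using g f by (auto simp: R_def)
  qed
  have R_inner: "l2_inner g g' = l2_inner f f'" if "R f g" "R f' g'" for f g f' g'
  proof -
    obtain p where p: "(\<lambda>n. l2_norm (\<lambda>x. lc (p n) x - f x)) \<longlonglongrightarrow> 0" "(\<lambda>n. l2_norm (\<lambda>x. lc' (p n) x - g x)) \<longlonglongrightarrow> 0"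
      and fg: "f \<in> L2" "g \<in> L2"
      using \<open>R f g\<close> by (auto simp: R_def)
    obtain q where q: "(\<lambda>n. l2_norm (\<lambda>x. lc (q n) x - f' x)) \<longlonglongrightarrow> 0" "(\<lambda>n. l2_norm (\<lambda>x. lc' (q n) x - g' x)) \<longlonglongrightarrow> 0"
      and fg': "f' \<in> L2" "g' \<in> L2"
      using \<open>R f' g'\<close> by (auto simp: R_def)
    have "(\<lambda>n. l2_inner (lc (p n)) (lc (q n))) \<longlonglongrightarrow> l2_inner f f'"
      by (intro l2_inner_tendsto lcL fg fg' p q)
    moreover have "(\<lambda>n. l2_inner (lc (p n)) (lc (q n))) \<longlonglongrightarrow> l2_inner g g'"
      unfolding inner[symmetric] by (intro l2_inner_tendsto lcL' fg fg' p q)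
    ultimately show ?thesis by (rule LIMSEQ_unique[symmetric])
  qed
  have R_e: "R (e i) (e' i)" for i
    unfolding R_def by (auto simp: e e' lc_def lc'_def intro!: exI[of _ "\<lambda>_. ({i}, \<lambda>_. 1)"])
  define T where "T f = (SOME g. R f g)" for f
  have RT: "R f (T f)" if "f \<in> L2" for f unfolding T_def by (rule someI_ex[OF ex[OF that]])
  have T: "l2_isometry T"
    unfolding l2_isometry_def using RT R_inner by (auto simp: R_def)
  moreover have "l2_eq (T (e i)) (e' i)" for i
  proof -
    have TL: "T (e i) \<in> L2" by (rule l2_isometryD(1)[OF T e])
    \<comment> \<open>\<open>T (e i)\<close> and \<open>e' i\<close> are both related to
      \<open>e i\<close>, so all inner products between them agree and their difference has norm
      zero.\<close>
    have "l2_inner (T (e i)) (T (e i)) = l2_inner (e i) (e i)" "l2_inner (T (e i)) (e' i) = l2_inner (e i) (e i)"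
      "l2_inner (e' i) (T (e i)) = l2_inner (e i) (e i)" "l2_inner (e' i) (e' i) = l2_inner (e i) (e i)"
      by (intro R_inner RT R_e e)+
    then have "l2_inner (\<lambda>x. T (e i) x - e' i x) (\<lambda>x. T (e i) x - e' i x) = 0"
      by (simp add: l2_inner_diff_left l2_inner_diff_right L2_diff TL e')
    then show ?thesis by (simp add: l2_norm_diff_eq_0 TL e' l2_inner_self)
  qed
  ultimately show thesis by (rule that)
qed

text \<open>An isometry keeps the distance of a function from each finite combination. Hence
  \<open>f\<close> is in the closed span of \<open>e'\<close> exactly when \<open>F f\<close> is in
  that of \<open>e\<close>, and the new span comes out as a preimage.\<close>

lemma l2_isometry_transfer_onb:
  assumes F: "l2_isometry F" and onb: "l2_orthonormal_basis e I S"
    and e': "\<And>i. i \<in> I \<Longrightarrow> e' i \<in> L2" and Fe: "\<And>i. i \<in> I \<Longrightarrow> l2_eq (F (e' i)) (e i)"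
  shows "l2_orthonormal_basis e' I {f \<in> L2. F f \<in> S}"
  unfolding l2_orthonormal_basis_def
proof (intro conjI ballI)
  note FD = l2_isometryD[OF F]
  have e: "e i \<in> L2" if "i \<in> I" for i using onb that by (simp add: l2_orthonormal_basis_def)
  fix i j assume ij: "i \<in> I" "j \<in> I"
  have "l2_inner (e' i) (e' j) = l2_inner (F (e' i)) (F (e' j))" by (simp add: FD e' ij)
  also have "\<dots> = l2_inner (e i) (e j)" by (intro l2_inner_cong Fe FD e' ij e)
  finally show "l2_inner (e' i) (e' j) = (if i = j then 1 else 0)"
    using onb ij by (simp add: l2_orthonormal_basis_def)
next
  note FD = l2_isometryD[OF F]
  have e: "e i \<in> L2" if "i \<in> I" for i using onb that by (simp add: l2_orthonormal_basis_def)
  have *: "l2_norm (\<lambda>x. f x - (\<Sum>i\<in>J. c i * e' i x)) = l2_norm (\<lambda>x. F f x - (\<Sum>i\<in>J. c i * e i x))"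
    if f: "f \<in> L2" and J: "J \<subseteq> I" for f J c
  proof -
    have s: "(\<lambda>x. \<Sum>i\<in>J. c i * e' i x) \<in> L2" "(\<lambda>x. \<Sum>i\<in>J. c i * e i x) \<in> L2"
      using J by (auto intro!: L2_sum L2_cmult e e')
    have "l2_eq (F (\<lambda>x. \<Sum>i\<in>J. c i * e' i x)) (\<lambda>x. \<Sum>i\<in>J. F (\<lambda>x. c i * e' i x) x)"
      by (rule l2_isometry_sum[OF F]) (use J e' L2_cmult in blast)
    also have "l2_eq \<dots> (\<lambda>x. \<Sum>i\<in>J. c i * e i x)"
    proof -
      have "l2_eq (F (\<lambda>x. c i * e' i x)) (\<lambda>x. c i * e i x)" if "i \<in> J" for i
      proof -
        have "i \<in> I" using J that by blast
        then show ?thesis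
          using l2_eq_trans[OF l2_isometry_cmult[OF F e'] l2_eq_mult[OF Fe]] by blast
      qed
      then show ?thesis
      proof (induction J rule: infinite_finite_induct)
        case (insert i J)
        have "l2_eq (\<lambda>x. F (\<lambda>x. c i * e' i x) x + (\<Sum>i\<in>J. F (\<lambda>x. c i * e' i x) x)) (\<lambda>x. c i * e i x + (\<Sum>i\<in>J. c i * e i x))"
          by (intro l2_eq_add insert) auto
        then show ?case using insert by simp
      qed auto
    qed
    finally have eq: "l2_eq (F (\<lambda>x. \<Sum>i\<in>J. c i * e' i x)) (\<lambda>x. \<Sum>i\<in>J. c i * e i x)" .
    have "l2_norm (\<lambda>x. f x - (\<Sum>i\<in>J. c i * e' i x)) = l2_norm (\<lambda>x. F f x - F (\<lambda>x. \<Sum>i\<in>J. c i * e' i x) x)"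
      by (rule l2_isometry_norm_diff[OF F f s(1), symmetric])
    also have "\<dots> = l2_norm (\<lambda>x. F f x - (\<Sum>i\<in>J. c i * e i x))"
      by (intro l2_norm_cong l2_eq_diff eq l2_eq_refl L2_diff FD f s)
    finally show ?thesis .
  qed
  have "f \<in> l2_closure (l2_span e' I) \<longleftrightarrow> F f \<in> l2_closure (l2_span e I)" if f: "f \<in> L2" for f
  proof -
    have "(\<exists>g\<in>l2_span e' I. l2_norm (\<lambda>x. f x - g x) < r) \<longleftrightarrow> (\<exists>g\<in>l2_span e I. l2_norm (\<lambda>x. F f x - g x) < r)" for r
    proof
      assume "\<exists>g\<in>l2_span e' I. l2_norm (\<lambda>x. f x - g x) < r"
      then obtain J c where J: "finite J" "J \<subseteq> I" "l2_norm (\<lambda>x. f x - (\<Sum>i\<in>J. c i * e' i x)) < r"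
        unfolding l2_span_def by blast
      then show "\<exists>g\<in>l2_span e I. l2_norm (\<lambda>x. F f x - g x) < r"
        unfolding *[OF f J(2)] l2_span_def by (intro bexI[of _ "\<lambda>x. \<Sum>i\<in>J. c i * e i x"]) auto
    next
      assume "\<exists>g\<in>l2_span e I. l2_norm (\<lambda>x. F f x - g x) < r"
      then obtain J c where J: "finite J" "J \<subseteq> I" "l2_norm (\<lambda>x. F f x - (\<Sum>i\<in>J. c i * e i x)) < r"
        unfolding l2_span_def by blast
      then show "\<exists>g\<in>l2_span e' I. l2_norm (\<lambda>x. f x - g x) < r"
        unfolding *[OF f J(2), symmetric] l2_span_def by (intro bexI[of _ "\<lambda>x. \<Sum>i\<in>J. c i * e' i x"]) auto
    qed
    then show ?thesis using f FD(1)[OF f] by (simp add: l2_closure_def)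
  qed
  moreover have "l2_closure (l2_span e' I) \<subseteq> L2" by (auto simp: l2_closure_def)
  moreover have "l2_closure (l2_span e I) = S" using onb by (simp add: l2_orthonormal_basis_def)
  ultimately show "l2_closure (l2_span e' I) = {f \<in> L2. F f \<in> S}" by blast
qed (use e' in auto)

section \<open>The Fourier transform\<close>

text \<open>A modulated sinc function. For \<open>b \<le> a\<close> the interval is empty and the
  value 0, so box corners can be treated without an order between them.\<close>

definition interval_ift :: "real \<Rightarrow> real \<Rightarrow> real \<Rightarrow> complex" where
  "interval_ift a b x = (\<integral>\<xi>. indicator {a<..<b} \<xi> * cis (2 * pi * (x * \<xi>)) \<partial>lborel)"

lemma measurable_cis [measurable]: "cis \<in> borel_measurable borel"
  by (intro borel_measurable_continuous_onI continuous_intros)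

lemma cmod_indicator [simp]: "cmod (indicator S x) = indicator S x"
  by (simp add: indicator_def)

lemma cnj_indicator [simp]: "cnj (indicator S x) = indicator S x"
  by (simp add: indicator_def)

lemma integrable_indicator_cis:
  assumes "S \<in> sets borel" "emeasure lborel S < \<infinity>" "g \<in> borel_measurable borel"
  shows "integrable lborel (\<lambda>\<xi>. indicator S \<xi> * cis (g \<xi>))"
proof -
  note [measurable] = assms(1,3)
  have "integrable lborel (\<lambda>\<xi>. indicator S \<xi> :: real)"
    using assms(1,2) by simp
  then show ?thesis
    by (rule Bochner_Integration.integrable_bound) (measurable, auto simp: norm_mult)
qed

lemma interval_ift_measurable [measurable]: "interval_ift a b \<in> borel_measurable borel"
proof -
  have "interval_ift a b = (\<lambda>x. \<integral>\<xi>. indicator {a<..<b} \<xi> * cis (2 * pi * (x * \<xi>)) \<partial>lborel)"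
    by (simp add: interval_ift_def[abs_def])
  also have "\<dots> \<in> borel_measurable borel"
    by (rule lborel.borel_measurable_lebesgue_integral) measurable
  finally show ?thesis .
qed

lemma interval_ift_empty: "b \<le> a \<Longrightarrow> interval_ift a b x = 0"
  by (simp add: interval_ift_def)

lemma interval_ift_eq:
  assumes "x \<noteq> 0" "a \<le> b"
  shows "interval_ift a b x = (cis (2 * pi * (x * b)) - cis (2 * pi * (x * a))) / (2 * pi * \<i> * x)"
proof -
  let ?F = "\<lambda>\<xi>. cis (2 * pi * (x * \<xi>)) / (2 * pi * \<i> * x)"
  have "interval_ift a b x = (\<integral>\<xi>. indicator {a..b} \<xi> *\<^sub>R cis (2 * pi * (x * \<xi>)) \<partial>lborel)"
    unfolding interval_ift_def
  proof (rule integral_cong_AE)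
    have "AE \<xi> in lborel. \<xi> \<noteq> a \<and> \<xi> \<noteq> b"
      using AE_lborel_singleton[of a] AE_lborel_singleton[of b] by eventually_elim simp
    then show "AE \<xi> in lborel. indicator {a<..<b} \<xi> * cis (2 * pi * (x * \<xi>)) = indicator {a..b} \<xi> *\<^sub>R cis (2 * pi * (x * \<xi>))"
      by eventually_elim (auto simp: indicator_def)
  qed measurable
  also have "\<dots> = ?F b - ?F a"
  proof (rule integral_FTC_atLeastAtMost[OF assms(2)])
    fix \<xi>
    have "((\<lambda>z. exp (\<i> * (2 * pi * x * z)) / (2 * pi * \<i> * x)) has_field_derivative exp (\<i> * (2 * pi * x * \<xi>)))
        (at (of_real \<xi>))"
      using assms(1) by (auto intro!: derivative_eq_intros simp: field_simps)
    from has_vector_derivative_real_field[OF this]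
    show "(?F has_vector_derivative cis (2 * pi * (x * \<xi>))) (at \<xi> within {a..b})"
      by (simp add: cis_conv_exp mult.assoc)
  qed (auto intro!: continuous_intros)
  finally show ?thesis by (simp add: diff_divide_distrib)
qed

lemma interval_ift_0: "a \<le> b \<Longrightarrow> interval_ift a b 0 = of_real (b - a)"
proof -
  assume "a \<le> b"
  have "interval_ift a b 0 = (\<integral>\<xi>. of_real (indicator {a<..<b} \<xi>) \<partial>lborel)"
    unfolding interval_ift_def by (intro Bochner_Integration.integral_cong) (auto simp: indicator_def)
  then show ?thesis using \<open>a \<le> b\<close> by simp
qed

lemma cnj_interval_ift: "cnj (interval_ift a b x) = interval_ift a b (- x)"
proof -
  have "cnj (interval_ift a b x) = (\<integral>\<xi>. cnj (indicator {a<..<b} \<xi> * cis (2 * pi * (x * \<xi>))) \<partial>lborel)"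
    unfolding interval_ift_def by (rule Bochner_Integration.integral_cnj[symmetric])
  then show ?thesis by (simp add: interval_ift_def cis_cnj)
qed

lemma cmod_interval_ift_le: "a \<le> b \<Longrightarrow> cmod (interval_ift a b x) \<le> b - a"
proof -
  assume ab: "a \<le> b"
  have "cmod (interval_ift a b x) \<le> (\<integral>\<xi>. indicator {a<..<b} \<xi> \<partial>lborel)"
    unfolding interval_ift_def
    by (rule Bochner_Integration.integral_norm_bound_integral[OF integrable_indicator_cis])
       (use ab in \<open>auto simp: norm_mult\<close>)
  then show ?thesis using ab by simp
qed

text \<open>The function is bounded near the origin and decays at least like the reciprocal of the
  distance to it, so its square is dominated by a multiple of
  \<open>1 / (1 + x\<^sup>2)\<close>.\<close>

lemma interval_ift_L2: "interval_ift a b \<in> L2"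
proof (cases "a \<le> b")
  case True
  \<comment> \<open>\<open>(b - a)\<^sup>2\<close> bounds the squared modulus, and 1 bounds its
    product with \<open>x\<^sup>2\<close>.\<close>
  define K where "K = (b - a)\<^sup>2 + 1"
  have bound: "(cmod (interval_ift a b x))\<^sup>2 \<le> K * inverse (1 + x\<^sup>2)" for x
  proof -
    have 1: "(cmod (interval_ift a b x))\<^sup>2 \<le> (b - a)\<^sup>2"
      by (intro power_mono cmod_interval_ift_le True) simp
    have "cmod (interval_ift a b x) * \<bar>x\<bar> \<le> 1"
    proof (cases "x = 0")
      case False
      have "cmod (cis (2 * pi * (x * b)) - cis (2 * pi * (x * a))) \<le> 2"
        using norm_triangle_ineq4[of "cis (2 * pi * (x * b))" "cis (2 * pi * (x * a))"] by simp
      then have "cmod (interval_ift a b x) * \<bar>x\<bar> \<le> 1 / pi"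
        unfolding interval_ift_eq[OF False True] using False
        by (simp add: norm_divide norm_mult field_simps)
      also have "\<dots> \<le> 1" using pi_gt3 by simp
      finally show ?thesis .
    qed simp
    then have "(cmod (interval_ift a b x) * \<bar>x\<bar>)\<^sup>2 \<le> 1\<^sup>2" by (intro power_mono) auto
    then have "(cmod (interval_ift a b x))\<^sup>2 * (1 + x\<^sup>2) \<le> K"
      using 1 by (simp add: K_def power_mult_distrib distrib_left)
    moreover have "1 + x\<^sup>2 > 0" by (simp add: add_pos_nonneg)
    ultimately show ?thesis by (simp add: field_simps)
  qed
  show ?thesis
  proof (rule L2I)
    have "integrable lborel (\<lambda>x::real. inverse (1 + x\<^sup>2))"
      using integrable_inverse_1_plus_square by (simp add: set_integrable_def)
    then have "integrable lborel (\<lambda>x. K * inverse (1 + x\<^sup>2))" by simp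
    then show "integrable lborel (\<lambda>x. (cmod (interval_ift a b x))\<^sup>2)"
    proof (rule Bochner_Integration.integrable_bound)
      show "AE x in lborel. norm ((cmod (interval_ift a b x))\<^sup>2) \<le> norm (K * inverse (1 + x\<^sup>2))"
        using bound by (auto intro!: AE_I2 order_trans[OF _ abs_ge_self])
    qed measurable
  qed measurable
next
  case False
  then have "interval_ift a b = (\<lambda>_. 0)" by (auto simp: interval_ift_empty)
  then show ?thesis by simp
qed

text \<open>Levy's inversion formula for the uniform distribution on \<open>{a<..<b}\<close> is the Parseval identity
  for two intervals.\<close>

lemma interval_ift_inner:
  "l2_inner (interval_ift a b) (interval_ift c d) = measure lborel ({a<..<b} \<inter> {c<..<d})"
proof (cases "a < b \<and> c < d")
  case False
  then have "interval_ift a b = (\<lambda>_. 0) \<or> interval_ift c d = (\<lambda>_. 0)"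
    by (auto simp: interval_ift_empty fun_eq_iff)
  moreover have "{a<..<b} \<inter> {c<..<d} = {}" using False by auto
  ultimately show ?thesis by auto
next
  case True
  then have ab: "a < b" and cd: "c < d" by auto
  define M where "M = density lborel (\<lambda>x. ennreal (indicator {a<..<b} x / (b - a)))"
  have intM: "(\<integral>x. g x \<partial>M) = (\<integral>x. (indicator {a<..<b} x / (b - a)) *\<^sub>R g x \<partial>lborel)"
    if "g \<in> borel_measurable borel" for g :: "real \<Rightarrow> 'z::{banach, second_countable_topology}"
    unfolding M_def by (rule integral_density) (use that ab in auto)
  have emM: "emeasure M S = ennreal (measure lborel (S \<inter> {a<..<b}) / (b - a))" if [measurable]: "S \<in> sets borel" for S
  proof -
    have "emeasure M S = (\<integral>\<^sup>+x. ennreal (indicator {a<..<b} x / (b - a)) * indicator S x \<partial>lborel)"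
      unfolding M_def by (rule emeasure_density) auto
    also have "\<dots> = (\<integral>\<^sup>+x. ennreal (1 / (b - a)) * indicator (S \<inter> {a<..<b}) x \<partial>lborel)"
      by (intro nn_integral_cong) (auto simp: indicator_def)
    also have "\<dots> = ennreal (1 / (b - a)) * emeasure lborel (S \<inter> {a<..<b})"
      by (rule nn_integral_cmult_indicator) measurable
    also have "emeasure lborel (S \<inter> {a<..<b}) = ennreal (measure lborel (S \<inter> {a<..<b}))"
      by (rule emeasure_eq_ennreal_measure)
        (use emeasure_bounded_finite[of "S \<inter> {a<..<b}"] in \<open>auto simp: bounded_Int\<close>)
    finally show ?thesis using ab by (simp add: ennreal_mult''[symmetric] flip: ennreal_mult)
  qed
  have "prob_space M"
  proof (rule prob_spaceI)
    have "space M = UNIV" by (simp add: M_def)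
    then show "emeasure M (space M) = 1" using ab by (simp add: emM)
  qed
  then interpret real_distribution M
    by (simp add: real_distribution_def real_distribution_axioms_def M_def)
  have mM: "measure M S = measure lborel (S \<inter> {a<..<b}) / (b - a)" if "S \<in> sets borel" for S
    using ab by (simp add: measure_def emM that)
  \<comment> \<open>Characteristic functions carry no factor \<open>2 * pi\<close> in the exponent,
    so the argument is rescaled.\<close>
  have char: "char M t = interval_ift a b (t / (2 * pi)) / (b - a)" for t
  proof -
    have "char M t = (\<integral>x. (indicator {a<..<b} x / (b - a)) *\<^sub>R cis (t * x) \<partial>lborel)"
      unfolding char_def cis_conv_exp[symmetric] by (subst intM) (auto simp: cis_conv_exp)
    also have "\<dots> = (\<integral>x. (indicator {a<..<b} x * cis (2 * pi * (t / (2 * pi) * x))) / of_real (b - a) \<partial>lborel)"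
      by (intro Bochner_Integration.integral_cong) (auto simp: indicator_def scaleR_conv_of_real)
    also have "\<dots> = interval_ift a b (t / (2 * pi)) / (b - a)"
      unfolding interval_ift_def by simp
    finally show ?thesis .
  qed
  define h where "h x = interval_ift a b x * cnj (interval_ift c d x)" for x
  have h: "integrable lborel h"
    unfolding h_def by (intro integrable_L2_inner interval_ift_L2)
  have h': "integrable lborel (\<lambda>t. h (t / (2 * pi)))"
    using lborel_integrable_real_affine[OF h, of "1 / (2 * pi)" 0] by simp
  have hm[measurable]: "(\<lambda>t. h (t / (2 * pi))) \<in> borel_measurable borel"
    using borel_measurable_integrable[OF h'] by simp
  \<comment> \<open>Levy's formula asks that the endpoints \<open>c\<close> and \<open>d\<close>
    carry no mass.\<close>
  have sing: "measure lborel ({x} \<inter> {a<..<b}) = 0" for x :: real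
  proof -
    have "measure lborel ({x} \<inter> {a<..<b}) \<le> measure lborel {x}"
      by (rule measure_mono_fmeasurable) (auto simp: fmeasurable_def)
    then show ?thesis by (simp add: antisym)
  qed
  have L: "(\<lambda>T. 1 / (2 * pi) * (CLBINT t=-real T..real T. (iexp (-(t * c)) - iexp (-(t * d))) / (\<i> * t) * char M t))
      \<longlonglongrightarrow> of_real (measure M {c<..d})"
    using Levy_Inversion[of c d] cd by (simp add: mM sing)
  have E: "(CLBINT t=-real T..real T. (iexp (-(t * c)) - iexp (-(t * d))) / (\<i> * t) * char M t)
      = (\<integral>t. indicator {- real T..real T} t * (h (t / (2 * pi)) / (b - a)) \<partial>lborel)" for T
  proof -
    have "(CLBINT t=-real T..real T. (iexp (-(t * c)) - iexp (-(t * d))) / (\<i> * t) * char M t)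
      = (CLBINT t:{- real T..real T}. (iexp (-(t * c)) - iexp (-(t * d))) / (\<i> * t) * char M t)"
      using interval_integral_Icc[of "- real T" "real T"] by simp
    also have "\<dots> = (\<integral>t. indicator {- real T..real T} t * (h (t / (2 * pi)) / (b - a)) \<partial>lborel)"
      unfolding set_lebesgue_integral_def
    proof (rule integral_cong_AE)
      have "AE t in lborel. t \<noteq> (0::real)" by (rule AE_lborel_singleton)
      then show "AE t in lborel. indicator {- real T..real T} t *\<^sub>R ((iexp (-(t * c)) - iexp (-(t * d))) / (\<i> * t) * char M t)
        = indicator {- real T..real T} t * (h (t / (2 * pi)) / (b - a))"
      proof eventually_elim
        case (elim t)
        \<comment> \<open>Levy's kernel is the conjugate transform of the other interval; the closed
          formula for it holds away from 0.\<close>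
        have "cnj (interval_ift c d (t / (2 * pi))) = (iexp (-(t * c)) - iexp (-(t * d))) / (\<i> * t)"
          unfolding cnj_interval_ift using elim cd
          by (subst interval_ift_eq) (auto simp: cis_conv_exp field_simps)
        then show ?case by (simp add: h_def char indicator_def)
      qed
      show "(\<lambda>t. indicator {- real T..real T} t *\<^sub>R ((iexp (-(t * c)) - iexp (-(t * d))) / (\<i> * t) * char M t)) \<in> borel_measurable lborel"
        unfolding char by measurable
    qed measurable
    finally show ?thesis .
  qed
  have "(\<lambda>T. 1 / (2 * pi) * (\<integral>t. indicator {- real T..real T} t * (h (t / (2 * pi)) / (b - a)) \<partial>lborel))
      \<longlonglongrightarrow> of_real (measure M {c<..d})" by (rule L[unfolded E])
  \<comment> \<open>Levy's formula is a limit over symmetric windows. As \<open>h\<close> is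
    integrable, the same limit is the integral over the whole line, so the two values can be
    compared.\<close>
  moreover have "(\<lambda>T. 1 / (2 * pi) * (\<integral>t. indicator {- real T..real T} t * (h (t / (2 * pi)) / (b - a)) \<partial>lborel))
      \<longlonglongrightarrow> 1 / (2 * pi) * (\<integral>t. h (t / (2 * pi)) / (b - a) \<partial>lborel)"
  proof (rule tendsto_mult[OF tendsto_const], rule integral_dominated_convergence)
    show "integrable lborel (\<lambda>t. cmod (h (t / (2 * pi)) / (b - a)))" using h' by simp
    show "AE t in lborel. (\<lambda>T. indicator {- real T..real T} t * (h (t / (2 * pi)) / (b - a))) \<longlonglongrightarrow> h (t / (2 * pi)) / (b - a)"
    proof (rule AE_I2)
      fix t :: real
      obtain N where N: "\<bar>t\<bar> \<le> real N" using real_arch_simple by blast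
      have "\<forall>\<^sub>F T in sequentially. indicator {- real T..real T} t * (h (t / (2 * pi)) / (b - a)) = h (t / (2 * pi)) / (b - a)"
        using N by (intro eventually_sequentiallyI[of N]) (auto simp: indicator_def)
      then show "(\<lambda>T. indicator {- real T..real T} t * (h (t / (2 * pi)) / (b - a))) \<longlonglongrightarrow> h (t / (2 * pi)) / (b - a)"
        by (rule tendsto_eventually)
    qed
    show "AE t in lborel. cmod (indicator {- real T..real T} t * (h (t / (2 * pi)) / (b - a))) \<le> cmod (h (t / (2 * pi)) / (b - a))" for T
      by (auto simp: indicator_def)
  qed measurable
  ultimately have "of_real (measure M {c<..d}) = 1 / (2 * pi) * (\<integral>t. h (t / (2 * pi)) / (b - a) \<partial>lborel)"
    by (rule LIMSEQ_unique)
  also have "(\<integral>t. h (t / (2 * pi)) / (b - a) \<partial>lborel) = (\<integral>t. h (t / (2 * pi)) \<partial>lborel) / (b - a)"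
    by simp
  also have "(\<integral>t. h (t / (2 * pi)) \<partial>lborel) = 2 * pi * (\<integral>x. h x \<partial>lborel)"
    using lborel_integral_real_affine[of "1 / (2 * pi)" h 0] by (simp add: scaleR_conv_of_real field_simps)
  finally have "of_real (measure M {c<..d}) = (\<integral>x. h x \<partial>lborel) / (b - a)" by simp
  then have "(\<integral>x. h x \<partial>lborel) = of_real (measure M {c<..d} * (b - a))"
    using ab by (simp add: field_simps)
  also have "measure M {c<..d} * (b - a) = measure lborel ({c<..d} \<inter> {a<..<b})"
    using ab by (simp add: mM)
  also have "\<dots> = measure lborel ({a<..<b} \<inter> {c<..<d})"
  proof (rule measure_eq_AE)
    show "AE x in lborel. (x \<in> {c<..d} \<inter> {a<..<b}) = (x \<in> {a<..<b} \<inter> {c<..<d})"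
      using AE_lborel_singleton[of d] by eventually_elim auto
  qed auto
  finally show ?thesis by (simp add: l2_inner_def h_def)
qed

section \<open>Lebesgue measure on the plane and tensor products\<close>

lemma Basis_real2: "(Basis :: (real^2) set) = {axis 1 1, axis 2 1}"
  by (auto simp: Basis_vec_def UNIV_2)

lemma axis_12_neq [simp]: "(axis 1 1 :: real^2) \<noteq> axis 2 1" "(axis 2 1 :: real^2) \<noteq> axis 1 1"
  by (simp_all add: axis_eq_axis)

lemma inner_real2: "(x :: real^2) \<bullet> y = x $ 1 * y $ 1 + x $ 2 * y $ 2"
  by (simp add: inner_vec_def sum_2)

lemma vec_eq_2: "(x :: 'a^2) = y \<longleftrightarrow> x $ 1 = y $ 1 \<and> x $ 2 = y $ 2"
  by (simp add: vec_eq_iff forall_2)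

lemma mem_box_2: "(x :: real^2) \<in> box a b \<longleftrightarrow> x $ 1 \<in> {a $ 1<..<b $ 1} \<and> x $ 2 \<in> {a $ 2<..<b $ 2}"
  by (auto simp: mem_box_cart forall_2)

lemma measurable_vec_nth [measurable]: "(\<lambda>x :: real^2. x $ i) \<in> borel_measurable borel"
  by (intro borel_measurable_continuous_onI continuous_intros)

lemma vector_2_measurable: "(\<lambda>p. vector [fst p, snd p] :: real^2) \<in> borel_measurable (lborel \<Otimes>\<^sub>M lborel)"
proof -
  have "(\<lambda>p. vector [fst p, snd p] :: real^2) = (\<lambda>p. fst p *\<^sub>R axis 1 1 + snd p *\<^sub>R axis 2 1)"
    by (auto simp: vec_eq_2 axis_def)
  also have "\<dots> \<in> borel_measurable (lborel \<Otimes>\<^sub>M lborel)"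
    by measurable
  finally show ?thesis .
qed

text \<open>Lebesgue measure is determined by its values on boxes, and a box in the plane is a
  product of two intervals. This makes Fubini's theorem for product measures available for integrals
  over \<open>real^2\<close>.\<close>

lemma lborel_real2: "(lborel :: (real^2) measure) = distr (lborel \<Otimes>\<^sub>M lborel) borel (\<lambda>p. vector [fst p, snd p])"
proof (rule lborel_eqI)
  note [measurable] = vector_2_measurable
  fix l u :: "real^2" assume le: "\<And>b. b \<in> Basis \<Longrightarrow> l \<bullet> b \<le> u \<bullet> b"
  have le: "l $ 1 \<le> u $ 1" "l $ 2 \<le> u $ 2"
    using le[of "axis 1 1"] le[of "axis 2 1"] by (simp_all add: Basis_real2 inner_axis)
  have "emeasure (distr (lborel \<Otimes>\<^sub>M lborel) borel (\<lambda>p. vector [fst p, snd p])) (box l u)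
      = emeasure (lborel \<Otimes>\<^sub>M lborel) ({l $ 1<..<u $ 1} \<times> {l $ 2<..<u $ 2})"
    by (subst emeasure_distr) (auto intro!: arg_cong2[where f = emeasure] simp: mem_box_2 space_pair_measure)
  also have "\<dots> = ennreal (u $ 1 - l $ 1) * ennreal (u $ 2 - l $ 2)"
    using le by (subst lborel.emeasure_pair_measure_Times) auto
  also have "\<dots> = ennreal (\<Prod>b\<in>Basis. (u - l) \<bullet> b)"
    using le by (simp add: Basis_real2 inner_axis ennreal_mult)
  finally show "emeasure (distr (lborel \<Otimes>\<^sub>M lborel) borel (\<lambda>p. vector [fst p, snd p])) (box l u)
    = ennreal (\<Prod>b\<in>Basis. (u - l) \<bullet> b)" .
qed simp

lemma
  fixes f g :: "real \<Rightarrow> 'a::{real_normed_field, banach, second_countable_topology}"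
  assumes f: "integrable lborel f" and g: "integrable lborel g"
  shows integrable_tensor: "integrable lborel (\<lambda>v::real^2. f (v $ 1) * g (v $ 2))" (is ?I)
    and integral_tensor: "(\<integral>v. f (v $ 1) * g (v $ 2) \<partial>(lborel :: (real^2) measure)) = (\<integral>x. f x \<partial>lborel) * (\<integral>y. g y \<partial>lborel)" (is ?E)
proof -
  note [measurable] = vector_2_measurable
  have [measurable]: "f \<in> borel_measurable borel" "g \<in> borel_measurable borel"
    using f g by (auto dest: borel_measurable_integrable)
  have i: "integrable (lborel \<Otimes>\<^sub>M lborel) (\<lambda>p. f (fst p) * g (snd p))"
  proof (rule lborel_pair.Fubini_integrable)
    show "integrable lborel (\<lambda>x. \<integral>y. norm (f (fst (x, y)) * g (snd (x, y))) \<partial>lborel)"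
      using f by (simp add: norm_mult)
    show "AE x in lborel. integrable lborel (\<lambda>y. f (fst (x, y)) * g (snd (x, y)))"
      using g by simp
  qed measurable
  then show ?I
    by (subst lborel_real2, subst integrable_distr_eq) auto
  have "(\<integral>v. f (v $ 1) * g (v $ 2) \<partial>(lborel :: (real^2) measure)) = (\<integral>p. f (fst p) * g (snd p) \<partial>(lborel \<Otimes>\<^sub>M lborel))"
    by (subst lborel_real2, subst integral_distr) auto
  also have "\<dots> = (\<integral>x. (\<integral>y. f x * g y \<partial>lborel) \<partial>lborel)"
    using lborel_pair.integral_fst'[OF i] by simp
  also have "\<dots> = (\<integral>x. f x \<partial>lborel) * (\<integral>y. g y \<partial>lborel)"
    by simp
  finally show ?E .
qed

lemma tensor_fun_L2:
  assumes f: "f \<in> L2" and g: "g \<in> L2"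
  shows "tensor_fun f g \<in> L2"
proof (rule L2I)
  note [measurable] = f[THEN L2_measurable_borel] g[THEN L2_measurable_borel]
  show "tensor_fun f g \<in> borel_measurable lborel" unfolding tensor_fun_def by measurable
  show "integrable lborel (\<lambda>x. (cmod (tensor_fun f g x))\<^sup>2)"
    using integrable_tensor[OF L2_integrable[OF f] L2_integrable[OF g]]
    by (simp add: tensor_fun_def norm_mult power_mult_distrib)
qed

lemma tensor_fun_inner:
  assumes "f \<in> L2" "g \<in> L2" "f' \<in> L2" "g' \<in> L2"
  shows "l2_inner (tensor_fun f g) (tensor_fun f' g') = l2_inner f f' * l2_inner g g'"
  using integral_tensor[OF integrable_L2_inner[OF assms(1,3)] integrable_L2_inner[OF assms(2,4)]]
  by (simp add: l2_inner_def tensor_fun_def mult_ac)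

lemma indicator_box_tensor:
  "(indicator (box a b) :: real^2 \<Rightarrow> complex) = tensor_fun (indicator {a $ 1<..<b $ 1}) (indicator {a $ 2<..<b $ 2})"
  by (auto simp: tensor_fun_def mem_box_2 indicator_def fun_eq_iff)

lemma l2_inner_indicator:
  assumes "S \<in> sets borel" "T \<in> sets borel" "bounded S"
  shows "l2_inner (indicator S :: 'a::euclidean_space \<Rightarrow> complex) (indicator T) = measure lborel (S \<inter> T)"
proof -
  have "emeasure lborel (S \<inter> T) < \<infinity>" using assms by (intro emeasure_bounded_finite) (auto simp: bounded_Int)
  moreover have "l2_inner (indicator S :: 'a \<Rightarrow> complex) (indicator T) = (\<integral>x. of_real (indicator (S \<inter> T) x) \<partial>lborel)"
    unfolding l2_inner_def by (intro Bochner_Integration.integral_cong) (auto simp: indicator_def)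
  ultimately show ?thesis using assms by simp
qed

text \<open>The first hypothesis says that \<open>T\<close> changes Lebesgue measure by the constant
  factor \<open>c\<close>, and the factor \<open>sqrt c\<close> compensates this in the norm.
  Translations are the case \<open>c = 1\<close>, dilations along the axes the case
  \<open>c = s * t\<close>.\<close>

lemma l2_inner_change_of_variables:
  fixes f g :: "'a::euclidean_space \<Rightarrow> complex"
  assumes "lborel = density (distr lborel borel T) (\<lambda>_. ennreal c)" "c > 0" "T \<in> borel_measurable borel"
    and f: "f \<in> L2" and g: "g \<in> L2"
  shows "(\<lambda>x. of_real (sqrt c) * f (T x)) \<in> L2"
    "l2_inner (\<lambda>x. of_real (sqrt c) * f (T x)) (\<lambda>x. of_real (sqrt c) * g (T x)) = l2_inner f g"
proof -
  note [measurable] = f[THEN L2_measurable_borel] g[THEN L2_measurable_borel] assms(3)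
  have I: "integrable lborel h \<longleftrightarrow> integrable lborel (\<lambda>x. c *\<^sub>R h (T x))"
    and E: "(\<integral>x. h x \<partial>lborel) = (\<integral>x. c *\<^sub>R h (T x) \<partial>lborel)"
    if [measurable]: "h \<in> borel_measurable borel" for h :: "'a \<Rightarrow> 'z::{banach, second_countable_topology}"
  proof -
    have "integrable lborel h \<longleftrightarrow> integrable (density (distr lborel borel T) (\<lambda>_. ennreal c)) h"
      using assms(1) by simp
    also have "\<dots> \<longleftrightarrow> integrable lborel (\<lambda>x. c *\<^sub>R h (T x))"
      using assms(2) by (subst integrable_density) (auto simp: integrable_distr_eq)
    finally show "integrable lborel h \<longleftrightarrow> integrable lborel (\<lambda>x. c *\<^sub>R h (T x))" .
    have "(\<integral>x. h x \<partial>lborel) = (\<integral>x. h x \<partial>(density (distr lborel borel T) (\<lambda>_. ennreal c)))"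
      using assms(1) by simp
    also have "\<dots> = (\<integral>x. c *\<^sub>R h (T x) \<partial>lborel)"
      using assms(2) by (subst integral_density) (auto simp: integral_distr)
    finally show "(\<integral>x. h x \<partial>lborel) = (\<integral>x. c *\<^sub>R h (T x) \<partial>lborel)" .
  qed
  show "(\<lambda>x. of_real (sqrt c) * f (T x)) \<in> L2"
  proof (rule L2I)
    have "integrable lborel (\<lambda>x. c *\<^sub>R (cmod (f (T x)))\<^sup>2)"
      using L2_integrable[OF f] by (subst (asm) I) auto
    then show "integrable lborel (\<lambda>x. (cmod (of_real (sqrt c) * f (T x)))\<^sup>2)"
      using assms(2) by (simp add: norm_mult power_mult_distrib)
  qed measurable
  have "of_real (sqrt c) * of_real (sqrt c) = complex_of_real c"
    using assms(2) by (simp flip: of_real_mult)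
  then have "(of_real (sqrt c) * z) * cnj (of_real (sqrt c) * w) = c *\<^sub>R (z * cnj w)" for z w
    by (simp add: scaleR_conv_of_real)
  then have "l2_inner (\<lambda>x. of_real (sqrt c) * f (T x)) (\<lambda>x. of_real (sqrt c) * g (T x))
      = (\<integral>x. c *\<^sub>R (f (T x) * cnj (g (T x))) \<partial>lborel)"
    by (simp add: l2_inner_def)
  also have "\<dots> = l2_inner f g"
    unfolding l2_inner_def
    by (rule E[symmetric], rule borel_measurable_integrable[OF integrable_L2_inner[OF f g], simplified])
  finally show "l2_inner (\<lambda>x. of_real (sqrt c) * f (T x)) (\<lambda>x. of_real (sqrt c) * g (T x)) = l2_inner f g" .
qed

lemma l2_isometry_translate: "l2_isometry (translate (k :: 'a::euclidean_space))"
proof -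
  have L: "lborel = density (distr lborel borel (\<lambda>x :: 'a. x - k)) (\<lambda>_. ennreal 1)"
    using lborel_affine[of 1 "- k"] by simp
  then show ?thesis
    using l2_inner_change_of_variables[OF L] by (simp add: l2_isometry_def translate_def[abs_def])
qed

text \<open>The sign is chosen so that the Fourier transform carries translation by \<open>k\<close>
  to modulation by \<open>k\<close>.\<close>

definition modulate :: "'a::euclidean_space \<Rightarrow> ('a \<Rightarrow> complex) \<Rightarrow> 'a \<Rightarrow> complex" where
  "modulate k f = (\<lambda>\<xi>. cis (- (2 * pi * (k \<bullet> \<xi>))) * f \<xi>)"

lemma l2_isometry_modulate: "l2_isometry (modulate k)"
  unfolding l2_isometry_def
proof (intro conjI ballI)
  show "modulate k f \<in> L2" if "f \<in> L2" for f
    unfolding modulate_def by (rule L2_mult_bounded[OF that, where C = 1]) auto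
  have "modulate k f x * cnj (modulate k g x) = f x * cnj (g x)" for f g x
  proof -
    have "cis (- (2 * pi * (k \<bullet> x))) * cis (2 * pi * (k \<bullet> x)) = 1" by (simp add: cis_mult)
    then show ?thesis by (simp add: modulate_def cis_cnj algebra_simps)
  qed
  then show "l2_inner (modulate k f) (modulate k g) = l2_inner f g" for f g
    by (simp add: l2_inner_def)
qed

definition axis_scale :: "real \<Rightarrow> real \<Rightarrow> real^2 \<Rightarrow> real^2" where
  "axis_scale s t x = vector [s * x $ 1, t * x $ 2]"

text \<open>With real parameters, all products of integer powers of the two dilation operators
  belong to one family, in which composition multiplies the parameters.\<close>

definition axis_dilate :: "real \<Rightarrow> real \<Rightarrow> (real^2 \<Rightarrow> complex) \<Rightarrow> real^2 \<Rightarrow> complex" where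
  "axis_dilate s t f = (\<lambda>x. of_real (sqrt (s * t)) * f (axis_scale s t x))"

lemma axis_scale_nth [simp]: "axis_scale s t x $ 1 = s * x $ 1" "axis_scale s t x $ 2 = t * x $ 2"
  by (simp_all add: axis_scale_def)

lemma axis_scale_eq: "axis_scale s t x = (s * x $ 1) *\<^sub>R axis 1 1 + (t * x $ 2) *\<^sub>R axis 2 1"
  by (simp add: vec_eq_2 axis_def)

lemma axis_scale_measurable [measurable]: "axis_scale s t \<in> borel_measurable borel"
  unfolding axis_scale_eq[abs_def] by measurable

lemma l2_isometry_axis_dilate:
  assumes "s > 0" "t > 0"
  shows "l2_isometry (axis_dilate s t)"
proof -
  define c where "c j = (if j = (axis 1 1 :: real^2) then s else t)" for j
  have "lborel = density (distr lborel borel (\<lambda>x. 0 + (\<Sum>j\<in>Basis. (c j * (x \<bullet> j)) *\<^sub>R j))) (\<lambda>_. (\<Prod>j\<in>Basis. \<bar>c j\<bar>))"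
    by (rule lborel_affine_euclidean) (use assms in \<open>auto simp: c_def\<close>)
  also have "(\<lambda>x. 0 + (\<Sum>j\<in>Basis. (c j * (x \<bullet> j)) *\<^sub>R j)) = axis_scale s t"
    by (auto simp: Basis_real2 c_def axis_scale_eq inner_axis)
  also have "(\<Prod>j\<in>Basis. \<bar>c j\<bar>) = s * t" using assms by (simp add: Basis_real2 c_def)
  finally have L: "lborel = density (distr lborel borel (axis_scale s t)) (\<lambda>_. ennreal (s * t))" .
  show ?thesis
    using l2_inner_change_of_variables[OF L] assms by (simp add: l2_isometry_def axis_dilate_def[abs_def])
qed

section \<open>Construction of the Fourier transform on the plane\<close>

definition box_ift :: "real^2 \<Rightarrow> real^2 \<Rightarrow> real^2 \<Rightarrow> complex" where
  "box_ift a b = tensor_fun (interval_ift (a $ 1) (b $ 1)) (interval_ift (a $ 2) (b $ 2))"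

lemma box_ift_L2: "box_ift a b \<in> L2"
  unfolding box_ift_def by (intro tensor_fun_L2 interval_ift_L2)

lemma indicator_box_L2: "(indicator (box a b) :: 'a::euclidean_space \<Rightarrow> complex) \<in> L2"
  by (rule L2_indicator_bounded) auto

lemma indicator_interval_L2: "(indicator {a<..<b::real} :: real \<Rightarrow> complex) \<in> L2"
  by (rule L2_indicator_bounded) auto

text \<open>Parseval's identity for intervals, once in each variable. It is the equality of Gram
  matrices that the isometric extension asks for.\<close>

lemma box_ift_inner: "l2_inner (box_ift a b) (box_ift c d) = l2_inner (indicator (box a b)) (indicator (box c d))"
  unfolding box_ift_def indicator_box_tensor
  by (simp add: tensor_fun_inner interval_ift_L2 indicator_interval_L2 interval_ift_inner l2_inner_indicator)

lemma l2_inner_cnj: "l2_inner (\<lambda>x. cnj (f x)) (\<lambda>x. cnj (g x)) = cnj (l2_inner f g)"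
proof -
  have "cnj (l2_inner f g) = (\<integral>x. cnj (f x * cnj (g x)) \<partial>lborel)"
    unfolding l2_inner_def by (rule Bochner_Integration.integral_cnj[symmetric])
  then show ?thesis by (simp add: l2_inner_def)
qed

lemma indicator_boxes_total:
  "l2_closure (l2_span (\<lambda>(a, b). indicator (box a b)) UNIV) = (L2 :: ('a::euclidean_space \<Rightarrow> complex) set)"
  by (rule closed_l2_subspace_eq_L2)
    (use indicator_box_L2 l2_closure_span_memI[of UNIV "\<lambda>(a, b). indicator (box a b)"] in \<open>auto intro!: closed_l2_subspace_span\<close>)

lemma ex_inverse_fourier:
  "\<exists>T. l2_isometry T \<and> (\<forall>a b. l2_eq (T (indicator (box a b))) (box_ift a b))"
proof (rule l2_isometry_extension[of "\<lambda>(a, b). indicator (box a b :: (real^2) set)" "\<lambda>(a, b). box_ift a b"])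
  show "l2_inner (case i of (a, b) \<Rightarrow> box_ift a b) (case j of (a, b) \<Rightarrow> box_ift a b)
    = l2_inner (case i of (a, b) \<Rightarrow> indicator (box a b)) (case j of (a, b) \<Rightarrow> indicator (box a b))" for i j
    by (simp add: case_prod_unfold box_ift_inner)
  fix T :: "(real^2 \<Rightarrow> complex) \<Rightarrow> real^2 \<Rightarrow> complex"
  assume "l2_isometry T" "\<And>i. l2_eq (T (case i of (a, b) \<Rightarrow> indicator (box a b))) (case i of (a, b) \<Rightarrow> box_ift a b)"
  from this(1) this(2)[of "(a, b)" for a b] show ?thesis by auto
qed (use box_ift_L2 indicator_box_L2 indicator_boxes_total in auto)

text \<open>For a real function the Fourier transform is the conjugate of the inverse transform,
  which gives the values on boxes. Conjugation leaves the Gram matrix as it is because inner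
  products of indicators are real.\<close>

lemma ex_fourier:
  "\<exists>T. l2_isometry T \<and> (\<forall>a b. l2_eq (T (indicator (box a b))) (\<lambda>x. cnj (box_ift a b x)))"
proof (rule l2_isometry_extension[of "\<lambda>(a, b). indicator (box a b :: (real^2) set)" "\<lambda>(a, b) x. cnj (box_ift a b x)"])
  show "l2_inner (case i of (a, b) \<Rightarrow> \<lambda>x. cnj (box_ift a b x)) (case j of (a, b) \<Rightarrow> \<lambda>x. cnj (box_ift a b x))
    = l2_inner (case i of (a, b) \<Rightarrow> indicator (box a b)) (case j of (a, b) \<Rightarrow> indicator (box a b))" for i j
  proof -
    have "cnj (l2_inner (indicator S) (indicator T :: real^2 \<Rightarrow> complex)) = l2_inner (indicator S) (indicator T)" for S T
      unfolding l2_inner_cnj[symmetric] by simp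
    then show ?thesis by (simp add: case_prod_unfold l2_inner_cnj box_ift_inner)
  qed
  fix T :: "(real^2 \<Rightarrow> complex) \<Rightarrow> real^2 \<Rightarrow> complex"
  assume "l2_isometry T" "\<And>i. l2_eq (T (case i of (a, b) \<Rightarrow> indicator (box a b))) (case i of (a, b) \<Rightarrow> \<lambda>x. cnj (box_ift a b x))"
  from this(1) this(2)[of "(a, b)" for a b] show ?thesis by auto
qed (use box_ift_L2 L2_cnj indicator_box_L2 indicator_boxes_total in auto)

text \<open>The operator is determined only up to equality almost everywhere, hence a choice; what
  is known about it is the isometry property and the values on boxes.\<close>

definition l2_ift :: "(real^2 \<Rightarrow> complex) \<Rightarrow> real^2 \<Rightarrow> complex" where
  "l2_ift = (SOME T. l2_isometry T \<and> (\<forall>a b. l2_eq (T (indicator (box a b))) (box_ift a b)))"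

definition l2_ft :: "(real^2 \<Rightarrow> complex) \<Rightarrow> real^2 \<Rightarrow> complex" where
  "l2_ft = (SOME T. l2_isometry T \<and> (\<forall>a b. l2_eq (T (indicator (box a b))) (\<lambda>x. cnj (box_ift a b x))))"

lemma l2_isometry_ift: "l2_isometry l2_ift"
  and l2_ift_box: "l2_eq (l2_ift (indicator (box a b))) (box_ift a b)"
  using someI_ex[OF ex_inverse_fourier] by (auto simp: l2_ift_def)

lemma l2_isometry_ft: "l2_isometry l2_ft"
  and l2_ft_box: "l2_eq (l2_ft (indicator (box a b))) (\<lambda>x. cnj (box_ift a b x))"
  using someI_ex[OF ex_fourier] by (auto simp: l2_ft_def)

lemmas l2_ft_L2 = l2_isometryD(1)[OF l2_isometry_ft] and l2_ift_L2 = l2_isometryD(1)[OF l2_isometry_ift]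

text \<open>Both sides are linear and continuous in \<open>f\<close>, so an adjoint relation need
  only be checked on boxes.\<close>

lemma closed_l2_subspace_inner_agree:
  assumes T: "l2_isometry T" and g: "g \<in> L2" and h: "h \<in> L2"
  shows "closed_l2_subspace {f \<in> L2. l2_inner (T f) g = l2_inner f h}"
  unfolding closed_l2_subspace_def
proof (intro conjI ballI allI)
  note TL = l2_isometryD(1)[OF T]
  show "(\<lambda>_. 0) \<in> {f \<in> L2. l2_inner (T f) g = l2_inner f h}"
    using l2_inner_cong[OF l2_isometry_zero[OF T] l2_eq_refl[of g]] by (simp add: TL g)
  {
    fix f1 f2 assume f: "f1 \<in> {f \<in> L2. l2_inner (T f) g = l2_inner f h}" "f2 \<in> {f \<in> L2. l2_inner (T f) g = l2_inner f h}"
    then have fL: "f1 \<in> L2" "f2 \<in> L2" by auto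
    have "l2_inner (T (\<lambda>x. f1 x + f2 x)) g = l2_inner (\<lambda>x. T f1 x + T f2 x) g"
      by (intro l2_inner_cong l2_isometry_add[OF T] l2_eq_refl TL L2_add fL g)
    then show "(\<lambda>x. f1 x + f2 x) \<in> {f \<in> L2. l2_inner (T f) g = l2_inner f h}"
      using f by (simp add: L2_add l2_inner_add_left TL g h)
  }
  {
    fix c f assume f: "f \<in> {f \<in> L2. l2_inner (T f) g = l2_inner f h}"
    then have fL: "f \<in> L2" by auto
    have "l2_inner (T (\<lambda>x. c * f x)) g = l2_inner (\<lambda>x. c * T f x) g"
      by (intro l2_inner_cong l2_isometry_cmult[OF T] l2_eq_refl TL L2_cmult fL g)
    then show "(\<lambda>x. c * f x) \<in> {f \<in> L2. l2_inner (T f) g = l2_inner f h}"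
      using f by (simp add: L2_cmult l2_inner_cmult_left)
  }
  show "l2_closure {f \<in> L2. l2_inner (T f) g = l2_inner f h} \<subseteq> {f \<in> L2. l2_inner (T f) g = l2_inner f h}"
  proof
    fix f assume f: "f \<in> l2_closure {f \<in> L2. l2_inner (T f) g = l2_inner f h}"
    then have fL: "f \<in> L2" by (auto simp: l2_closure_def)
    \<comment> \<open>The defect is at most the distance from \<open>f\<close> to an approximant
      times the sum of the two norms; the added 1 makes the divisor positive.\<close>
    define K where "K = l2_norm g + l2_norm h + 1"
    have K: "K > 0" unfolding K_def by (intro add_nonneg_pos add_nonneg_nonneg) auto
    have "cmod (l2_inner (T f) g - l2_inner f h) \<le> 0 + e" if e: "e > 0" for e
    proof -
      have "e / K > 0" using e K by simp
      then obtain p where p: "p \<in> L2" "l2_inner (T p) g = l2_inner p h" "l2_norm (\<lambda>x. f x - p x) < e / K"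
        using f unfolding l2_closure_def by blast
      have "l2_inner (T f) g - l2_inner f h = l2_inner (\<lambda>x. T f x - T p x) g - l2_inner (\<lambda>x. f x - p x) h"
        by (simp add: l2_inner_diff_left TL fL p g h)
      also have "cmod \<dots> \<le> cmod (l2_inner (\<lambda>x. T f x - T p x) g) + cmod (l2_inner (\<lambda>x. f x - p x) h)"
        by (rule norm_triangle_ineq4)
      also have "\<dots> \<le> l2_norm (\<lambda>x. T f x - T p x) * l2_norm g + l2_norm (\<lambda>x. f x - p x) * l2_norm h"
        by (intro add_mono l2_Cauchy_Schwarz L2_diff TL fL p g h)
      also have "\<dots> \<le> l2_norm (\<lambda>x. f x - p x) * K"
        unfolding l2_isometry_norm_diff[OF T fL p(1)] by (simp add: K_def distrib_left)
      also have "\<dots> \<le> e" using p(3) K by (simp add: field_simps)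
      finally show ?thesis by simp
    qed
    then have "cmod (l2_inner (T f) g - l2_inner f h) \<le> 0" by (rule field_le_epsilon)
    then show "f \<in> {f \<in> L2. l2_inner (T f) g = l2_inner f h}" using fL by simp
  qed
qed auto

text \<open>The Fourier kernel is symmetric in its two variables, and on a bounded rectangle
  Fubini's theorem applies.\<close>

lemma integral_interval_ift_swap:
  "(\<integral>x. indicator {c<..<d} x * cnj (interval_ift a b x) \<partial>lborel)
    = (\<integral>\<xi>. indicator {a<..<b} \<xi> * cnj (interval_ift c d \<xi>) \<partial>lborel)"
proof -
  let ?g = "\<lambda>x \<xi>. (indicator {c<..<d} x * indicator {a<..<b} \<xi>) * cis (- (2 * pi * (x * \<xi>)))"
  have cnj_eq: "cnj (interval_ift a b x) = (\<integral>\<xi>. indicator {a<..<b} \<xi> * cis (- (2 * pi * (x * \<xi>))) \<partial>lborel)" for a b x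
    unfolding cnj_interval_ift by (simp add: interval_ift_def)
  have "integrable (lborel \<Otimes>\<^sub>M lborel) (\<lambda>p. ?g (fst p) (snd p))"
  proof (rule Bochner_Integration.integrable_bound)
    have "emeasure (lborel \<Otimes>\<^sub>M lborel) ({c<..<d} \<times> {a<..<b}) < \<infinity>"
      using emeasure_bounded_finite[of "{c<..<d}"] emeasure_bounded_finite[of "{a<..<b}"]
      by (subst lborel.emeasure_pair_measure_Times) (auto simp: ennreal_mult_less_top)
    then show "integrable (lborel \<Otimes>\<^sub>M lborel) (indicator ({c<..<d} \<times> {a<..<b}) :: _ \<Rightarrow> real)"
      by simp
    show "AE p in lborel \<Otimes>\<^sub>M lborel. norm (?g (fst p) (snd p)) \<le> norm (indicator ({c<..<d} \<times> {a<..<b}) p :: real)"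
      by (auto simp: norm_mult indicator_def)
  qed measurable
  then have "(\<integral>x. (\<integral>\<xi>. ?g x \<xi> \<partial>lborel) \<partial>lborel) = (\<integral>\<xi>. (\<integral>x. ?g x \<xi> \<partial>lborel) \<partial>lborel)"
    by (intro lborel_pair.Fubini_integral[symmetric]) (simp add: case_prod_unfold)
  moreover have "(\<integral>\<xi>. ?g x \<xi> \<partial>lborel) = indicator {c<..<d} x * cnj (interval_ift a b x)" for x
    by (simp add: cnj_eq mult.assoc)
  moreover have "(\<integral>x. ?g x \<xi> \<partial>lborel) = indicator {a<..<b} \<xi> * cnj (interval_ift c d \<xi>)" for \<xi>
  proof -
    have "(\<integral>x. ?g x \<xi> \<partial>lborel) = (\<integral>x. indicator {a<..<b} \<xi> * (indicator {c<..<d} x * cis (- (2 * pi * (\<xi> * x)))) \<partial>lborel)"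
      by (simp add: mult_ac)
    then show ?thesis by (simp add: cnj_eq)
  qed
  ultimately show ?thesis by simp
qed

text \<open>For two box indicators this is the exchange of integrals in each variable; density
  extends it first in \<open>f\<close>, then in \<open>g\<close>.\<close>

lemma l2_ft_adjoint:
  assumes f: "f \<in> L2" and g: "g \<in> L2"
  shows "l2_inner (l2_ft f) g = l2_inner f (l2_ift g)"
proof -
  have bb: "l2_inner (l2_ft (indicator (box a b))) (indicator (box c d)) = l2_inner (indicator (box a b)) (l2_ift (indicator (box c d)))"
    for a b c d :: "real^2"
  proof -
    have cnj_box: "(\<lambda>x. cnj (box_ift a b x)) = tensor_fun (\<lambda>x. cnj (interval_ift (a $ 1) (b $ 1) x)) (\<lambda>x. cnj (interval_ift (a $ 2) (b $ 2) x))"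
      for a b by (auto simp: box_ift_def tensor_fun_def)
    have "l2_inner (l2_ft (indicator (box a b))) (indicator (box c d)) = l2_inner (\<lambda>x. cnj (box_ift a b x)) (indicator (box c d))"
      by (intro l2_inner_cong l2_ft_box l2_eq_refl l2_ft_L2 indicator_box_L2 L2_cnj box_ift_L2)
    also have "\<dots> = l2_inner (\<lambda>x. cnj (interval_ift (a $ 1) (b $ 1) x)) (indicator {c $ 1<..<d $ 1})
        * l2_inner (\<lambda>x. cnj (interval_ift (a $ 2) (b $ 2) x)) (indicator {c $ 2<..<d $ 2})"
      unfolding cnj_box indicator_box_tensor by (intro tensor_fun_inner L2_cnj interval_ift_L2 indicator_interval_L2)
    also have "\<dots> = l2_inner (indicator {a $ 1<..<b $ 1}) (interval_ift (c $ 1) (d $ 1))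
        * l2_inner (indicator {a $ 2<..<b $ 2}) (interval_ift (c $ 2) (d $ 2))"
      using integral_interval_ift_swap by (simp add: l2_inner_def mult.commute)
    also have "\<dots> = l2_inner (indicator (box a b)) (box_ift c d)"
      unfolding box_ift_def indicator_box_tensor by (intro tensor_fun_inner[symmetric] interval_ift_L2 indicator_interval_L2)
    also have "\<dots> = l2_inner (indicator (box a b)) (l2_ift (indicator (box c d)))"
      by (intro l2_inner_cong l2_ift_box[THEN l2_eq_sym] l2_eq_refl l2_ift_L2 indicator_box_L2 box_ift_L2)
    finally show ?thesis .
  qed
  have fb: "l2_inner (l2_ft f) (indicator (box c d)) = l2_inner f (l2_ift (indicator (box c d)))" if "f \<in> L2" for f c d
  proof -
    have "{f \<in> L2. l2_inner (l2_ft f) (indicator (box c d)) = l2_inner f (l2_ift (indicator (box c d)))} = L2"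
      by (rule closed_l2_subspace_eq_L2[OF closed_l2_subspace_inner_agree[OF l2_isometry_ft indicator_box_L2 l2_ift_L2[OF indicator_box_L2]]])
        (simp add: bb indicator_box_L2)
    then show ?thesis using that by blast
  qed
  have "{g \<in> L2. l2_inner (l2_ift g) f = l2_inner g (l2_ft f)} = L2"
  proof (rule closed_l2_subspace_eq_L2[OF closed_l2_subspace_inner_agree[OF l2_isometry_ift f l2_ft_L2[OF f]]])
    show "indicator (box a b) \<in> {g \<in> L2. l2_inner (l2_ift g) f = l2_inner g (l2_ft f)}" for a b
      using fb[OF f, of a b] indicator_box_L2
      by (simp add: l2_inner_commute[of "l2_ift _"] l2_inner_commute[of "indicator _" "l2_ft f"])
  qed
  then have "l2_inner (l2_ift g) f = l2_inner g (l2_ft f)" using g by blast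
  then show ?thesis
    by (simp add: l2_inner_commute[of "l2_ft f" g] l2_inner_commute[of f "l2_ift g"])
qed

lemma l2_eq_if_inner_eq:
  assumes "f \<in> L2" "g \<in> L2" "\<And>h. h \<in> L2 \<Longrightarrow> l2_inner f h = l2_inner g h"
  shows "l2_eq f g"
proof -
  have "l2_inner (\<lambda>x. f x - g x) (\<lambda>x. f x - g x) = 0"
    using assms by (simp add: l2_inner_diff_left L2_diff)
  then show ?thesis by (simp add: l2_norm_diff_eq_0 assms l2_inner_self)
qed

text \<open>Two isometries that are adjoint to each other are inverse to each other: the inner
  product of \<open>l2_ft (l2_ift f)\<close> with \<open>h\<close> equals that of
  \<open>l2_ift f\<close> with \<open>l2_ift h\<close>, hence that of \<open>f\<close> with
  \<open>h\<close>. Plancherel's theorem, including surjectivity, comes out of this and its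
  counterpart below.\<close>

lemma l2_ft_ift: "f \<in> L2 \<Longrightarrow> l2_eq (l2_ft (l2_ift f)) f"
  by (intro l2_eq_if_inner_eq l2_ft_L2 l2_ift_L2)
    (simp_all add: l2_ft_adjoint l2_ift_L2 l2_isometryD(2)[OF l2_isometry_ift])

lemma l2_ift_ft:
  assumes f: "f \<in> L2" shows "l2_eq (l2_ift (l2_ft f)) f"
proof (intro l2_eq_if_inner_eq l2_ft_L2 l2_ift_L2 f)
  fix h :: "real^2 \<Rightarrow> complex" assume h: "h \<in> L2"
  have "l2_inner (l2_ift (l2_ft f)) h = cnj (l2_inner h (l2_ift (l2_ft f)))" by (rule l2_inner_commute)
  also have "\<dots> = cnj (l2_inner (l2_ft h) (l2_ft f))" by (simp add: l2_ft_adjoint h f l2_ft_L2)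
  also have "\<dots> = cnj (l2_inner h f)" by (simp add: l2_isometryD(2)[OF l2_isometry_ft] h f)
  also have "\<dots> = l2_inner f h" by (rule l2_inner_commute[symmetric])
  finally show "l2_inner (l2_ift (l2_ft f)) h = l2_inner f h" .
qed

section \<open>Translations and dilations under the Fourier transform\<close>

lemma interval_ift_translate: "interval_ift (a + k) (b + k) x = cis (2 * pi * (k * x)) * interval_ift a b x"
proof -
  have "interval_ift (a + k) (b + k) x = (\<integral>\<xi>. indicator {a + k<..<b + k} (k + 1 * \<xi>) * cis (2 * pi * (x * (k + 1 * \<xi>))) \<partial>lborel)"
    unfolding interval_ift_def by (subst lborel_integral_real_affine[of 1 _ k]) auto
  also have "\<dots> = (\<integral>\<xi>. cis (2 * pi * (k * x)) * (indicator {a<..<b} \<xi> * cis (2 * pi * (x * \<xi>))) \<partial>lborel)"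
    by (intro Bochner_Integration.integral_cong) (auto simp: indicator_def cis_mult algebra_simps)
  finally show ?thesis by (simp add: interval_ift_def)
qed

lemma interval_ift_scale:
  assumes "s > 0"
  shows "interval_ift (a / s) (b / s) x = of_real (1 / s) * interval_ift a b (x / s)"
proof -
  have "interval_ift a b (x / s) = of_real s * (\<integral>\<xi>. indicator {a<..<b} (0 + s * \<xi>) * cis (2 * pi * (x / s * (0 + s * \<xi>))) \<partial>lborel)"
    unfolding interval_ift_def using assms by (subst lborel_integral_real_affine[of s _ 0]) (auto simp: scaleR_conv_of_real)
  also have "(\<integral>\<xi>. indicator {a<..<b} (0 + s * \<xi>) * cis (2 * pi * (x / s * (0 + s * \<xi>))) \<partial>lborel) = interval_ift (a / s) (b / s) x"
    unfolding interval_ift_def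
    by (intro Bochner_Integration.integral_cong) (use assms in \<open>auto simp: indicator_def field_simps\<close>)
  finally show ?thesis using assms by simp
qed

text \<open>Both sides are isometries in \<open>f\<close>, so they are compared on boxes, which
  translations map to boxes.\<close>

lemma l2_ft_translate:
  assumes "f \<in> L2"
  shows "l2_eq (l2_ft (translate k f)) (modulate k (l2_ft f))"
proof (rule l2_isometry_agree_on_boxes[OF _ _ _ assms])
  show "l2_isometry (\<lambda>f. l2_ft (translate k f))" "l2_isometry (\<lambda>f. modulate k (l2_ft f))"
    by (rule l2_isometry_comp[OF l2_isometry_ft l2_isometry_translate] l2_isometry_comp[OF l2_isometry_modulate l2_isometry_ft])+
  fix a b :: "real^2"
  have "translate k (indicator (box a b)) = (indicator (box (a + k) (b + k)) :: real^2 \<Rightarrow> complex)"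
    by (auto simp: translate_def indicator_def mem_box_2 fun_eq_iff)
  moreover have "(\<lambda>x. cnj (box_ift (a + k) (b + k) x)) = modulate k (\<lambda>x. cnj (box_ift a b x))"
  proof
    fix x
    have "cis (- (2 * pi * (k \<bullet> x))) = cis (- (2 * pi * (k $ 1 * x $ 1))) * cis (- (2 * pi * (k $ 2 * x $ 2)))"
      by (simp add: inner_real2 cis_mult algebra_simps)
    then show "cnj (box_ift (a + k) (b + k) x) = modulate k (\<lambda>x. cnj (box_ift a b x)) x"
      by (simp add: modulate_def box_ift_def tensor_fun_def interval_ift_translate cis_cnj)
  qed
  moreover have "l2_eq (modulate k (\<lambda>x. cnj (box_ift a b x))) (modulate k (l2_ft (indicator (box a b))))"
    by (intro l2_isometry_cong[OF l2_isometry_modulate] L2_cnj box_ift_L2 l2_ft_L2 indicator_box_L2 l2_ft_box[THEN l2_eq_sym])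
  ultimately show "l2_eq (l2_ft (translate k (indicator (box a b)))) (modulate k (l2_ft (indicator (box a b))))"
    using l2_eq_trans[OF l2_ft_box[of "a + k" "b + k"]] by simp
qed

lemma l2_ft_axis_dilate:
  assumes s: "s > 0" and t: "t > 0" and f: "f \<in> L2"
  shows "l2_eq (l2_ft (axis_dilate s t f)) (axis_dilate (1 / s) (1 / t) (l2_ft f))"
proof (rule l2_isometry_agree_on_boxes[OF _ _ _ f])
  have iso: "l2_isometry (axis_dilate s t)" "l2_isometry (axis_dilate (1 / s) (1 / t))"
    using s t by (auto intro!: l2_isometry_axis_dilate)
  show "l2_isometry (\<lambda>f. l2_ft (axis_dilate s t f))" "l2_isometry (\<lambda>f. axis_dilate (1 / s) (1 / t) (l2_ft f))"
    by (rule l2_isometry_comp[OF l2_isometry_ft iso(1)] l2_isometry_comp[OF iso(2) l2_isometry_ft])+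
  fix a b :: "real^2"
  define a' where "a' = axis_scale (1 / s) (1 / t) a"
  define b' where "b' = axis_scale (1 / s) (1 / t) b"
  have 1: "axis_dilate s t (indicator (box a b)) = (\<lambda>x. of_real (sqrt (s * t)) * indicator (box a' b') x)"
    using s t by (auto simp: axis_dilate_def indicator_def mem_box_2 fun_eq_iff a'_def b'_def field_simps)
  have "l2_eq (l2_ft (axis_dilate s t (indicator (box a b)))) (\<lambda>x. of_real (sqrt (s * t)) * l2_ft (indicator (box a' b')) x)"
    unfolding 1 by (rule l2_isometry_cmult[OF l2_isometry_ft indicator_box_L2])
  also have "l2_eq \<dots> (\<lambda>x. of_real (sqrt (s * t)) * cnj (box_ift a' b' x))"
    by (intro l2_eq_mult l2_ft_box)
  also have "\<dots> = axis_dilate (1 / s) (1 / t) (\<lambda>x. cnj (box_ift a b x))"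
  proof -
    \<comment> \<open>The normalization of the dilation times the Jacobian of the shrunken box is
      the normalization of the inverse dilation.\<close>
    have "sqrt (s * t) * (1 / s * (1 / t)) = sqrt (1 / s * (1 / t))"
      using s t by (simp add: real_sqrt_divide real_sqrt_mult field_simps flip: real_sqrt_mult)
    then have r: "complex_of_real (sqrt (s * t)) * (of_real (1 / s) * of_real (1 / t)) = of_real (sqrt (1 / s * (1 / t)))"
      by (metis of_real_mult)
    show ?thesis
    proof
      fix x
      have "cnj (box_ift a' b' x) = (of_real (1 / s) * of_real (1 / t)) * cnj (box_ift a b (axis_scale (1 / s) (1 / t) x))"
        using interval_ift_scale[OF s, of "a $ 1" "b $ 1" "x $ 1"] interval_ift_scale[OF t, of "a $ 2" "b $ 2" "x $ 2"]
        by (simp add: box_ift_def tensor_fun_def a'_def b'_def)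
      then show "of_real (sqrt (s * t)) * cnj (box_ift a' b' x) = axis_dilate (1 / s) (1 / t) (\<lambda>x. cnj (box_ift a b x)) x"
        unfolding axis_dilate_def r[symmetric] by (simp only: mult.assoc)
    qed
  qed
  also have "l2_eq \<dots> (axis_dilate (1 / s) (1 / t) (l2_ft (indicator (box a b))))"
    by (intro l2_isometry_cong[OF iso(2)] L2_cnj box_ift_L2 l2_ft_L2 indicator_box_L2 l2_ft_box[THEN l2_eq_sym])
  finally show "l2_eq (l2_ft (axis_dilate s t (indicator (box a b)))) (axis_dilate (1 / s) (1 / t) (l2_ft (indicator (box a b))))" .
qed

section \<open>Orthonormal bases of exponentials\<close>

lemma int_lattice_iff: "k \<in> int_lattice \<longleftrightarrow> k $ 1 \<in> \<int> \<and> k $ 2 \<in> \<int>"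
  by (simp add: int_lattice_def forall_2)

lemma cos_int_period: "cos (2 * pi * (y - of_int n)) = cos (2 * pi * y)"
proof -
  have "sin (2 * pi * of_int n) = 0" "cos (2 * pi * of_int n) = 1"
    using sin_int_2pin cos_int_2pin by auto
  then show ?thesis by (simp add: right_diff_distrib cos_diff)
qed

text \<open>The cosine is a trigonometric polynomial that measures the distance to the nearest
  integer, so its superlevel sets are periodized intervals. This is the link from integer
  exponentials to boxes. The limit 1/2 on \<open>w\<close> is where the cosine stops
  decreasing.\<close>

lemma cos_gt_iff_near_int:
  assumes "0 < w" "w \<le> 1/2"
  shows "cos (2 * pi * w) < cos (2 * pi * y) \<longleftrightarrow> (\<exists>n::int. \<bar>y - n\<bar> < w)"
proof -
  have *: "cos (2 * pi * w) < cos (2 * pi * y) \<longleftrightarrow> \<bar>y - of_int n\<bar> < w" if "\<bar>y - of_int n\<bar> \<le> 1/2" for n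
  proof -
    have "cos (2 * pi * y) = cos (2 * pi * \<bar>y - of_int n\<bar>)"
      using cos_int_period[of y n] cos_abs_real[of "2 * pi * (y - of_int n)"] by (simp add: abs_mult)
    moreover have "cos (2 * pi * w) < cos (2 * pi * \<bar>y - of_int n\<bar>) \<longleftrightarrow> 2 * pi * \<bar>y - of_int n\<bar> < 2 * pi * w"
      by (rule cos_mono_less_eq) (use that assms in \<open>auto simp: mult_left_le field_simps\<close>)
    ultimately show ?thesis by simp
  qed
  have "\<bar>y - of_int (round y)\<bar> \<le> 1/2"
    using of_int_round_abs_le[of y] by (simp add: abs_minus_commute)
  from *[OF this] have "cos (2 * pi * w) < cos (2 * pi * y) \<Longrightarrow> \<exists>n::int. \<bar>y - n\<bar> < w" by blast
  moreover have "cos (2 * pi * w) < cos (2 * pi * y)" if "\<bar>y - of_int n\<bar> < w" for n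
    using *[of n] that assms by simp
  ultimately show ?thesis by blast
qed

text \<open>Weierstrass approximation of ramps that rise from 0 at \<open>c\<close> with slope
  \<open>n\<close>. The uniform bound 2 prepares dominated convergence.\<close>

lemma polynomials_tend_to_indicator:
  obtains p :: "nat \<Rightarrow> real \<Rightarrow> real"
  where "\<And>n. real_polynomial_function (p n)" "\<And>n t. \<bar>t\<bar> \<le> 1 \<Longrightarrow> \<bar>p n t\<bar> \<le> 2"
    "\<And>t. \<bar>t\<bar> \<le> 1 \<Longrightarrow> (\<lambda>n. p n t) \<longlonglongrightarrow> indicator {c<..} t"
proof -
  define g where "g n t = min 1 (max 0 (real n * (t - c)))" for n t
  have ex: "\<exists>p. real_polynomial_function p \<and> (\<forall>t\<in>{-1..1}. \<bar>g n t - p t\<bar> < 1 / real (Suc n))" for n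
  proof -
    have "continuous_on {-1..1} (g n)" unfolding g_def by (intro continuous_intros)
    from Stone_Weierstrass_real_polynomial_function[OF compact_Icc this, of "1 / real (Suc n)"]
    obtain q where "real_polynomial_function q" "\<And>t. t \<in> {-1..1} \<Longrightarrow> \<bar>g n t - q t\<bar> < 1 / real (Suc n)"
      by (metis of_nat_0_less_iff zero_less_Suc zero_less_divide_1_iff)
    then show ?thesis by (intro exI[of _ q] conjI ballI)
  qed
  define p where "p n = (SOME p. real_polynomial_function p \<and> (\<forall>t\<in>{-1..1}. \<bar>g n t - p t\<bar> < 1 / real (Suc n)))" for n
  have p: "real_polynomial_function (p n)" "t \<in> {-1..1} \<Longrightarrow> \<bar>g n t - p n t\<bar> < 1 / real (Suc n)" for n t
    using someI_ex[OF ex[of n]] unfolding p_def[symmetric] by auto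
  show thesis
  proof (rule that[of p])
    fix n and t :: real assume t: "\<bar>t\<bar> \<le> 1"
    have "\<bar>g n t\<bar> \<le> 1" by (auto simp: g_def)
    moreover have "\<bar>g n t - p n t\<bar> < 1 / real (Suc n)" using t by (intro p(2)) auto
    moreover have "1 / real (Suc n) \<le> 1" by simp
    ultimately show "\<bar>p n t\<bar> \<le> 2" by linarith
  next
    fix t :: real assume t: "\<bar>t\<bar> \<le> 1"
    have g: "(\<lambda>n. g n t) \<longlonglongrightarrow> indicator {c<..} t"
    proof (cases "t > c")
      case True
      obtain N where N: "1 / (t - c) \<le> real N" using real_arch_simple by blast
      have "\<forall>\<^sub>F n in sequentially. g n t = indicator {c<..} t"
      proof (rule eventually_sequentiallyI[of N])
        fix n assume "N \<le> n"
        then have "1 / (t - c) \<le> real n" using N by linarith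
        then have "1 \<le> real n * (t - c)" using True by (simp add: field_simps)
        then show "g n t = indicator {c<..} t" using True by (simp add: g_def)
      qed
      then show ?thesis by (rule tendsto_eventually)
    next
      case False
      then have "g n t = 0" for n by (simp add: g_def mult_nonneg_nonpos)
      then show ?thesis using False by simp
    qed
    have "(\<lambda>n. p n t - g n t) \<longlonglongrightarrow> 0"
    proof (rule Lim_null_comparison)
      show "\<forall>\<^sub>F n in sequentially. norm (p n t - g n t) \<le> 1 / real (Suc n)"
      proof (intro always_eventually allI)
        fix n
        have "\<bar>g n t - p n t\<bar> < 1 / real (Suc n)" using t by (intro p(2)) auto
        then show "norm (p n t - g n t) \<le> 1 / real (Suc n)" unfolding real_norm_def by linarith
      qed
      show "(\<lambda>n. 1 / real (Suc n)) \<longlonglongrightarrow> 0" using LIMSEQ_inverse_real_of_nat by (simp add: inverse_eq_divide)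
    qed
    from tendsto_add[OF this g] show "(\<lambda>n. p n t) \<longlonglongrightarrow> indicator {c<..} t" by simp
  qed (rule p)
qed

text \<open>Quantifying over all lattice vectors \<open>k\<close> makes the class stable under
  multiplication by integer exponentials, which only shift \<open>k\<close>. It therefore contains
  the trigonometric polynomials and, by bounded limits, indicators of periodized boxes.\<close>

definition exponential_multipliers :: "(real^2) set \<Rightarrow> (real^2 \<Rightarrow> complex) set" where
  "exponential_multipliers S = {h \<in> borel_measurable borel. (\<exists>B. \<forall>x. cmod (h x) \<le> B) \<and>
     (\<forall>k\<in>int_lattice. (\<lambda>x. h x * modulate k (indicator S) x)
        \<in> l2_closure (l2_span (\<lambda>k. modulate k (indicator S)) int_lattice))}"

context
  fixes S :: "(real^2) set"
  assumes S: "S \<in> sets borel" "bounded S"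
begin

lemma modulate_indicator_L2: "modulate k (indicator S) \<in> L2"
  by (intro l2_isometryD(1)[OF l2_isometry_modulate] L2_indicator_bounded S)

lemma closed_exponential_span:
  "closed_l2_subspace (l2_closure (l2_span (\<lambda>k. modulate k (indicator S)) int_lattice))"
  by (intro closed_l2_subspace_span modulate_indicator_L2)

lemma exponential_multipliers_one: "(\<lambda>_. 1) \<in> exponential_multipliers S"
  unfolding exponential_multipliers_def
  by (auto intro!: exI[of _ 1] l2_closure_span_memI modulate_indicator_L2)

lemma exponential_multipliers_add:
  assumes "h \<in> exponential_multipliers S" "g \<in> exponential_multipliers S"
  shows "(\<lambda>x. h x + g x) \<in> exponential_multipliers S"
proof -
  obtain B C where B: "\<And>x. cmod (h x) \<le> B" "\<And>x. cmod (g x) \<le> C"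
    using assms unfolding exponential_multipliers_def by auto
  have "cmod (h x + g x) \<le> B + C" for x
    using norm_triangle_ineq[of "h x" "g x"] B[of x] by linarith
  moreover have "(\<lambda>x. (h x + g x) * modulate k (indicator S) x)
      \<in> l2_closure (l2_span (\<lambda>k. modulate k (indicator S)) int_lattice)" if "k \<in> int_lattice" for k
    unfolding distrib_right
    using assms that by (intro closed_l2_subspaceD(3)[OF closed_exponential_span]) (auto simp: exponential_multipliers_def)
  ultimately show ?thesis using assms by (auto simp: exponential_multipliers_def)
qed

lemma exponential_multipliers_cmult:
  assumes "h \<in> exponential_multipliers S"
  shows "(\<lambda>x. c * h x) \<in> exponential_multipliers S"
proof -
  obtain B where B: "\<And>x. cmod (h x) \<le> B"
    using assms unfolding exponential_multipliers_def by auto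
  have "cmod (c * h x) \<le> cmod c * B" for x
    using B[of x] by (simp add: norm_mult mult_left_mono)
  moreover have "(\<lambda>x. c * h x * modulate k (indicator S) x)
      \<in> l2_closure (l2_span (\<lambda>k. modulate k (indicator S)) int_lattice)" if "k \<in> int_lattice" for k
    unfolding mult.assoc
    using assms that by (intro closed_l2_subspaceD(4)[OF closed_exponential_span]) (auto simp: exponential_multipliers_def)
  ultimately show ?thesis using assms by (auto simp: exponential_multipliers_def)
qed

lemma exponential_multipliers_cis:
  assumes h: "h \<in> exponential_multipliers S" and j: "j \<in> int_lattice"
  shows "(\<lambda>x. cis (- (2 * pi * (j \<bullet> x))) * h x) \<in> exponential_multipliers S"
proof -
  have [measurable]: "h \<in> borel_measurable borel" using h by (simp add: exponential_multipliers_def)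
  have "(\<lambda>x. cis (- (2 * pi * (j \<bullet> x))) * h x * modulate k (indicator S) x)
      \<in> l2_closure (l2_span (\<lambda>k. modulate k (indicator S)) int_lattice)" if k: "k \<in> int_lattice" for k
  proof -
    have "k + j \<in> int_lattice" using j k by (auto simp: int_lattice_iff)
    moreover have "(\<lambda>x. cis (- (2 * pi * (j \<bullet> x))) * h x * modulate k (indicator S) x) = (\<lambda>x. h x * modulate (k + j) (indicator S) x)"
    proof
      fix x
      have "cis (- (2 * pi * ((k + j) \<bullet> x))) = cis (- (2 * pi * (j \<bullet> x))) * cis (- (2 * pi * (k \<bullet> x)))"
        by (simp add: cis_mult algebra_simps)
      then show "cis (- (2 * pi * (j \<bullet> x))) * h x * modulate k (indicator S) x = h x * modulate (k + j) (indicator S) x"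
        by (simp add: modulate_def mult_ac)
    qed
    ultimately show ?thesis using h by (simp add: exponential_multipliers_def)
  qed
  then show ?thesis using h by (auto simp: exponential_multipliers_def norm_mult)
qed

lemma exponential_multipliers_cos:
  assumes h: "h \<in> exponential_multipliers S"
  shows "(\<lambda>x. of_real (cos (2 * pi * (x $ i - m))) * h x) \<in> exponential_multipliers S"
proof -
  have ax: "axis i 1 \<in> int_lattice" "- axis i 1 \<in> int_lattice"
    by (auto simp: int_lattice_def axis_def)
  have *: "of_real (cos (2 * pi * (x $ i - m)))
      = cis (- (2 * pi * m)) / 2 * cis (- (2 * pi * (- axis i 1 \<bullet> x))) + cis (2 * pi * m) / 2 * cis (- (2 * pi * (axis i 1 \<bullet> x)))" for x
  proof -
    have "of_real (cos t) = (cis t + cis (- t)) / 2" for t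
      by (simp add: complex_eq_iff)
    then have "of_real (cos (2 * pi * (x $ i - m))) = (cis (2 * pi * (x $ i - m)) + cis (- (2 * pi * (x $ i - m)))) / 2" .
    also have "\<dots> = (cis (- (2 * pi * m)) * cis (2 * pi * x $ i) + cis (2 * pi * m) * cis (- (2 * pi * x $ i))) / 2"
      by (simp add: cis_mult algebra_simps)
    finally show ?thesis by (simp add: inner_axis' add_divide_distrib)
  qed
  have "(\<lambda>x. cis (- (2 * pi * m)) / 2 * (cis (- (2 * pi * (- axis i 1 \<bullet> x))) * h x)
      + cis (2 * pi * m) / 2 * (cis (- (2 * pi * (axis i 1 \<bullet> x))) * h x)) \<in> exponential_multipliers S"
    by (intro exponential_multipliers_add exponential_multipliers_cmult exponential_multipliers_cis ax h)
  then show ?thesis by (simp only: * distrib_right mult.assoc[of "_ / 2"])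
qed

text \<open>Keeping \<open>h\<close> general in the induction lets a product of polynomials be
  applied one factor after the other.\<close>

lemma exponential_multipliers_polynomial:
  assumes "real_polynomial_function p" "h \<in> exponential_multipliers S"
  shows "(\<lambda>x. of_real (p (cos (2 * pi * (x $ i - m)))) * h x) \<in> exponential_multipliers S"
  using assms
proof (induction arbitrary: h)
  case (linear f)
  \<comment> \<open>A linear functional on the reals is multiplication by its value at 1.\<close>
  have "f t = f 1 * t" for t using linear_simps(5)[OF linear(1), of t 1] by simp
  then have "(\<lambda>x. of_real (f (cos (2 * pi * (x $ i - m)))) * h x)
      = (\<lambda>x. of_real (f 1) * (of_real (cos (2 * pi * (x $ i - m))) * h x))"
    by (metis (no_types, opaque_lifting) mult.assoc of_real_mult)
  then show ?case
    using exponential_multipliers_cmult[OF exponential_multipliers_cos[OF linear(2)]] by simp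
next
  case (const c)
  then show ?case by (rule exponential_multipliers_cmult)
next
  case (add f g)
  then show ?case by (simp add: distrib_right exponential_multipliers_add)
next
  case (mult f g)
  then show ?case by (simp add: mult.assoc)
qed

lemma exponential_multipliers_arc:
  assumes h: "h \<in> exponential_multipliers S"
  shows "(\<lambda>x. indicator {c<..} (cos (2 * pi * (x $ i - m))) * h x) \<in> exponential_multipliers S"
proof -
  obtain p where p: "\<And>n. real_polynomial_function (p n)" "\<And>n t. \<bar>t\<bar> \<le> 1 \<Longrightarrow> \<bar>p n t\<bar> \<le> 2"
    "\<And>t. \<bar>t\<bar> \<le> 1 \<Longrightarrow> (\<lambda>n. p n t) \<longlonglongrightarrow> indicator {c<..} t"
    using polynomials_tend_to_indicator by blast
  have hm[measurable]: "h \<in> borel_measurable borel" using h by (simp add: exponential_multipliers_def)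
  obtain B where B: "\<And>x. cmod (h x) \<le> B" using h by (auto simp: exponential_multipliers_def)
  have "(\<lambda>x. indicator {c<..} (cos (2 * pi * (x $ i - m))) * h x * modulate k (indicator S) x)
      \<in> l2_closure (l2_span (\<lambda>k. modulate k (indicator S)) int_lattice)" if k: "k \<in> int_lattice" for k
  proof (rule closed_l2_subspace_dominated[OF closed_exponential_span, where w = "\<lambda>x. 2 * B * cmod (modulate k (indicator S) x)"])
    show "(\<lambda>x. of_real (p n (cos (2 * pi * (x $ i - m)))) * h x * modulate k (indicator S) x)
      \<in> l2_closure (l2_span (\<lambda>k. modulate k (indicator S)) int_lattice)" for n
      using exponential_multipliers_polynomial[OF p(1) h] k by (simp add: exponential_multipliers_def)
    show "AE x in lborel. cmod (of_real (p n (cos (2 * pi * (x $ i - m)))) * h x * modulate k (indicator S) x)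
      \<le> 2 * B * cmod (modulate k (indicator S) x)" for n
      using p(2) B by (intro AE_I2) (auto simp: norm_mult intro!: mult_mono mult_right_mono)
    show "AE x in lborel. (\<lambda>n. of_real (p n (cos (2 * pi * (x $ i - m)))) * h x * modulate k (indicator S) x)
      \<longlonglongrightarrow> indicator {c<..} (cos (2 * pi * (x $ i - m))) * h x * modulate k (indicator S) x"
    proof (rule AE_I2)
      fix x :: "real^2"
      have "(\<lambda>n. complex_of_real (p n (cos (2 * pi * (x $ i - m))))) \<longlonglongrightarrow> of_real (indicator {c<..} (cos (2 * pi * (x $ i - m))))"
        by (intro tendsto_of_real p) simp
      then have "(\<lambda>n. complex_of_real (p n (cos (2 * pi * (x $ i - m))))) \<longlonglongrightarrow> indicator {c<..} (cos (2 * pi * (x $ i - m)))"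
        by (cases "c < cos (2 * pi * (x $ i - m))") simp_all
      then show "(\<lambda>n. of_real (p n (cos (2 * pi * (x $ i - m)))) * h x * modulate k (indicator S) x)
      \<longlonglongrightarrow> indicator {c<..} (cos (2 * pi * (x $ i - m))) * h x * modulate k (indicator S) x"
        by (intro tendsto_mult tendsto_const)
    qed
    show "integrable lborel (\<lambda>x. (2 * B * cmod (modulate k (indicator S) x))\<^sup>2)"
      using L2_integrable[OF modulate_indicator_L2] by (simp add: power_mult_distrib)
    have [measurable]: "modulate k (indicator S) \<in> borel_measurable borel"
      by (rule L2_measurable_borel[OF modulate_indicator_L2])
    show "(\<lambda>x. indicator {c<..} (cos (2 * pi * (x $ i - m))) * h x * modulate k (indicator S) x) \<in> borel_measurable lborel"
      by measurable
  qed
  moreover have "cmod (indicator {c<..} (cos (2 * pi * (x $ i - m))) * h x) \<le> B" for x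
    using B[of x] order_trans[OF norm_ge_zero B[of x]] by (auto simp: norm_mult indicator_def)
  moreover have "(\<lambda>x. indicator {c<..} (cos (2 * pi * (x $ i - m))) * h x) \<in> borel_measurable borel"
    by measurable
  ultimately show ?thesis by (auto simp: exponential_multipliers_def)
qed

text \<open>The product of an arc in each coordinate is the indicator of all integer translates of
  the box. By the packing property \<open>S\<close> meets these translates only in the box itself,
  so multiplication by the indicator of \<open>S\<close> leaves exactly the box.\<close>

lemma indicator_box_in_exponential_span:
  assumes packing: "\<And>x y. x \<in> S \<Longrightarrow> y \<in> S \<Longrightarrow> x - y \<in> int_lattice \<Longrightarrow> x = y"
    and sub: "box a b \<subseteq> S" and side: "\<And>i. b $ i - a $ i \<le> 1"
  shows "indicator (box a b) \<in> l2_closure (l2_span (\<lambda>k. modulate k (indicator S)) int_lattice)"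
proof (cases "box a b = {}")
  case True
  then show ?thesis using closed_l2_subspaceD(2)[OF closed_exponential_span] by (simp add: indicator_def[abs_def])
next
  case False
  then obtain x where "x \<in> box a b" by blast
  then have "a $ i < x $ i" "x $ i < b $ i" for i by (auto simp: mem_box_cart)
  then have ab: "a $ i < b $ i" for i using less_trans by blast
  \<comment> \<open>Midpoint and half side length; sides of length at most 1 give the half-width at
    most 1/2 that the cosine criterion asks for.\<close>
  define m where "m i = (a $ i + b $ i) / 2" for i
  define w where "w i = (b $ i - a $ i) / 2" for i
  have w: "0 < w i" "w i \<le> 1/2" for i using ab[of i] side[of i] by (auto simp: w_def)
  define arc where "arc i x = (indicator {cos (2 * pi * w i)<..} (cos (2 * pi * (x $ i - m i))) :: complex)" for i and x :: "real^2"
  have "(\<lambda>x. arc 1 x * (arc 2 x * 1)) \<in> exponential_multipliers S"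
    unfolding arc_def by (intro exponential_multipliers_arc exponential_multipliers_one)
  then have "(\<lambda>x. arc 1 x * (arc 2 x * 1) * modulate 0 (indicator S) x) \<in> l2_closure (l2_span (\<lambda>k. modulate k (indicator S)) int_lattice)"
    by (simp add: exponential_multipliers_def int_lattice_iff)
  moreover have "arc 1 x * (arc 2 x * 1) * modulate 0 (indicator S) x = indicator (box a b) x" for x
  proof -
    have near: "cos (2 * pi * w i) < cos (2 * pi * (x $ i - m i)) \<longleftrightarrow> (\<exists>n::int. x $ i - n \<in> {a $ i<..<b $ i})" for i
    proof -
      have "\<bar>x $ i - m i - n\<bar> < w i \<longleftrightarrow> x $ i - n \<in> {a $ i<..<b $ i}" for n :: real
        by (auto simp: m_def w_def abs_less_iff field_simps)
      then show ?thesis unfolding cos_gt_iff_near_int[OF w] by blast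
    qed
    have "x \<in> box a b \<longleftrightarrow> x \<in> S \<and> (\<exists>n::int. x $ 1 - n \<in> {a $ 1<..<b $ 1}) \<and> (\<exists>n::int. x $ 2 - n \<in> {a $ 2<..<b $ 2})"
    proof
      assume "x \<in> box a b"
      then show "x \<in> S \<and> (\<exists>n::int. x $ 1 - n \<in> {a $ 1<..<b $ 1}) \<and> (\<exists>n::int. x $ 2 - n \<in> {a $ 2<..<b $ 2})"
        using sub by (auto simp: mem_box_2 intro!: exI[of _ 0])
    next
      assume *: "x \<in> S \<and> (\<exists>n::int. x $ 1 - n \<in> {a $ 1<..<b $ 1}) \<and> (\<exists>n::int. x $ 2 - n \<in> {a $ 2<..<b $ 2})"
      then obtain n1 n2 :: int where n: "x $ 1 - n1 \<in> {a $ 1<..<b $ 1}" "x $ 2 - n2 \<in> {a $ 2<..<b $ 2}" by blast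
      define y :: "real^2" where "y = x - vector [of_int n1, of_int n2]"
      have y: "y \<in> box a b" using n by (simp add: mem_box_2 y_def)
      have "x = y" using * y sub by (intro packing) (auto simp: y_def int_lattice_iff)
      then show "x \<in> box a b" using y by simp
    qed
    then show ?thesis by (auto simp: arc_def modulate_def indicator_def near)
  qed
  ultimately show ?thesis by simp
qed

text \<open>Orthonormality depends only on the difference of two lattice vectors. For completeness,
  \<open>S\<close> is cut into boxes of side at most 1, all of whose subboxes have their indicators
  in the closed span, and the density argument is applied inside \<open>S\<close>.\<close>

lemma exponential_orthonormal_basis:
  assumes packing: "\<And>x y. x \<in> S \<Longrightarrow> y \<in> S \<Longrightarrow> x - y \<in> int_lattice \<Longrightarrow> x = y"
    and P: "finite P" "S = (\<Union>p\<in>P. box (l p) (u p))" "disjoint_family_on (\<lambda>p. box (l p) (u p)) P"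
    and side: "\<And>p i. p \<in> P \<Longrightarrow> u p $ i - l p $ i \<le> 1"
    and orth: "\<And>k. k \<in> int_lattice \<Longrightarrow> l2_inner (indicator S) (modulate k (indicator S)) = (if k = 0 then 1 else 0)"
  shows "l2_orthonormal_basis (\<lambda>k. modulate k (indicator S)) int_lattice (L2_on S)"
  unfolding l2_orthonormal_basis_def
proof (intro conjI ballI modulate_indicator_L2)
  fix k j assume kj: "k \<in> int_lattice" "j \<in> int_lattice"
  then have "j - k \<in> int_lattice" by (auto simp: int_lattice_iff)
  have "modulate k (indicator S) x * cnj (modulate j (indicator S) x)
    = indicator S x * cnj (modulate (j - k) (indicator S) x)" for x
  proof -
    have "cis (2 * pi * ((j - k) \<bullet> x)) = cis (- (2 * pi * (k \<bullet> x))) * cis (2 * pi * (j \<bullet> x))"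
      by (simp add: cis_mult algebra_simps)
    then show ?thesis by (simp add: modulate_def cis_cnj)
  qed
  then have "l2_inner (modulate k (indicator S)) (modulate j (indicator S)) = l2_inner (indicator S) (modulate (j - k) (indicator S))"
    by (simp add: l2_inner_def)
  also have "\<dots> = (if k = j then 1 else 0)" using orth[OF \<open>j - k \<in> int_lattice\<close>] by auto
  finally show "l2_inner (modulate k (indicator S)) (modulate j (indicator S)) = (if k = j then 1 else 0)" .
next
  let ?C = "l2_closure (l2_span (\<lambda>k. modulate k (indicator S)) int_lattice)"
  show "?C = L2_on S"
  proof
    show "?C \<subseteq> L2_on S"
      by (rule l2_closure_span_subset[OF closed_l2_subspace_L2_on[OF S(1)]])
        (use modulate_indicator_L2 in \<open>auto simp: L2_on_def modulate_def\<close>)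
    show "L2_on S \<subseteq> ?C"
    proof
      fix f assume f: "f \<in> L2_on S"
      then have fL: "f \<in> L2" by (simp add: L2_on_def)
      have "(\<lambda>x. indicator S x * f x) \<in> ?C"
      proof (rule closed_l2_subspace_contains_L2_on[OF closed_exponential_span S(1) _ fL])
        fix a b :: "real^2"
        have "indicator (box a b \<inter> S) = (\<lambda>x. \<Sum>p\<in>P. indicator (box a b \<inter> box (l p) (u p)) x :: complex)"
        proof -
          have eq: "box a b \<inter> S = (\<Union>p\<in>P. box a b \<inter> box (l p) (u p))" using P(2) by auto
          have "disjoint_family_on (\<lambda>p. box a b \<inter> box (l p) (u p)) P"
            using P(3) by (auto simp: disjoint_family_on_def)
          from indicator_UN_disjoint[OF P(1) this] show ?thesis
            unfolding eq by (rule ext)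
        qed
        moreover have "(indicator (box a b \<inter> box (l p) (u p)) :: real^2 \<Rightarrow> complex) \<in> ?C" if p: "p \<in> P" for p
        proof -
          define a' where "a' = (\<chi> i. max (a $ i) (l p $ i))"
          define b' where "b' = (\<chi> i. min (b $ i) (u p $ i))"
          have eq: "box a b \<inter> box (l p) (u p) = box a' b'"
            by (auto simp: mem_box_2 a'_def b'_def)
          show ?thesis unfolding eq
          proof (rule indicator_box_in_exponential_span[OF packing])
            show "box a' b' \<subseteq> S" using eq P(2) p by blast
            show "b' $ i - a' $ i \<le> 1" for i using side[OF p, of i] by (auto simp: a'_def b'_def)
          qed
        qed
        ultimately show "indicator (box a b \<inter> S) \<in> ?C"
          by (simp add: closed_l2_subspace_sum[OF closed_exponential_span])
      qed
      moreover have "l2_eq (\<lambda>x. indicator S x * f x) f"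
        using f by (auto simp: L2_on_def l2_eq_def indicator_def elim!: AE_mp)
      ultimately show "f \<in> ?C" using closed_l2_subspace_cong[OF closed_exponential_span _ fL] by blast
    qed
  qed
qed

end

section \<open>Band-limited functions\<close>

text \<open>A Paley-Wiener space with spectrum \<open>S\<close>. Orthogonal complements, sums and
  projections of such spaces become set operations on the spectra.\<close>

definition band :: "(real^2) set \<Rightarrow> (real^2 \<Rightarrow> complex) set" where
  "band S = {f \<in> L2. l2_ft f \<in> L2_on S}"

lemma band_L2: "f \<in> band S \<Longrightarrow> f \<in> L2"
  by (simp add: band_def)

lemma L2_on_cong:
  assumes f: "f \<in> L2_on S" and g: "g \<in> L2" and eq: "l2_eq f g"
  shows "g \<in> L2_on S"
proof -
  have "AE x in lborel. x \<notin> S \<longrightarrow> f x = 0" using f by (simp add: L2_on_def)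
  then have "AE x in lborel. x \<notin> S \<longrightarrow> g x = 0"
    using eq unfolding l2_eq_def by eventually_elim auto
  then show ?thesis using g by (simp add: L2_on_def)
qed

lemma L2_on_iff: "f \<in> L2 \<Longrightarrow> f \<in> L2_on S \<longleftrightarrow> l2_eq (\<lambda>x. indicator S x * f x) f"
  by (auto simp: L2_on_def l2_eq_def indicator_def elim!: AE_mp)

lemma L2_on_cong_set:
  assumes "AE x in lborel. x \<in> S \<longleftrightarrow> x \<in> T"
  shows "L2_on S = L2_on T"
proof -
  have "AE x in lborel. x \<notin> T \<longrightarrow> f x = 0"
    if "AE x in lborel. x \<notin> S \<longrightarrow> f x = 0" "AE x in lborel. x \<in> S \<longleftrightarrow> x \<in> T" for f :: "'a \<Rightarrow> complex" and S T :: "'a set"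
    using that by eventually_elim auto
  from this[of S _ T] this[of T _ S] assms show ?thesis
    unfolding L2_on_def by (auto elim!: AE_mp)
qed

lemma closed_l2_subspace_pullback:
  assumes F: "l2_isometry F" and C: "closed_l2_subspace C"
  shows "closed_l2_subspace {f \<in> L2. F f \<in> C}"
  unfolding closed_l2_subspace_def
proof (intro conjI ballI allI)
  note FL = l2_isometryD(1)[OF F]
  show "(\<lambda>_. 0) \<in> {f \<in> L2. F f \<in> C}"
    using closed_l2_subspace_cong[OF C closed_l2_subspaceD(2)[OF C] FL[OF L2_zero] l2_isometry_zero[OF F, THEN l2_eq_sym]] by simp
  show "(\<lambda>x. f x + g x) \<in> {f \<in> L2. F f \<in> C}" if "f \<in> {f \<in> L2. F f \<in> C}" "g \<in> {f \<in> L2. F f \<in> C}" for f g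
    using that closed_l2_subspace_cong[OF C closed_l2_subspaceD(3)[OF C, of "F f" "F g"] FL[OF L2_add[of f g]]
        l2_isometry_add[OF F, THEN l2_eq_sym]] by (simp add: L2_add)
  show "(\<lambda>x. c * f x) \<in> {f \<in> L2. F f \<in> C}" if "f \<in> {f \<in> L2. F f \<in> C}" for c f
    using that closed_l2_subspace_cong[OF C closed_l2_subspaceD(4)[OF C, of "F f" c] FL[OF L2_cmult[of f c]]
        l2_isometry_cmult[OF F, THEN l2_eq_sym]] by (simp add: L2_cmult)
  show "l2_closure {f \<in> L2. F f \<in> C} \<subseteq> {f \<in> L2. F f \<in> C}"
  proof
    fix f assume f: "f \<in> l2_closure {f \<in> L2. F f \<in> C}"
    then have fL: "f \<in> L2" by (auto simp: l2_closure_def)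
    have "\<exists>g\<in>C. l2_norm (\<lambda>x. F f x - g x) < e" if e: "e > 0" for e
    proof -
      obtain g where g: "g \<in> L2" "F g \<in> C" "l2_norm (\<lambda>x. f x - g x) < e"
        using f e unfolding l2_closure_def by blast
      then show ?thesis using l2_isometry_norm_diff[OF F fL g(1)] by (intro bexI[of _ "F g"]) auto
    qed
    then have "F f \<in> l2_closure C" using FL[OF fL] by (simp add: l2_closure_def)
    then show "f \<in> {f \<in> L2. F f \<in> C}" using closed_l2_subspaceD(5)[OF C] fL by blast
  qed
qed auto

lemma closed_l2_subspace_band: "S \<in> sets borel \<Longrightarrow> closed_l2_subspace (band S)"
  unfolding band_def by (intro closed_l2_subspace_pullback l2_isometry_ft closed_l2_subspace_L2_on)

lemma L2_on_mono: "S \<subseteq> T \<Longrightarrow> L2_on S \<subseteq> L2_on T"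
  by (auto simp: L2_on_def elim!: AE_mp)

lemma band_mono: "S \<subseteq> T \<Longrightarrow> band S \<subseteq> band T"
  using L2_on_mono[of S T] by (auto simp: band_def)

text \<open>The orthogonal projection onto \<open>band S\<close>.\<close>

definition band_cut :: "(real^2) set \<Rightarrow> (real^2 \<Rightarrow> complex) \<Rightarrow> real^2 \<Rightarrow> complex" where
  "band_cut S f = l2_ift (\<lambda>x. indicator S x * l2_ft f x)"

lemma
  assumes S: "S \<in> sets borel" and f: "f \<in> L2"
  shows band_cut_L2: "band_cut S f \<in> L2"
    and l2_ft_band_cut: "l2_eq (l2_ft (band_cut S f)) (\<lambda>x. indicator S x * l2_ft f x)"
    and band_cut_band: "band_cut S f \<in> band S"
proof -
  have L: "(\<lambda>x. indicator S x * l2_ft f x) \<in> L2" by (intro L2_indicator_mult l2_ft_L2 f S)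
  show 1: "band_cut S f \<in> L2" unfolding band_cut_def by (rule l2_ift_L2[OF L])
  show 2: "l2_eq (l2_ft (band_cut S f)) (\<lambda>x. indicator S x * l2_ft f x)"
    unfolding band_cut_def by (rule l2_ft_ift[OF L])
  have "(\<lambda>x. indicator S x * l2_ft f x) \<in> L2_on S" by (intro L2_on_indicator_mult l2_ft_L2 f S)
  then show "band_cut S f \<in> band S"
    unfolding band_def using 1 L2_on_cong[OF _ l2_ft_L2[OF 1] l2_eq_sym[OF 2]] by simp
qed

lemma l2_inner_band_disjoint:
  assumes f: "f \<in> band S" and g: "g \<in> band T" and d: "S \<inter> T = {}"
  shows "l2_inner f g = 0"
proof -
  have "l2_inner f g = l2_inner (l2_ft f) (l2_ft g)"
    using f g by (simp add: l2_isometryD(2)[OF l2_isometry_ft] band_def)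
  also have "\<dots> = 0"
  proof -
    have "AE x in lborel. l2_ft f x * cnj (l2_ft g x) = 0"
    proof -
      have "AE x in lborel. x \<notin> S \<longrightarrow> l2_ft f x = 0" "AE x in lborel. x \<notin> T \<longrightarrow> l2_ft g x = 0"
        using f g by (auto simp: band_def L2_on_def)
      then show ?thesis by eventually_elim (use d in auto)
    qed
    then show ?thesis unfolding l2_inner_def by (rule integral_eq_zero_AE)
  qed
  finally show ?thesis .
qed

lemma l2_orthogonal_band: "S \<inter> T = {} \<Longrightarrow> l2_orthogonal (band S) (band T)"
  by (auto simp: l2_orthogonal_def l2_inner_band_disjoint)

lemma l2_ominus_band:
  assumes [measurable]: "S \<in> sets borel" "T \<in> sets borel"
  shows "l2_ominus (band S) (band T) = band (S - T)"
proof
  show "band (S - T) \<subseteq> l2_ominus (band S) (band T)"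
    using band_mono[of "S - T" S] by (auto simp: l2_ominus_def intro!: l2_inner_band_disjoint)
  show "l2_ominus (band S) (band T) \<subseteq> band (S - T)"
  proof
    fix f assume f: "f \<in> l2_ominus (band S) (band T)"
    then have fS: "f \<in> band S" and fL: "f \<in> L2" by (auto simp: l2_ominus_def band_def)
    let ?g = "\<lambda>x. indicator T x * l2_ft f x"
    have gL: "?g \<in> L2" by (intro L2_indicator_mult l2_ft_L2 fL assms)
    \<comment> \<open>Testing \<open>f\<close> against its own projection onto \<open>band T\<close>
      gives the squared norm of the part of its transform on \<open>T\<close>.\<close>
    have "0 = l2_inner f (band_cut T f)"
      using f band_cut_band[OF assms(2) fL] by (simp add: l2_ominus_def)
    also have "\<dots> = l2_inner (l2_ft f) (l2_ft (band_cut T f))"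
      by (simp add: l2_isometryD(2)[OF l2_isometry_ft] fL band_cut_L2[OF assms(2)])
    also have "\<dots> = l2_inner (l2_ft f) ?g"
      by (intro l2_inner_cong l2_ft_band_cut l2_eq_refl l2_ft_L2 fL band_cut_L2 gL assms)
    also have "\<dots> = l2_inner ?g ?g"
      unfolding l2_inner_def by (intro Bochner_Integration.integral_cong) (auto simp: indicator_def)
    finally have "l2_eq ?g (\<lambda>_. 0)"
      using l2_norm_eq_0_iff[OF gL] by (simp add: l2_inner_self)
    then have "AE x in lborel. x \<in> T \<longrightarrow> l2_ft f x = 0"
      unfolding l2_eq_def by eventually_elim (auto simp: indicator_def)
    moreover have "AE x in lborel. x \<notin> S \<longrightarrow> l2_ft f x = 0" using fS by (simp add: band_def L2_on_def)
    ultimately have "AE x in lborel. x \<notin> S - T \<longrightarrow> l2_ft f x = 0" by eventually_elim auto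
    then show "f \<in> band (S - T)" using fL by (simp add: band_def L2_on_def l2_ft_L2)
  qed
qed

lemma l2_sum_band:
  assumes S: "S \<in> sets borel" and T: "T \<in> sets borel"
  shows "l2_sum (band S) (band T) = band (S \<union> T)"
proof
  have "S \<union> T \<in> sets borel" using S T by auto
  note C = closed_l2_subspace_band[OF this]
  show "l2_sum (band S) (band T) \<subseteq> band (S \<union> T)"
    using band_mono[of S "S \<union> T"] band_mono[of T "S \<union> T"] closed_l2_subspaceD(3)[OF C]
    by (auto simp: l2_sum_def)
  show "band (S \<union> T) \<subseteq> l2_sum (band S) (band T)"
  proof
    fix f assume f: "f \<in> band (S \<union> T)"
    then have fL: "f \<in> L2" by (rule band_L2)
    \<comment> \<open>The sets may overlap: everything on \<open>T\<close> goes into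
      \<open>h\<close>, and the remainder has its spectrum in \<open>S - T\<close>.\<close>
    define h where "h = band_cut T f"
    have h: "h \<in> L2" "h \<in> band T" "l2_eq (l2_ft h) (\<lambda>x. indicator T x * l2_ft f x)"
      unfolding h_def by (intro band_cut_L2 band_cut_band l2_ft_band_cut T fL)+
    have "l2_eq (l2_ft (\<lambda>x. f x - h x)) (\<lambda>x. l2_ft f x - l2_ft h x)"
      by (intro l2_isometry_diff l2_isometry_ft fL h)
    moreover have "AE x in lborel. x \<notin> S \<union> T \<longrightarrow> l2_ft f x = 0" using f by (simp add: band_def L2_on_def)
    ultimately have "AE x in lborel. x \<notin> S \<longrightarrow> l2_ft (\<lambda>x. f x - h x) x = 0"
      using h(3) unfolding l2_eq_def by eventually_elim (auto simp: indicator_def)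
    then have "(\<lambda>x. f x - h x) \<in> band S"
      using fL h by (simp add: band_def L2_on_def L2_diff l2_ft_L2)
    then show "f \<in> l2_sum (band S) (band T)"
      unfolding l2_sum_def using h(2) by (intro CollectI exI[of _ "\<lambda>x. f x - h x"] exI[of _ h]) auto
  qed
qed

text \<open>\<open>l2_proj\<close> is a choice and has to be identified. \<open>band_cut\<close>
  shows that its defining condition can be met, and two solutions differ by an element of the band
  that is orthogonal to itself.\<close>

lemma l2_ft_l2_proj_band:
  assumes S: "S \<in> sets borel" and f: "f \<in> L2"
  shows "l2_proj (band S) f \<in> L2" "l2_eq (l2_ft (l2_proj (band S) f)) (\<lambda>x. indicator S x * l2_ft f x)"
proof -
  define p where "p = l2_proj (band S) f"
  define q where "q = band_cut S f"
  have C: "closed_l2_subspace (band S)" by (rule closed_l2_subspace_band[OF S])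
  have q: "q \<in> L2" "q \<in> band S" "l2_eq (l2_ft q) (\<lambda>x. indicator S x * l2_ft f x)"
    unfolding q_def by (intro band_cut_L2 band_cut_band l2_ft_band_cut S f)+
  have qo: "l2_inner (\<lambda>x. f x - q x) h = 0" if h: "h \<in> band S" for h
  proof -
    have "l2_eq (l2_ft (\<lambda>x. f x - q x)) (\<lambda>x. l2_ft f x - l2_ft q x)"
      by (intro l2_isometry_diff l2_isometry_ft f q)
    then have "AE x in lborel. x \<notin> - S \<longrightarrow> l2_ft (\<lambda>x. f x - q x) x = 0"
      using q(3) unfolding l2_eq_def by eventually_elim (auto simp: indicator_def)
    then have "(\<lambda>x. f x - q x) \<in> band (- S)"
      using f q by (simp add: band_def L2_on_def L2_diff l2_ft_L2)
    then show ?thesis using h by (rule l2_inner_band_disjoint) auto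
  qed
  have "\<exists>g. g \<in> band S \<and> (\<forall>h\<in>band S. l2_inner (\<lambda>x. f x - g x) h = 0)"
    using q(2) qo by blast
  from someI_ex[OF this] have p: "p \<in> band S" "\<And>h. h \<in> band S \<Longrightarrow> l2_inner (\<lambda>x. f x - p x) h = 0"
    unfolding p_def l2_proj_def by auto
  show pL: "l2_proj (band S) f \<in> L2" using p(1) by (simp add: p_def[symmetric] band_L2)
  have d: "(\<lambda>x. p x - q x) \<in> band S" using closed_l2_subspace_diff[OF C p(1) q(2)] .
  have "l2_inner (\<lambda>x. p x - q x) (\<lambda>x. p x - q x)
      = l2_inner (\<lambda>x. (f x - q x) - (f x - p x)) (\<lambda>x. p x - q x)" by simp
  also have "\<dots> = 0"
    using p(1) d band_L2[OF p(1)] band_L2[OF d] f q(1) by (subst l2_inner_diff_left) (simp_all add: L2_diff p(2) qo)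
  finally have "l2_eq p q" using band_L2[OF p(1)] q(1) by (simp add: l2_norm_diff_eq_0 l2_inner_self)
  then have "l2_eq (l2_ft p) (l2_ft q)" by (rule l2_isometry_cong[OF l2_isometry_ft band_L2[OF p(1)] q(1)])
  then show "l2_eq (l2_ft (l2_proj (band S) f)) (\<lambda>x. indicator S x * l2_ft f x)"
    unfolding p_def[symmetric] using q(3) by (rule l2_eq_trans)
qed

text \<open>On the transform side the projections are multiplications by indicators, which
  commute.\<close>

lemma l2_proj_band_commute:
  assumes S: "S \<in> sets borel" and T: "T \<in> sets borel" and f: "f \<in> L2"
  shows "l2_eq (l2_proj (band S) (l2_proj (band T) f)) (l2_proj (band T) (l2_proj (band S) f))"
proof (rule l2_isometry_inj[OF l2_isometry_ft])
  note P = l2_ft_l2_proj_band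
  show "l2_proj (band S) (l2_proj (band T) f) \<in> L2" "l2_proj (band T) (l2_proj (band S) f) \<in> L2"
    by (intro P(1) S T f)+
  have "l2_eq (l2_ft (l2_proj (band S) (l2_proj (band T) f))) (\<lambda>x. indicator S x * l2_ft (l2_proj (band T) f) x)"
    by (intro P S T f)
  also have "l2_eq \<dots> (\<lambda>x. indicator S x * (indicator T x * l2_ft f x))"
    by (intro l2_eq_mult P S T f)
  also have "\<dots> = (\<lambda>x. indicator T x * (indicator S x * l2_ft f x))" by (simp add: mult.left_commute)
  also have "l2_eq \<dots> (\<lambda>x. indicator T x * l2_ft (l2_proj (band S) f) x)"
    by (intro l2_eq_mult l2_eq_sym[OF P(2)] S T f)
  also have "l2_eq \<dots> (l2_ft (l2_proj (band T) (l2_proj (band S) f)))"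
    by (intro l2_eq_sym[OF P(2)] P(1) S T f)
  finally show "l2_eq (l2_ft (l2_proj (band S) (l2_proj (band T) f))) (l2_ft (l2_proj (band T) (l2_proj (band S) f)))" .
qed

lemma axis_scale_axis_scale [simp]: "axis_scale s t (axis_scale s' t' x) = axis_scale (s * s') (t * t') x"
  by (simp add: vec_eq_2)

lemma axis_scale_1 [simp]: "axis_scale 1 1 x = x"
  by (simp add: vec_eq_2)

lemma axis_dilate_axis_dilate:
  assumes "s > 0" "t > 0" "s' > 0" "t' > 0"
  shows "axis_dilate s t (axis_dilate s' t' f) = axis_dilate (s * s') (t * t') f"
proof -
  have "sqrt (s * t) * sqrt (s' * t') = sqrt (s * s' * (t * t'))"
    by (simp add: mult_ac flip: real_sqrt_mult)
  then have "complex_of_real (sqrt (s * t)) * of_real (sqrt (s' * t')) = of_real (sqrt (s * s' * (t * t')))"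
    by (metis of_real_mult)
  then show ?thesis by (simp add: axis_dilate_def fun_eq_iff mult_ac)
qed

lemma axis_dilate_1 [simp]: "axis_dilate 1 1 f = f"
  by (simp add: axis_dilate_def)

lemma axis_dilate_L2_on:
  assumes s: "s > 0" and t: "t > 0" and S: "S \<in> sets borel" and f: "f \<in> L2_on S"
  shows "axis_dilate s t f \<in> L2_on (axis_scale s t -` S)"
proof -
  have fL: "f \<in> L2" using f by (simp add: L2_on_def)
  note D = l2_isometry_axis_dilate[OF s t]
  have "l2_eq (axis_dilate s t (\<lambda>x. indicator S x * f x)) (axis_dilate s t f)"
    using f fL by (intro l2_isometry_cong[OF D] L2_indicator_mult S) (simp_all add: L2_on_iff)
  moreover have "axis_dilate s t (\<lambda>x. indicator S x * f x) = (\<lambda>x. indicator (axis_scale s t -` S) x * axis_dilate s t f x)"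
    by (auto simp: axis_dilate_def fun_eq_iff indicator_def)
  ultimately show ?thesis using l2_isometryD(1)[OF D fL] by (simp add: L2_on_iff)
qed

text \<open>One inclusion is proved for all parameters; applied to the inverse dilation it yields
  the other.\<close>

lemma axis_dilate_band:
  assumes s: "s > 0" and t: "t > 0" and S: "S \<in> sets borel"
  shows "axis_dilate s t ` band S = band (axis_scale (1 / s) (1 / t) -` S)"
proof -
  have sub: "axis_dilate s t ` band S \<subseteq> band (axis_scale (1 / s) (1 / t) -` S)"
    if s: "s > 0" and t: "t > 0" and S: "S \<in> sets borel" for s t S
  proof
    fix g assume "g \<in> axis_dilate s t ` band S"
    then obtain f where g: "g = axis_dilate s t f" and f: "f \<in> band S" by blast
    have fL: "f \<in> L2" using f by (rule band_L2)
    have gL: "g \<in> L2" unfolding g by (rule l2_isometryD(1)[OF l2_isometry_axis_dilate[OF s t] fL])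
    have "axis_dilate (1 / s) (1 / t) (l2_ft f) \<in> L2_on (axis_scale (1 / s) (1 / t) -` S)"
      using f s t S by (intro axis_dilate_L2_on) (auto simp: band_def)
    then have "l2_ft g \<in> L2_on (axis_scale (1 / s) (1 / t) -` S)"
      by (rule L2_on_cong) (use gL l2_ft_L2 l2_ft_axis_dilate[OF s t fL] g in \<open>auto intro: l2_eq_sym\<close>)
    then show "g \<in> band (axis_scale (1 / s) (1 / t) -` S)" using gL by (simp add: band_def)
  qed
  show ?thesis
  proof
    show "axis_dilate s t ` band S \<subseteq> band (axis_scale (1 / s) (1 / t) -` S)" by (rule sub[OF s t S])
    show "band (axis_scale (1 / s) (1 / t) -` S) \<subseteq> axis_dilate s t ` band S"
    proof
      fix g assume g: "g \<in> band (axis_scale (1 / s) (1 / t) -` S)"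
      have [measurable]: "S \<in> sets borel" by fact
      have "axis_scale (1 / s) (1 / t) -` S \<in> sets borel"
        using measurable_sets[OF axis_scale_measurable S, of "1 / s" "1 / t"] by simp
      from sub[of "1 / s" "1 / t", OF _ _ this] g s t
      have "axis_dilate (1 / s) (1 / t) g \<in> band (axis_scale s t -` (axis_scale (1 / s) (1 / t) -` S))"
        by auto
      also have "axis_scale s t -` (axis_scale (1 / s) (1 / t) -` S) = S"
        using s t by auto
      finally have "axis_dilate (1 / s) (1 / t) g \<in> band S" .
      moreover have "g = axis_dilate s t (axis_dilate (1 / s) (1 / t) g)"
        using s t by (simp add: axis_dilate_axis_dilate)
      ultimately show "g \<in> axis_dilate s t ` band S" by blast
    qed
  qed
qed

lemma l2_zero_subset_band: "l2_zero \<subseteq> band S"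
proof
  fix f :: "real^2 \<Rightarrow> complex" assume f: "f \<in> l2_zero"
  then have fL: "f \<in> L2" and z: "l2_eq f (\<lambda>_. 0)" by (auto simp: l2_zero_def)
  have "l2_eq (l2_ft f) (l2_ft (\<lambda>_. 0))" by (rule l2_isometry_cong[OF l2_isometry_ft fL L2_zero z])
  also have "l2_eq \<dots> (\<lambda>_. 0)" by (rule l2_isometry_zero[OF l2_isometry_ft])
  finally show "f \<in> band S" using fL unfolding band_def L2_on_def l2_eq_def by (auto simp: l2_ft_L2)
qed

text \<open>The index set is countable, so the exceptional null sets can be united and the transform
  vanishes almost everywhere outside the intersection of the spectra.\<close>

lemma INT_band:
  fixes S :: "int \<Rightarrow> int \<Rightarrow> (real^2) set"
  assumes null: "AE x in lborel. x \<notin> (\<Inter>i. \<Inter>j. S i j)"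
  shows "(\<Inter>i. \<Inter>j. band (S i j)) = l2_zero"
proof
  show "l2_zero \<subseteq> (\<Inter>i. \<Inter>j. band (S i j))" using l2_zero_subset_band by blast
  show "(\<Inter>i. \<Inter>j. band (S i j)) \<subseteq> l2_zero"
  proof
    fix f assume f: "f \<in> (\<Inter>i. \<Inter>j. band (S i j))"
    then have fL: "f \<in> L2" using band_L2 by blast
    have "AE x in lborel. \<forall>i j. x \<notin> S i j \<longrightarrow> l2_ft f x = 0"
      using f unfolding AE_all_countable by (auto simp: band_def L2_on_def)
    then have "AE x in lborel. l2_ft f x = 0"
      using null by eventually_elim auto
    then have "l2_eq (l2_ft f) (\<lambda>_. 0)" by (simp add: l2_eq_def)
    also have "l2_eq \<dots> (l2_ft (\<lambda>_. 0))" by (rule l2_isometry_zero[OF l2_isometry_ft, THEN l2_eq_sym])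
    finally have "l2_eq f (\<lambda>_. 0)" by (intro l2_isometry_inj[OF l2_isometry_ft fL L2_zero])
    then show "f \<in> l2_zero" using fL by (simp add: l2_zero_def)
  qed
qed

text \<open>The projections of \<open>f\<close> onto the diagonal bands converge to
  \<open>f\<close>, by dominated convergence of the cut-off transforms.\<close>

lemma l2_closure_UN_band:
  fixes S :: "int \<Rightarrow> int \<Rightarrow> (real^2) set"
  assumes S: "\<And>i j. S i j \<in> sets borel"
    and ex: "AE x in lborel. \<forall>\<^sub>F n in sequentially. x \<in> S (int n) (int n)"
  shows "l2_closure (\<Union>i. \<Union>j. band (S i j)) = L2"
proof
  show "l2_closure (\<Union>i. \<Union>j. band (S i j)) \<subseteq> L2" by (auto simp: l2_closure_def)
  show "L2 \<subseteq> l2_closure (\<Union>i. \<Union>j. band (S i j))"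
  proof
    fix f :: "real^2 \<Rightarrow> complex" assume f: "f \<in> L2"
    define s where "s n = band_cut (S (int n) (int n)) f" for n
    note [measurable] = l2_ft_L2[OF f, THEN L2_measurable_borel] S
    show "f \<in> l2_closure (\<Union>i. \<Union>j. band (S i j))"
    proof (rule l2_closure_limI[OF f])
      show "s n \<in> (\<Union>i. \<Union>j. band (S i j))" for n
        using band_cut_band[OF S f] unfolding s_def by blast
      have sL: "s n \<in> L2" for n unfolding s_def by (rule band_cut_L2[OF S f])
      have "l2_norm (\<lambda>x. s n x - f x) = l2_norm (\<lambda>x. indicator (S (int n) (int n)) x * l2_ft f x - l2_ft f x)" for n
      proof -
        have "l2_norm (\<lambda>x. s n x - f x) = l2_norm (\<lambda>x. l2_ft (s n) x - l2_ft f x)"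
          by (rule l2_isometry_norm_diff[OF l2_isometry_ft sL f, symmetric])
        also have "\<dots> = l2_norm (\<lambda>x. indicator (S (int n) (int n)) x * l2_ft f x - l2_ft f x)"
          unfolding s_def
          by (intro l2_norm_cong l2_eq_diff l2_ft_band_cut S f l2_eq_refl L2_diff l2_ft_L2 band_cut_L2 L2_indicator_mult)
        finally show ?thesis .
      qed
      moreover have "(\<lambda>n. l2_norm (\<lambda>x. indicator (S (int n) (int n)) x * l2_ft f x - l2_ft f x)) \<longlonglongrightarrow> 0"
      proof (rule l2_dominated_convergence(3)[where w = "\<lambda>x. cmod (l2_ft f x)"])
        show "integrable lborel (\<lambda>x. (cmod (l2_ft f x))\<^sup>2)" by (rule L2_integrable[OF l2_ft_L2[OF f]])
        show "AE x in lborel. (\<lambda>n. indicator (S (int n) (int n)) x * l2_ft f x) \<longlonglongrightarrow> l2_ft f x"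
          using ex
        proof eventually_elim
          case (elim x)
          then have "\<forall>\<^sub>F n in sequentially. indicator (S (int n) (int n)) x * l2_ft f x = l2_ft f x"
            by eventually_elim simp
          then show ?case by (rule tendsto_eventually)
        qed
        show "AE x in lborel. cmod (indicator (S (int n) (int n)) x * l2_ft f x) \<le> cmod (l2_ft f x)" for n
          by (auto simp: indicator_def)
      qed measurable
      ultimately show "(\<lambda>n. l2_norm (\<lambda>x. s n x - f x)) \<longlonglongrightarrow> 0" by simp
    qed
  qed
qed

lemma translates_orthonormal_basis_band:
  assumes \<phi>: "\<phi> \<in> L2" "l2_eq (l2_ft \<phi>) (indicator S)" and S: "S \<in> sets borel" "bounded S"
    and onb: "l2_orthonormal_basis (\<lambda>k. modulate k (indicator S)) int_lattice (L2_on S)"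
  shows "l2_orthonormal_basis (\<lambda>k. translate k \<phi>) int_lattice (band S)"
  unfolding band_def
proof (rule l2_isometry_transfer_onb[OF l2_isometry_ft onb])
  fix k :: "real^2"
  show "translate k \<phi> \<in> L2" by (rule l2_isometryD(1)[OF l2_isometry_translate \<phi>(1)])
  have "l2_eq (l2_ft (translate k \<phi>)) (modulate k (l2_ft \<phi>))" by (rule l2_ft_translate[OF \<phi>(1)])
  also have "l2_eq \<dots> (modulate k (indicator S))"
    by (intro l2_isometry_cong[OF l2_isometry_modulate] \<phi> l2_ft_L2 L2_indicator_bounded S)
  finally show "l2_eq (l2_ft (translate k \<phi>)) (modulate k (indicator S))" .
qed

section \<open>Agreement with the Fourier transform defined by limits of Fourier integrals\<close>

lemma l2_ift_translate:
  assumes "f \<in> L2"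
  shows "l2_eq (l2_ift (translate k f)) (modulate (- k) (l2_ift f))"
proof (rule l2_isometry_agree_on_boxes[OF _ _ _ assms])
  show "l2_isometry (\<lambda>f. l2_ift (translate k f))" "l2_isometry (\<lambda>f. modulate (- k) (l2_ift f))"
    by (rule l2_isometry_comp[OF l2_isometry_ift l2_isometry_translate] l2_isometry_comp[OF l2_isometry_modulate l2_isometry_ift])+
  fix a b :: "real^2"
  have "translate k (indicator (box a b)) = (indicator (box (a + k) (b + k)) :: real^2 \<Rightarrow> complex)"
    by (auto simp: translate_def indicator_def mem_box_2 fun_eq_iff)
  moreover have "box_ift (a + k) (b + k) = modulate (- k) (box_ift a b)"
  proof
    fix x
    have "cis (- (2 * pi * (- k \<bullet> x))) = cis (2 * pi * (k $ 1 * x $ 1)) * cis (2 * pi * (k $ 2 * x $ 2))"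
      by (simp add: inner_real2 cis_mult algebra_simps)
    then show "box_ift (a + k) (b + k) x = modulate (- k) (box_ift a b) x"
      unfolding modulate_def by (simp add: box_ift_def tensor_fun_def interval_ift_translate)
  qed
  moreover have "l2_eq (modulate (- k) (box_ift a b)) (modulate (- k) (l2_ift (indicator (box a b))))"
    by (intro l2_isometry_cong[OF l2_isometry_modulate] box_ift_L2 l2_ift_L2 indicator_box_L2 l2_ift_box[THEN l2_eq_sym])
  ultimately show "l2_eq (l2_ift (translate k (indicator (box a b)))) (modulate (- k) (l2_ift (indicator (box a b))))"
    using l2_eq_trans[OF l2_ift_box[of "a + k" "b + k"]] by simp
qed

lemma cmod_box_ift_le:
  assumes "a $ 1 \<le> b $ 1" "a $ 2 \<le> b $ 2"
  shows "cmod (box_ift a b x) \<le> (b $ 1 - a $ 1) * (b $ 2 - a $ 2)"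
  unfolding box_ift_def tensor_fun_def norm_mult
  using assms by (intro mult_mono cmod_interval_ift_le) auto

lemma interval_ift_tendsto:
  assumes "y \<longlonglongrightarrow> 0" "a \<le> b"
  shows "(\<lambda>n. interval_ift a b (y n)) \<longlonglongrightarrow> of_real (b - a)"
proof -
  have "(\<lambda>n. interval_ift a b (y n)) \<longlonglongrightarrow> interval_ift a b 0"
    unfolding interval_ift_def
  proof (rule integral_dominated_convergence)
    show "integrable lborel (indicator {a<..<b} :: real \<Rightarrow> real)"
      using assms(2) by simp
    show "AE \<xi> in lborel. cmod (indicator {a<..<b} \<xi> * cis (2 * pi * (y n * \<xi>))) \<le> indicator {a<..<b} \<xi>" for n
      by (auto simp: norm_mult)
    have "continuous_on UNIV cis" by (intro continuous_intros)
    then have "isCont cis z" for z by (simp add: continuous_on_eq_continuous_at)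
    then have "(\<lambda>n. cis (2 * pi * (y n * \<xi>))) \<longlonglongrightarrow> cis (2 * pi * (0 * \<xi>))" for \<xi>
      by (rule isCont_tendsto_compose) (intro tendsto_intros assms)
    then show "AE \<xi> in lborel. (\<lambda>n. indicator {a<..<b} \<xi> * cis (2 * pi * (y n * \<xi>))) \<longlonglongrightarrow> indicator {a<..<b} \<xi> * cis (2 * pi * (0 * \<xi>))"
      by (intro AE_I2 tendsto_mult tendsto_const)
  qed measurable
  then show ?thesis using interval_ift_0[OF assms(2)] by simp
qed

text \<open>The approximants are \<open>\<psi>\<close> times dilates of a sinc kernel; their Fourier integrals are
  averages of \<open>indicator W\<close> over shrinking squares, by the Parseval identity.\<close>

lemma has_fourier_transform_indicator:
  assumes \<psi>: "\<psi> \<in> L2" "l2_eq (l2_ft \<psi>) (indicator W)" and W: "W \<in> sets borel" "bounded W"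
    and loc: "AE \<xi> in lborel. \<exists>d>0. \<forall>\<eta>. \<bar>\<eta> $ 1\<bar> < d \<and> \<bar>\<eta> $ 2\<bar> < d \<longrightarrow> (\<eta> + \<xi> \<in> W \<longleftrightarrow> \<xi> \<in> W)"
  shows "has_fourier_transform \<psi> (indicator W)"
proof -
  note [measurable] = \<psi>(1)[THEN L2_measurable_borel] W(1)
  have WL: "(indicator W :: real^2 \<Rightarrow> complex) \<in> L2" by (rule L2_indicator_bounded[OF W])
  \<comment> \<open>The square \<open>Q n\<close> has side \<open>1 / Suc n\<close> and area
    \<open>1 / c n\<close>, so \<open>k n\<close> is the inverse transform of its indicator
    normalized to integral 1.\<close>
  define \<delta> where "\<delta> n = 1 / (2 * real (Suc n))" for n
  define u where "u n = (vector [\<delta> n, \<delta> n] :: real^2)" for n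
  define Q where "Q n = box (- u n) (u n)" for n
  define c where "c n = (real (Suc n))\<^sup>2" for n
  define k where "k n x = of_real (c n) * box_ift (- u n) (u n) x" for n x
  have c: "c n * measure lborel (Q n) = 1" for n
  proof -
    have "complex_of_real (measure lborel (Q n)) = l2_inner (indicator (Q n)) (indicator (Q n))"
      by (subst l2_inner_indicator) (auto simp: Q_def)
    also have "\<dots> = measure lborel {- \<delta> n<..<\<delta> n} * measure lborel {- \<delta> n<..<\<delta> n}"
      unfolding Q_def indicator_box_tensor
      by (subst tensor_fun_inner) (auto simp: indicator_interval_L2 l2_inner_indicator u_def)
    also have "\<dots> = of_real ((2 * \<delta> n)\<^sup>2)"
      by (simp add: \<delta>_def power2_eq_square)
    finally have "measure lborel (Q n) = (2 * \<delta> n)\<^sup>2" unfolding of_real_eq_iff .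
    then show ?thesis by (simp add: c_def \<delta>_def power_divide del: of_nat_Suc)
  qed
  have kL: "k n \<in> L2" for n unfolding k_def by (intro L2_cmult box_ift_L2)
  note [measurable] = kL[THEN L2_measurable_borel]
  have kb: "cmod (k n x) \<le> 1" for n x
  proof -
    have "cmod (box_ift (- u n) (u n) x) \<le> (2 * \<delta> n) * (2 * \<delta> n)"
      using cmod_box_ift_le[of "- u n" "u n" x] by (simp add: u_def \<delta>_def)
    then have "cmod (k n x) \<le> c n * ((2 * \<delta> n) * (2 * \<delta> n))"
      unfolding k_def norm_mult norm_of_real by (intro mult_mono) (auto simp: c_def)
    also have "\<dots> = 1" by (simp add: c_def \<delta>_def power2_eq_square del: of_nat_Suc)
    finally show ?thesis .
  qed
  \<comment> \<open>The square is symmetric about 0, so its transform is real; the inner product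
    below conjugates its second argument.\<close>
  have kcnj: "cnj (k n x) = k n x" for n x
  proof -
    have "interval_ift (- \<delta> n) (\<delta> n) (- y) = interval_ift (- \<delta> n) (\<delta> n) y" for y
    proof -
      have "interval_ift (- \<delta> n) (\<delta> n) (- y) = (\<integral>\<xi>. indicator {- \<delta> n<..<\<delta> n} (0 + (-1) * \<xi>) * cis (2 * pi * (- y * (0 + (-1) * \<xi>))) \<partial>lborel)"
        unfolding interval_ift_def by (subst lborel_integral_real_affine[of "-1" _ 0]) auto
      also have "\<dots> = interval_ift (- \<delta> n) (\<delta> n) y"
        unfolding interval_ift_def by (intro Bochner_Integration.integral_cong) (auto simp: indicator_def)
      finally show ?thesis .
    qed
    then show ?thesis by (simp add: k_def box_ift_def tensor_fun_def cnj_interval_ift u_def)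
  qed
  \<comment> \<open>By scaling, \<open>k n x\<close> is the kernel of the unit square evaluated at
    \<open>x\<close> divided by \<open>Suc n\<close>, and that kernel is 1 at the origin.\<close>
  have klim: "(\<lambda>n. k n x) \<longlonglongrightarrow> 1" for x
  proof -
    have "k n x = interval_ift (- 1 / 2) (1 / 2) (x $ 1 / real (Suc n)) * interval_ift (- 1 / 2) (1 / 2) (x $ 2 / real (Suc n))" for n
    proof -
      have "interval_ift (- \<delta> n) (\<delta> n) y = of_real (1 / real (Suc n)) * interval_ift (- 1 / 2) (1 / 2) (y / real (Suc n))" for y
        using interval_ift_scale[of "real (Suc n)" "- 1 / 2" "1 / 2" y] by (simp add: \<delta>_def)
      then show ?thesis
        by (simp add: k_def box_ift_def tensor_fun_def u_def c_def power2_eq_square del: of_nat_Suc)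
    qed
    moreover have lim0: "(\<lambda>n. y / real (Suc n)) \<longlonglongrightarrow> 0" for y
      using tendsto_mult[OF tendsto_const[of y] LIMSEQ_inverse_real_of_nat] by (simp add: divide_inverse)
    moreover have "(\<lambda>n. interval_ift (- 1 / 2) (1 / 2) (x $ 1 / real (Suc n)) * interval_ift (- 1 / 2) (1 / 2) (x $ 2 / real (Suc n)))
      \<longlonglongrightarrow> of_real (1 / 2 - (- 1 / 2)) * of_real (1 / 2 - (- 1 / 2))"
      by (intro tendsto_mult interval_ift_tendsto lim0) auto
    ultimately show ?thesis by simp
  qed
  \<comment> \<open>A product of two square-integrable functions is integrable, as the Fourier
    integral demands, and the bound 1 on the kernel makes \<open>\<psi>\<close> itself a
    majorant.\<close>
  define s where "s n x = \<psi> x * k n x" for n x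
  have s_dom: "s n \<in> L2" "(\<lambda>n. l2_norm (\<lambda>x. s n x - \<psi> x)) \<longlonglongrightarrow> 0" for n
  proof -
    have 1: "s n \<in> borel_measurable lborel" for n unfolding s_def by measurable
    have 2: "AE x in lborel. cmod (s n x) \<le> cmod (\<psi> x)" for n
      using kb by (auto simp: s_def norm_mult mult_left_le)
    have 3: "AE x in lborel. (\<lambda>n. s n x) \<longlonglongrightarrow> \<psi> x"
      using tendsto_mult[OF tendsto_const klim] by (auto simp: s_def)
    note D = l2_dominated_convergence[OF 1 L2_measurable[OF \<psi>(1)] L2_integrable[OF \<psi>(1)] 2 3]
    show "s n \<in> L2" "(\<lambda>n. l2_norm (\<lambda>x. s n x - \<psi> x)) \<longlonglongrightarrow> 0" by (rule D)+
  qed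
  define g where "g n \<xi> = complex_of_real (c n) * (\<integral>\<eta>. indicator W (\<eta> + \<xi>) * indicator (Q n) \<eta> \<partial>lborel)" for n and \<xi> :: "real^2"
  have Qm[measurable]: "Q n \<in> sets borel" for n by (simp add: Q_def)
  have Qb: "bounded (Q n)" for n by (simp add: Q_def)
  have four: "fourier_integral (s n) = g n" for n
  proof
    fix \<xi> :: "real^2"
    have tr: "translate (- \<xi>) (indicator W) \<in> L2" by (rule l2_isometryD(1)[OF l2_isometry_translate WL])
    \<comment> \<open>The Fourier integral is read as an inner product with the kernel. Modulating
      \<open>\<psi>\<close> translates \<open>W\<close> on the transform side, and the isometry
      property returns an overlap of \<open>W\<close> with a square.\<close>
    have "fourier_integral (s n) \<xi> = l2_inner (modulate \<xi> \<psi>) (k n)"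
      unfolding fourier_integral_def l2_inner_def
      by (simp add: s_def modulate_def kcnj inner_commute mult_ac)
    also have "\<dots> = cnj (of_real (c n)) * l2_inner (modulate \<xi> \<psi>) (box_ift (- u n) (u n))"
      unfolding k_def by (rule l2_inner_cmult_right)
    also have "l2_inner (modulate \<xi> \<psi>) (box_ift (- u n) (u n)) = l2_inner (l2_ift (translate (- \<xi>) (indicator W))) (l2_ift (indicator (Q n)))"
    proof (rule l2_inner_cong)
      have "l2_eq \<psi> (l2_ift (l2_ft \<psi>))" by (rule l2_ift_ft[OF \<psi>(1), THEN l2_eq_sym])
      also have "l2_eq \<dots> (l2_ift (indicator W))"
        by (rule l2_isometry_cong[OF l2_isometry_ift l2_ft_L2[OF \<psi>(1)] WL \<psi>(2)])
      finally have "l2_eq (modulate \<xi> \<psi>) (modulate \<xi> (l2_ift (indicator W)))"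
        by (rule l2_isometry_cong[OF l2_isometry_modulate \<psi>(1) l2_ift_L2[OF WL]])
      also have "l2_eq \<dots> (l2_ift (translate (- \<xi>) (indicator W)))"
        using l2_ift_translate[OF WL, of "- \<xi>", THEN l2_eq_sym] by simp
      finally show "l2_eq (modulate \<xi> \<psi>) (l2_ift (translate (- \<xi>) (indicator W)))" .
      show "l2_eq (box_ift (- u n) (u n)) (l2_ift (indicator (Q n)))"
        unfolding Q_def by (rule l2_ift_box[THEN l2_eq_sym])
      show "l2_ift (indicator (Q n)) \<in> L2" unfolding Q_def by (intro l2_ift_L2 indicator_box_L2)
    qed (intro l2_isometryD(1)[OF l2_isometry_modulate] \<psi> l2_ift_L2 tr box_ift_L2)+
    also have "\<dots> = l2_inner (translate (- \<xi>) (indicator W)) (indicator (Q n))"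
      unfolding Q_def by (rule l2_isometryD(2)[OF l2_isometry_ift tr indicator_box_L2])
    finally show "fourier_integral (s n) \<xi> = g n \<xi>"
      by (simp add: g_def l2_inner_def translate_def)
  qed
  obtain R where R: "\<And>x. x \<in> W \<Longrightarrow> norm x \<le> R" using W(2) by (auto simp: bounded_iff)
  have gm: "(\<lambda>\<xi>. g n \<xi> :: complex) \<in> borel_measurable lborel" for n
  proof -
    have "(\<lambda>\<xi>. \<integral>\<eta>. indicator W (\<eta> + \<xi>) * indicator (Q n) \<eta> \<partial>lborel :: complex) \<in> borel_measurable borel"
      by (rule lborel.borel_measurable_lebesgue_integral) measurable
    then show ?thesis unfolding g_def by measurable
  qed
  have Qint: "integrable lborel (indicator (Q n) :: real^2 \<Rightarrow> real)" for n
    using emeasure_bounded_finite[OF Qb[of n]] by simp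
  \<comment> \<open>Points of \<open>Q n\<close> have norm at most 2, so all averages vanish outside
    one fixed ball, whose indicator is the common majorant.\<close>
  have gb: "cmod (g n \<xi>) \<le> cmod (indicator (cball 0 (R + 2)) \<xi>)" for n \<xi>
  proof (cases "\<exists>\<eta>\<in>Q n. \<eta> + \<xi> \<in> W")
    case True
    then obtain \<eta> where \<eta>: "\<eta> \<in> Q n" "\<eta> + \<xi> \<in> W" by blast
    have "\<delta> n \<le> 1" by (simp add: \<delta>_def)
    then have "\<bar>\<eta> $ 1\<bar> \<le> 1" "\<bar>\<eta> $ 2\<bar> \<le> 1" using \<eta>(1) by (auto simp: Q_def mem_box_2 u_def)
    then have "norm \<eta> \<le> 2" using norm_le_l1_cart[of \<eta>] by (simp add: sum_2)
    moreover have "norm \<xi> \<le> norm (\<eta> + \<xi>) + norm \<eta>"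
      using norm_triangle_ineq4[of "\<eta> + \<xi>" \<eta>] by simp
    ultimately have "\<xi> \<in> cball 0 (R + 2)" using R[OF \<eta>(2)] by simp
    moreover have "cmod (\<integral>\<eta>. indicator W (\<eta> + \<xi>) * indicator (Q n) \<eta> \<partial>lborel) \<le> (\<integral>\<eta>. indicator (Q n) \<eta> \<partial>lborel)"
    proof (rule Bochner_Integration.integral_norm_bound_integral[OF _ Qint])
      show "integrable lborel (\<lambda>\<eta>. indicator W (\<eta> + \<xi>) * indicator (Q n) \<eta> :: complex)"
        by (rule Bochner_Integration.integrable_bound[OF Qint[of n]]) (measurable, auto simp: norm_mult indicator_def)
      show "cmod (indicator W (\<eta> + \<xi>) * indicator (Q n) \<eta>) \<le> indicator (Q n) \<eta>" for \<eta>
        by (auto simp: norm_mult indicator_def)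
    qed
    then have "cmod (g n \<xi>) \<le> c n * measure lborel (Q n)"
      unfolding g_def norm_mult norm_of_real by (intro mult_mono) (auto simp: c_def)
    ultimately show ?thesis by (simp add: c)
  next
    case False
    then have "indicator W (\<eta> + \<xi>) * indicator (Q n) \<eta> = (0::complex)" for \<eta> by (auto simp: indicator_def)
    then have "g n \<xi> = of_real (c n) * (\<integral>\<eta>. 0 \<partial>(lborel :: (real^2) measure))"
      unfolding g_def by (simp only:)
    then show ?thesis by simp
  qed
  \<comment> \<open>Membership in \<open>W\<close> is constant near almost every point, so the
    averages eventually equal the limit.\<close>
  have glim: "AE \<xi> in lborel. (\<lambda>n. g n \<xi> :: complex) \<longlonglongrightarrow> indicator W \<xi>"
    using loc
  proof eventually_elim
    case (elim \<xi>)
    then obtain d where d: "d > 0" "\<And>\<eta>. \<bar>\<eta> $ 1\<bar> < d \<Longrightarrow> \<bar>\<eta> $ 2\<bar> < d \<Longrightarrow> \<eta> + \<xi> \<in> W \<longleftrightarrow> \<xi> \<in> W" by blast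
    obtain N where N: "1 / d \<le> real N" using real_arch_simple by blast
    have "\<forall>\<^sub>F n in sequentially. g n \<xi> = (indicator W \<xi> :: complex)"
    proof (rule eventually_sequentiallyI[of N])
      fix n assume "N \<le> n"
      then have "1 / d \<le> real (Suc n)" using N by linarith
      then have "\<delta> n < d" using d(1) by (simp add: \<delta>_def field_simps)
      then have "indicator W (\<eta> + \<xi>) * indicator (Q n) \<eta> = (indicator W \<xi> * of_real (indicator (Q n) \<eta>) :: complex)" for \<eta>
      proof (cases "\<eta> \<in> Q n")
        case True
        then have "\<bar>\<eta> $ 1\<bar> < d" "\<bar>\<eta> $ 2\<bar> < d"
          using \<open>\<delta> n < d\<close> by (auto simp: Q_def mem_box_2 u_def)
        then show ?thesis using d(2)[of \<eta>] by (simp add: indicator_def)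
      qed simp
      then have "g n \<xi> = of_real (c n) * (indicator W \<xi> * of_real (measure lborel (Q n)))"
        by (simp add: g_def)
      also have "\<dots> = of_real (c n * measure lborel (Q n)) * indicator W \<xi>" by simp
      finally show "g n \<xi> = (indicator W \<xi> :: complex)" by (simp only: c) simp
    qed
    then show ?case by (rule tendsto_eventually)
  qed
  have BL: "(indicator (cball 0 (R + 2)) :: real^2 \<Rightarrow> complex) \<in> L2" by (rule L2_indicator_bounded) auto
  note D = l2_dominated_convergence[OF gm L2_measurable[OF WL] L2_integrable[OF BL] AE_I2[OF gb] glim]
  show ?thesis
    unfolding has_fourier_transform_def
  proof (intro conjI exI[of _ s] allI \<psi> WL s_dom)
    show "integrable lborel (s n)" for n unfolding s_def by (intro integrable_mult_L2 \<psi> kL)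
    show "fourier_integral (s n) \<in> L2" for n unfolding four by (rule D(2))
    show "(\<lambda>n. l2_norm (\<lambda>\<xi>. fourier_integral (s n) \<xi> - indicator W \<xi>)) \<longlonglongrightarrow> 0" unfolding four by (rule D(3))
  qed
qed

section \<open>Autocorrelations and sums of box transforms\<close>

lemma autocorrelation_indicator:
  assumes \<phi>: "\<phi> \<in> L2" "l2_eq (l2_ft \<phi>) (indicator S)" and S: "S \<in> sets borel" "bounded S"
  shows "l2_inner \<phi> (translate t \<phi>) = l2_inner (indicator S) (modulate t (indicator S))"
proof -
  have SL: "(indicator S :: real^2 \<Rightarrow> complex) \<in> L2" by (rule L2_indicator_bounded[OF S])
  note M = l2_isometryD(1)[OF l2_isometry_modulate] and T = l2_isometryD(1)[OF l2_isometry_translate]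
  have "l2_inner \<phi> (translate t \<phi>) = l2_inner (l2_ft \<phi>) (l2_ft (translate t \<phi>))"
    by (rule l2_isometryD(2)[OF l2_isometry_ft, symmetric]) (intro \<phi> T)+
  also have "\<dots> = l2_inner (indicator S) (modulate t (indicator S))"
  proof (rule l2_inner_cong[OF \<phi>(2)])
    have "l2_eq (l2_ft (translate t \<phi>)) (modulate t (l2_ft \<phi>))" by (rule l2_ft_translate[OF \<phi>(1)])
    also have "l2_eq \<dots> (modulate t (indicator S))"
      by (rule l2_isometry_cong[OF l2_isometry_modulate l2_ft_L2[OF \<phi>(1)] SL \<phi>(2)])
    finally show "l2_eq (l2_ft (translate t \<phi>)) (modulate t (indicator S))" .
  qed (intro l2_ft_L2 \<phi> T SL M)+
  finally show ?thesis .
qed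

lemma integral_box_cis:
  "(\<integral>\<xi>. indicator (box a b) \<xi> * cis (2 * pi * (t \<bullet> \<xi>)) \<partial>lborel) = box_ift a b t"
  and integrable_box_cis: "integrable lborel (\<lambda>\<xi>. indicator (box a b) \<xi> * cis (2 * pi * (t \<bullet> \<xi>)))"
proof -
  show "integrable lborel (\<lambda>\<xi>. indicator (box a b) \<xi> * cis (2 * pi * (t \<bullet> \<xi>)))"
    by (rule integrable_indicator_cis) (use emeasure_bounded_finite[of "box a b"] in auto)
  have i: "integrable lborel (\<lambda>\<xi>. indicator {a<..<b} \<xi> * cis (2 * pi * (x * \<xi>)))" for a b x :: real
    by (rule integrable_indicator_cis) (use emeasure_bounded_finite[of "{a<..<b}"] in auto)
  have "indicator (box a b) \<xi> * cis (2 * pi * (t \<bullet> \<xi>))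
      = (indicator {a $ 1<..<b $ 1} (\<xi> $ 1) * cis (2 * pi * (t $ 1 * \<xi> $ 1))) * (indicator {a $ 2<..<b $ 2} (\<xi> $ 2) * cis (2 * pi * (t $ 2 * \<xi> $ 2)))" for \<xi>
  proof -
    have "cis (2 * pi * (t \<bullet> \<xi>)) = cis (2 * pi * (t $ 1 * \<xi> $ 1)) * cis (2 * pi * (t $ 2 * \<xi> $ 2))"
      by (simp add: inner_real2 cis_mult algebra_simps)
    then show ?thesis by (simp add: indicator_box_tensor tensor_fun_def)
  qed
  then show "(\<integral>\<xi>. indicator (box a b) \<xi> * cis (2 * pi * (t \<bullet> \<xi>)) \<partial>lborel) = box_ift a b t"
    using integral_tensor[OF i i, of "a $ 1" "b $ 1" "t $ 1" "a $ 2" "b $ 2" "t $ 2"]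
    by (simp add: box_ift_def tensor_fun_def interval_ift_def)
qed

text \<open>An indicator is its own square, so only the exponential remains, and it is integrated
  box by box.\<close>

lemma l2_inner_indicator_modulate_boxes:
  assumes P: "finite P" "disjoint_family_on (\<lambda>p. box (l p) (u p)) P"
  shows "l2_inner (indicator (\<Union>p\<in>P. box (l p) (u p))) (modulate t (indicator (\<Union>p\<in>P. box (l p) (u p)))) = (\<Sum>p\<in>P. box_ift (l p) (u p) t)"
proof -
  let ?S = "\<Union>p\<in>P. box (l p) (u p)"
  have "indicator ?S \<xi> * cnj (modulate t (indicator ?S) \<xi>) = (\<Sum>p\<in>P. indicator (box (l p) (u p)) \<xi> * cis (2 * pi * (t \<bullet> \<xi>)))" for \<xi>
  proof -
    have "indicator ?S \<xi> * cnj (modulate t (indicator ?S) \<xi>) = indicator ?S \<xi> * cis (2 * pi * (t \<bullet> \<xi>))"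
      by (cases "\<xi> \<in> ?S") (simp_all add: modulate_def cis_cnj)
    then show ?thesis by (simp only: indicator_UN_disjoint[OF P] sum_distrib_right)
  qed
  then show ?thesis
    unfolding l2_inner_def by (simp add: Bochner_Integration.integral_sum integrable_box_cis integral_box_cis)
qed

lemma l2_ft_sum_box_ift:
  assumes P: "finite P" "disjoint_family_on (\<lambda>p. box (l p) (u p)) P"
  shows "l2_eq (l2_ft (\<lambda>x. \<Sum>p\<in>P. box_ift (l p) (u p) x)) (indicator (\<Union>p\<in>P. box (l p) (u p)))"
proof -
  have "l2_eq (l2_ft (\<lambda>x. \<Sum>p\<in>P. box_ift (l p) (u p) x)) (\<lambda>x. \<Sum>p\<in>P. l2_ft (box_ift (l p) (u p)) x)"
    by (intro l2_isometry_sum l2_isometry_ft box_ift_L2)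
  also have "l2_eq \<dots> (\<lambda>x. \<Sum>p\<in>P. indicator (box (l p) (u p)) x)"
  proof -
    have *: "l2_eq (l2_ft (box_ift a b)) (indicator (box a b))" for a b
    proof -
      have "l2_eq (l2_ft (box_ift a b)) (l2_ft (l2_ift (indicator (box a b))))"
        by (intro l2_isometry_cong[OF l2_isometry_ft] box_ift_L2 l2_ift_L2 indicator_box_L2 l2_ift_box[THEN l2_eq_sym])
      also have "l2_eq \<dots> (indicator (box a b))" by (rule l2_ft_ift[OF indicator_box_L2])
      finally show ?thesis .
    qed
    show ?thesis using P(1)
    proof (induction P rule: finite_induct)
      case (insert p P)
      have "l2_eq (\<lambda>x. l2_ft (box_ift (l p) (u p)) x + (\<Sum>p\<in>P. l2_ft (box_ift (l p) (u p)) x))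
        (\<lambda>x. indicator (box (l p) (u p)) x + (\<Sum>p\<in>P. indicator (box (l p) (u p)) x))"
        by (intro l2_eq_add * insert)
      then show ?case using insert by simp
    qed simp
  qed
  also have "(\<lambda>x. \<Sum>p\<in>P. indicator (box (l p) (u p)) x) = (indicator (\<Union>p\<in>P. box (l p) (u p)) :: real^2 \<Rightarrow> complex)"
    by (rule ext) (simp add: indicator_UN_disjoint[OF P])
  finally show ?thesis .
qed

lemma cnj_box_ift: "cnj (box_ift a b x) = box_ift (- b) (- a) x"
proof -
  have "interval_ift (- b) (- a) y = interval_ift a b (- y)" for a b y
  proof -
    have "interval_ift (- b) (- a) y = (\<integral>\<xi>. indicator {- b<..<- a} (0 + (-1) * \<xi>) * cis (2 * pi * (y * (0 + (-1) * \<xi>))) \<partial>lborel)"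
      unfolding interval_ift_def by (subst lborel_integral_real_affine[of "-1" _ 0]) auto
    also have "\<dots> = interval_ift a b (- y)"
      unfolding interval_ift_def by (intro Bochner_Integration.integral_cong) (auto simp: indicator_def)
    finally show ?thesis .
  qed
  then show ?thesis by (simp add: box_ift_def tensor_fun_def cnj_interval_ift)
qed

lemma translate_tensor_fun: "translate t (tensor_fun f g) = tensor_fun (translate (t $ 1) f) (translate (t $ 2) g)"
  by (simp add: translate_def tensor_fun_def)

text \<open>A kernel that is a product of functions of one variable has rank one, so its two-by-two
  minors vanish.\<close>

lemma autocorrelation_separable:
  assumes f: "f \<in> L2" and sep: "f\<^sub>1 \<in> L2" "f\<^sub>2 \<in> L2" "l2_eq f (tensor_fun f\<^sub>1 f\<^sub>2)"
  shows "l2_inner f (translate (vector [s, t]) f) * l2_inner f (translate (vector [s', t']) f)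
    = l2_inner f (translate (vector [s, t']) f) * l2_inner f (translate (vector [s', t]) f)"
proof -
  have R: "l2_inner f (translate (vector [s, t]) f) = l2_inner f\<^sub>1 (translate s f\<^sub>1) * l2_inner f\<^sub>2 (translate t f\<^sub>2)" for s t
  proof -
    note T = l2_isometryD(1)[OF l2_isometry_translate]
    have "l2_inner f (translate (vector [s, t]) f) = l2_inner (tensor_fun f\<^sub>1 f\<^sub>2) (translate (vector [s, t]) (tensor_fun f\<^sub>1 f\<^sub>2))"
      by (intro l2_inner_cong sep(3) l2_isometry_cong[OF l2_isometry_translate] f tensor_fun_L2 sep(1,2) T)
    also have "\<dots> = l2_inner f\<^sub>1 (translate s f\<^sub>1) * l2_inner f\<^sub>2 (translate t f\<^sub>2)"
      unfolding translate_tensor_fun by (subst tensor_fun_inner) (simp_all add: sep T)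
    finally show ?thesis .
  qed
  show ?thesis unfolding R by (simp add: mult_ac)
qed

text \<open>\<open>fun_powi\<close> takes \<open>inv\<close> for negative exponents. In a family
  indexed additively by the integers \<open>h (- 1)\<close> is a two-sided inverse of
  \<open>h 1\<close>, which evaluates \<open>inv\<close> and gives one formula for all
  powers.\<close>

lemma fun_powi_hom:
  fixes h :: "int \<Rightarrow> 'a \<Rightarrow> 'a"
  assumes h0: "h 0 = id" and hadd: "\<And>i j. h (i + j) = h i \<circ> h j"
  shows "fun_powi (h 1) i = h i"
proof -
  have "h 1 \<circ> h (- 1) = id" "h (- 1) \<circ> h 1 = id"
    using hadd[of 1 "- 1"] hadd[of "- 1" 1] h0 by simp_all
  then have inv: "inv (h 1) = h (- 1)" by (rule inv_unique_comp)
  have pos: "(h 1) ^^ n = h (int n)" for n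
  proof (induction n)
    case (Suc n)
    have "h (int (Suc n)) = h 1 \<circ> h (int n)" using hadd[of 1 "int n"] by simp
    then show ?case using Suc by simp
  qed (simp add: h0)
  have neg: "(h (- 1)) ^^ n = h (- int n)" for n
  proof (induction n)
    case (Suc n)
    have "h (- int (Suc n)) = h (- 1) \<circ> h (- int n)" using hadd[of "- 1" "- int n"] by simp
    then show ?case using Suc by simp
  qed (simp add: h0)
  show ?thesis
    unfolding fun_powi_def inv pos neg by auto
qed

lemma dilation_matrix_mult:
  "(vector [vector [s, 0], vector [0, t]] :: real^2^2) *v x = axis_scale s t x"
  by (simp add: vec_eq_2 matrix_vector_mult_def sum_2)

lemma dilate_eq_axis_dilate:
  "s > 0 \<Longrightarrow> t > 0 \<Longrightarrow> dilate (vector [vector [s, 0], vector [0, t]]) = axis_dilate s t"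
  by (simp add: fun_eq_iff dilate_def axis_dilate_def dilation_matrix_mult det_2 abs_mult)

lemma fun_powi_dilate_1:
  "fun_powi (dilate (vector [vector [2, 0], vector [0, 1]])) i = axis_dilate (2 powi i) 1"
  using fun_powi_hom[of "\<lambda>i. axis_dilate (2 powi i) 1" i]
  by (simp add: dilate_eq_axis_dilate fun_eq_iff axis_dilate_axis_dilate power_int_add)

lemma fun_powi_dilate_2:
  "fun_powi (dilate (vector [vector [1, 0], vector [0, 2]])) i = axis_dilate 1 (2 powi i)"
  using fun_powi_hom[of "\<lambda>i. axis_dilate 1 (2 powi i)" i]
  by (simp add: dilate_eq_axis_dilate fun_eq_iff axis_dilate_axis_dilate power_int_add)

lemma fun_powi_matrix_1:
  "fun_powi ((*v) (vector [vector [2, 0], vector [0, 1]] :: real^2^2)) i = axis_scale (2 powi i) 1"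
  using fun_powi_hom[of "\<lambda>i. axis_scale (2 powi i) 1" i]
  by (simp add: dilation_matrix_mult[abs_def] fun_eq_iff power_int_add)

lemma fun_powi_matrix_2:
  "fun_powi ((*v) (vector [vector [1, 0], vector [0, 2]] :: real^2^2)) i = axis_scale 1 (2 powi i)"
  using fun_powi_hom[of "\<lambda>i. axis_scale 1 (2 powi i)" i]
  by (simp add: dilation_matrix_mult[abs_def] fun_eq_iff power_int_add)

text \<open>Reconciles two conventions: \<open>translate\<close> subtracts \<open>k\<close>, while
  the wavelet system adds it.\<close>

lemma l2_span_uminus_index:
  fixes e :: "'i::ab_group_add \<Rightarrow> 'a::euclidean_space \<Rightarrow> complex"
  assumes I: "\<And>i. i \<in> I \<Longrightarrow> - i \<in> I"
  shows "l2_span (\<lambda>i. e (- i)) I = l2_span e I"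
proof -
  have *: "l2_span (\<lambda>i. e (- i)) I \<subseteq> l2_span e I" for e :: "'i \<Rightarrow> 'a \<Rightarrow> complex"
  proof
    fix f assume "f \<in> l2_span (\<lambda>i. e (- i)) I"
    then obtain F c where f: "f = (\<lambda>x. \<Sum>i\<in>F. c i * e (- i) x)" "finite F" "F \<subseteq> I"
      unfolding l2_span_def by blast
    have "f = (\<lambda>x. \<Sum>i\<in>uminus ` F. c (- i) * e i x)"
      unfolding f(1) by (subst sum.reindex) auto
    then show "f \<in> l2_span e I"
      unfolding l2_span_def using f I
      by (intro CollectI exI[of _ "uminus ` F"] exI[of _ "\<lambda>i. c (- i)"]) auto
  qed
  from *[of e] *[of "\<lambda>i. e (- i)"] show ?thesis by auto
qed

lemma l2_orthonormal_basis_uminus_index: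
  fixes e :: "'i::ab_group_add \<Rightarrow> 'a::euclidean_space \<Rightarrow> complex"
  assumes "\<And>i. i \<in> I \<Longrightarrow> - i \<in> I" "l2_orthonormal_basis e I S"
  shows "l2_orthonormal_basis (\<lambda>i. e (- i)) I S"
  using assms(2) by (auto simp: l2_orthonormal_basis_def l2_span_uminus_index[OF assms(1)] assms(1))

text \<open>Each dilation carries a basis of the functions on \<open>S\<close> to one of the
  functions on \<open>X m n\<close>. These sets partition the plane up to a null set, so L2 is the
  orthogonal sum of the pieces. The exponents are negative because the Fourier transform inverts
  dilations.\<close>

lemma dyadic_dilates_orthonormal_basis:
  fixes e :: "'i \<Rightarrow> real^2 \<Rightarrow> complex" and S :: "(real^2) set"
  defines "D \<equiv> \<lambda>m n. axis_dilate (2 powi (- m)) (2 powi (- n))"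
  defines "X \<equiv> \<lambda>m n. axis_scale (2 powi (- m)) (2 powi (- n)) -` S"
  assumes S: "S \<in> sets borel" and onb: "l2_orthonormal_basis e I (L2_on S)"
    and disjoint: "\<And>m n m' n'. (m, n) \<noteq> (m', n') \<Longrightarrow> X m n \<inter> X m' n' = {}"
    and cover: "AE x in lborel. \<exists>m n. x \<in> X m n"
  shows "l2_orthonormal_basis (\<lambda>(m, n, k). D m n (e k)) (UNIV \<times> UNIV \<times> I) L2"
proof -
  have e: "e k \<in> L2" "e k \<in> L2_on S" if "k \<in> I" for k
    using onb that l2_closure_span_memI[of I e k] by (auto simp: l2_orthonormal_basis_def)
  have D: "l2_isometry (D m n)" for m n
    unfolding D_def by (rule l2_isometry_axis_dilate) auto
  have DX: "D m n f \<in> L2_on (X m n)" if "f \<in> L2_on S" for m n f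
    unfolding D_def X_def by (rule axis_dilate_L2_on) (use S that in auto)
  have Xm[measurable]: "X m n \<in> sets borel" for m n
    unfolding X_def using measurable_sets[OF axis_scale_measurable S] by simp
  define E where "E = (\<lambda>(m, n, k). D m n (e k))"
  define J where "J = (UNIV \<times> UNIV \<times> I :: (int \<times> int \<times> 'i) set)"
  have EL: "E i \<in> L2" if "i \<in> J" for i
    using that e l2_isometryD(1)[OF D] by (auto simp: E_def J_def)
  have inner: "l2_inner (D m n (e k)) (D m' n' (e k')) = (if (m, n, k) = (m', n', k') then 1 else 0)"
    if k: "k \<in> I" "k' \<in> I" for m n m' n' k k'
  proof (cases "(m, n) = (m', n')")
    case True
    then show ?thesis
      using onb k e by (auto simp: l2_isometryD(2)[OF D] l2_orthonormal_basis_def)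
  next
    case False
    have "AE x in lborel. D m n (e k) x * cnj (D m' n' (e k') x) = 0"
    proof -
      have "AE x in lborel. x \<notin> X m n \<longrightarrow> D m n (e k) x = 0" "AE x in lborel. x \<notin> X m' n' \<longrightarrow> D m' n' (e k') x = 0"
        using DX[OF e(2)] k by (auto simp: L2_on_def)
      then show ?thesis by eventually_elim (use disjoint[OF False] in auto)
    qed
    then have "l2_inner (D m n (e k)) (D m' n' (e k')) = 0"
      unfolding l2_inner_def by (rule integral_eq_zero_AE)
    then show ?thesis using False by auto
  qed
  define C where "C = l2_closure (l2_span E J)"
  have C: "closed_l2_subspace C" unfolding C_def by (rule closed_l2_subspace_span[OF EL])
  have DC: "D m n f \<in> C" if f: "f \<in> L2_on S" for m n f
  proof -
    have "l2_closure (l2_span e I) \<subseteq> {f \<in> L2. D m n f \<in> C}"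
    proof (rule l2_closure_span_subset[OF closed_l2_subspace_pullback[OF D C]])
      fix k assume k: "k \<in> I"
      have "E (m, n, k) \<in> C" unfolding C_def using k by (intro l2_closure_span_memI EL) (auto simp: J_def)
      then show "e k \<in> {f \<in> L2. D m n f \<in> C}" using e(1)[OF k] by (simp add: E_def)
    qed
    then show ?thesis using f onb by (auto simp: l2_orthonormal_basis_def)
  qed
  have XC: "(\<lambda>x. indicator (X m n) x * f x) \<in> C" if f: "f \<in> L2" for m n f
  proof -
    \<comment> \<open>The inverse dilation moves the piece of \<open>f\<close> on
      \<open>X m n\<close> back to \<open>S\<close>.\<close>
    define g where "g = axis_dilate (2 powi m) (2 powi n) (\<lambda>x. indicator (X m n) x * f x)"
    have "(\<lambda>x. indicator (X m n) x * f x) \<in> L2_on (X m n)"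
      by (rule L2_on_indicator_mult[OF f Xm])
    then have "g \<in> L2_on (axis_scale (2 powi m) (2 powi n) -` X m n)"
      unfolding g_def by (intro axis_dilate_L2_on Xm) auto
    also have "axis_scale (2 powi m) (2 powi n) -` X m n = S"
      by (auto simp: X_def power_int_minus)
    finally have "D m n g \<in> C" by (rule DC)
    moreover have "D m n g = (\<lambda>x. indicator (X m n) x * f x)"
      unfolding D_def g_def by (subst axis_dilate_axis_dilate) (auto simp: power_int_minus)
    ultimately show ?thesis by simp
  qed
  have "L2 \<subseteq> C"
  proof
    fix f :: "real^2 \<Rightarrow> complex" assume f: "f \<in> L2"
    \<comment> \<open>Finite squares of indices exhaust all pairs and turn the double series into
      one sequence.\<close>
    define K where "K N = {- int N..int N} \<times> {- int N..int N}" for N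
    define Y where "Y N = (\<Union>p\<in>K N. X (fst p) (snd p))" for N
    have fin: "finite (K N)" for N by (simp add: K_def)
    have dj: "disjoint_family_on (\<lambda>p. X (fst p) (snd p)) (K N)" for N
      unfolding disjoint_family_on_def
    proof (intro ballI impI)
      fix p q :: "int \<times> int" assume "p \<noteq> q"
      then show "X (fst p) (snd p) \<inter> X (fst q) (snd q) = {}"
        using disjoint[of "fst p" "snd p" "fst q" "snd q"] by (simp add: prod_eq_iff)
    qed
    note [measurable] = f[THEN L2_measurable_borel]
    show "f \<in> C"
    proof (rule closed_l2_subspace_dominated[OF C, where w = "\<lambda>x. cmod (f x)"])
      show "(\<lambda>x. indicator (Y N) x * f x) \<in> C" for N
      proof -
        have "(\<lambda>x. \<Sum>p\<in>K N. indicator (X (fst p) (snd p)) x * f x) \<in> C"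
          by (intro closed_l2_subspace_sum[OF C] XC f)
        moreover have "(\<Sum>p\<in>K N. indicator (X (fst p) (snd p)) x * f x) = indicator (Y N) x * f x" for x
          unfolding Y_def by (simp only: indicator_UN_disjoint[OF fin dj] sum_distrib_right)
        ultimately show ?thesis by simp
      qed
      show "AE x in lborel. cmod (indicator (Y N) x * f x) \<le> cmod (f x)" for N
        by (auto simp: indicator_def)
      show "integrable lborel (\<lambda>x. (cmod (f x))\<^sup>2)" by (rule L2_integrable[OF f])
      show "AE x in lborel. (\<lambda>N. indicator (Y N) x * f x) \<longlonglongrightarrow> f x"
        using cover
      proof eventually_elim
        case (elim x)
        then obtain m n where mn: "x \<in> X m n" by blast
        have "\<forall>\<^sub>F N in sequentially. indicator (Y N) x * f x = f x"
        proof (rule eventually_sequentiallyI[of "nat (max \<bar>m\<bar> \<bar>n\<bar>)"])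
          fix N assume "nat (max \<bar>m\<bar> \<bar>n\<bar>) \<le> N"
          then have "(m, n) \<in> K N" by (auto simp: K_def)
          then have "x \<in> Y N" using mn by (force simp: Y_def)
          then show "indicator (Y N) x * f x = f x" by simp
        qed
        then show ?case by (rule tendsto_eventually)
      qed
    qed (measurable)
  qed
  then have "C = L2" using closed_l2_subspaceD(1)[OF C] by blast
  then have "l2_orthonormal_basis E J L2"
  proof -
    assume "C = L2"
    moreover have "l2_inner (E i) (E j) = (if i = j then 1 else 0)" if "i \<in> J" "j \<in> J" for i j
      using that inner by (auto simp: E_def J_def split: if_splits)
    ultimately show ?thesis
      unfolding l2_orthonormal_basis_def using EL by (simp add: C_def)
  qed
  then show ?thesis by (simp only: E_def J_def)
qed

lemma AE_not_in_negligible: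
  assumes "negligible N" "N \<in> sets borel"
  shows "AE x in lborel. x \<notin> N"
proof -
  have "N \<in> null_sets lborel"
    using assms by (simp add: negligible_iff_null_sets null_sets_completion_iff)
  then show ?thesis by (rule AE_not_in)
qed

lemma AE_coordinate_neq: "AE x in lborel. (x :: real^2) $ i \<noteq> c"
proof -
  have "AE x in lborel. (x :: real^2) \<notin> {x. x $ i = c}"
  proof (rule AE_not_in_negligible)
    have "{x :: real^2. x $ i = c} = {x. x \<bullet> axis i 1 = c}" by (simp add: inner_axis)
    moreover have "axis i 1 \<in> (Basis :: (real^2) set)" by (auto simp: Basis_vec_def)
    ultimately show "negligible {x :: real^2. x $ i = c}" by (simp add: negligible_standard_hyperplane)
  qed simp
  then show ?thesis by simp
qed

text \<open>Membership can fail to be locally constant only on the frontier, which is covered by the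
  frontiers of finitely many convex sets and hence negligible.\<close>

lemma boxes_AE_locally_constant:
  fixes l u :: "'i \<Rightarrow> real^2"
  assumes P: "finite P"
  defines "S \<equiv> (\<Union>p\<in>P. box (l p) (u p))"
  shows "AE \<xi> in lborel. \<exists>d>0. \<forall>\<eta>. \<bar>\<eta> $ 1\<bar> < d \<and> \<bar>\<eta> $ 2\<bar> < d \<longrightarrow> (\<eta> + \<xi> \<in> S \<longleftrightarrow> \<xi> \<in> S)"
proof -
  have "frontier S \<subseteq> (\<Union>p\<in>P. frontier (box (l p) (u p)))"
    unfolding S_def using frontier_Union_subset[of "(\<lambda>p. box (l p) (u p)) ` P"] P by auto
  moreover have "negligible (\<Union>p\<in>P. frontier (box (l p) (u p)))"
    using P by (intro negligible_Union) (auto intro!: negligible_convex_frontier convex_box)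
  ultimately have "negligible (frontier S)" by (rule negligible_subset[rotated])
  then have "AE \<xi> in lborel. \<xi> \<notin> frontier S" by (rule AE_not_in_negligible) (simp add: borel_closed)
  then show ?thesis
  proof eventually_elim
    case (elim \<xi>)
    have "\<exists>e>0. \<forall>y. dist y \<xi> < e \<longrightarrow> (y \<in> S \<longleftrightarrow> \<xi> \<in> S)"
    proof (cases "\<xi> \<in> S")
      case True
      then have "\<xi> \<in> interior S" using elim closure_subset[of S] by (auto simp: frontier_def)
      then obtain e where "e > 0" "ball \<xi> e \<subseteq> S" by (auto simp: mem_interior)
      then show ?thesis using True by (auto simp: subset_iff dist_commute)
    next
      case False
      then have "\<xi> \<in> - closure S" using elim interior_subset[of S] by (auto simp: frontier_def)
      then obtain e where "e > 0" "ball \<xi> e \<subseteq> - closure S"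
        using open_contains_ball[of "- closure S"] by auto
      then show ?thesis using False closure_subset[of S] by (intro exI[of _ e]) (auto simp: subset_iff dist_commute)
    qed
    then obtain e where e: "e > 0" "\<And>y. dist y \<xi> < e \<Longrightarrow> (y \<in> S \<longleftrightarrow> \<xi> \<in> S)" by blast
    have "\<eta> + \<xi> \<in> S \<longleftrightarrow> \<xi> \<in> S" if "\<bar>\<eta> $ 1\<bar> < e / 2" "\<bar>\<eta> $ 2\<bar> < e / 2" for \<eta>
    proof (rule e(2))
      have "norm \<eta> \<le> \<bar>\<eta> $ 1\<bar> + \<bar>\<eta> $ 2\<bar>" using norm_le_l1_cart[of \<eta>] by (simp add: sum_2)
      then show "dist (\<eta> + \<xi>) \<xi> < e" using that by (simp add: dist_norm)
    qed
    then show ?case using e(1) by (intro exI[of _ "e / 2"]) auto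
  qed
qed

lemma bmra_separable_autocorrelation:
  fixes A B :: "real^2^2"
  assumes A: "A = vector [vector [2, 0], vector [0, 1]]" and \<phi>: "\<phi> \<in> L2"
    and sep: "separable_bmra A B \<phi> V"
  shows "l2_inner \<phi> (translate (vector [1/2, 1]) \<phi>) * l2_inner \<phi> (translate (vector [0, 0]) \<phi>)
    = l2_inner \<phi> (translate (vector [1/2, 0]) \<phi>) * l2_inner \<phi> (translate (vector [0, 1]) \<phi>)"
proof -
  obtain f\<^sub>1 V\<^sub>1 f\<^sub>2 V\<^sub>2 U where f: "mra f\<^sub>1 V\<^sub>1" "mra f\<^sub>2 V\<^sub>2" and U: "l2_unitary U"
    and UA: "\<And>f. f \<in> L2 \<Longrightarrow> l2_eq (U (dilate A f)) (dilate A (U f))"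
    and UT: "\<And>k f. k \<in> int_lattice \<Longrightarrow> f \<in> L2 \<Longrightarrow> l2_eq (U (translate k f)) (translate k (U f))"
    and U\<phi>: "l2_eq (U \<phi>) (tensor_fun f\<^sub>1 f\<^sub>2)"
    using sep unfolding separable_bmra_def bmra_unitarily_equivalent_def by blast
  have fL: "f\<^sub>1 \<in> L2" "f\<^sub>2 \<in> L2" using f by (auto simp: mra_def)
  have iso: "l2_isometry U" using U by (simp add: l2_unitary_def l2_isometry_def)
  note UL = l2_isometryD(1)[OF iso]
  have dA: "dilate A = axis_dilate 2 1" unfolding A by (rule dilate_eq_axis_dilate) auto
  have isoA: "l2_isometry (axis_dilate 2 1)" "l2_isometry (axis_dilate (1/2) 1)"
    by (auto intro: l2_isometry_axis_dilate)
  note TL = l2_isometryD(1)[OF l2_isometry_translate]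
  \<comment> \<open>Conjugation by the first dilation halves the first coordinate of a translation
    vector, so commuting with that dilation and with integer translations includes half-integer
    shifts in the first coordinate.\<close>
  have half: "l2_eq (U (translate (axis_scale (1/2) 1 k) g)) (translate (axis_scale (1/2) 1 k) (U g))"
    if k: "k \<in> int_lattice" and g: "g \<in> L2" for k g
  proof -
    define f where "f = axis_dilate (1/2) 1 g"
    have f: "f \<in> L2" unfolding f_def by (rule l2_isometryD(1)[OF isoA(2) g])
    have gf: "g = axis_dilate 2 1 f" unfolding f_def by (simp add: axis_dilate_axis_dilate)
    have comm: "translate (axis_scale (1/2) 1 k) (axis_dilate 2 1 h) = axis_dilate 2 1 (translate k h)" for h
    proof -
      have "axis_scale 2 1 (x - axis_scale (1/2) 1 k) = axis_scale 2 1 x - k" for x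
        by (simp add: vec_eq_2)
      then show ?thesis by (simp add: translate_def axis_dilate_def)
    qed
    have "l2_eq (U (axis_dilate 2 1 (translate k f))) (axis_dilate 2 1 (U (translate k f)))"
      using UA[OF TL[OF f]] by (simp add: dA)
    also have "l2_eq \<dots> (axis_dilate 2 1 (translate k (U f)))"
      by (rule l2_isometry_cong[OF isoA(1) UL[OF TL[OF f]] TL[OF UL[OF f]] UT[OF k f]])
    also have "\<dots> = translate (axis_scale (1/2) 1 k) (axis_dilate 2 1 (U f))" by (rule comm[symmetric])
    also have "l2_eq \<dots> (translate (axis_scale (1/2) 1 k) (U (axis_dilate 2 1 f)))"
    proof (rule l2_isometry_cong[OF l2_isometry_translate])
      show "axis_dilate 2 1 (U f) \<in> L2" by (rule l2_isometryD(1)[OF isoA(1) UL[OF f]])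
      show "U (axis_dilate 2 1 f) \<in> L2" by (rule UL[OF l2_isometryD(1)[OF isoA(1) f]])
      show "l2_eq (axis_dilate 2 1 (U f)) (U (axis_dilate 2 1 f))"
        using UA[OF f] by (simp add: dA l2_eq_sym)
    qed
    finally show ?thesis unfolding gf comm .
  qed
  have R: "l2_inner (U \<phi>) (translate (vector [s, t]) (U \<phi>)) = l2_inner \<phi> (translate (vector [s, t]) \<phi>)"
    if "2 * s \<in> \<int>" "t \<in> \<int>" for s t
  proof -
    have k: "vector [2 * s, t] \<in> int_lattice" using that by (simp add: int_lattice_iff)
    have v: "axis_scale (1/2) 1 (vector [2 * s, t]) = vector [s, t]" by (simp add: vec_eq_2)
    have "l2_inner (U \<phi>) (translate (vector [s, t]) (U \<phi>)) = l2_inner (U \<phi>) (U (translate (vector [s, t]) \<phi>))"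
      by (rule l2_inner_cong[OF l2_eq_refl half[OF k \<phi>, unfolded v, THEN l2_eq_sym] UL[OF \<phi>] UL[OF \<phi>]
          TL[OF UL[OF \<phi>]] UL[OF TL[OF \<phi>]]])
    also have "\<dots> = l2_inner \<phi> (translate (vector [s, t]) \<phi>)"
      by (rule l2_isometryD(2)[OF iso \<phi> TL[OF \<phi>]])
    finally show ?thesis .
  qed
  from autocorrelation_separable[OF UL[OF \<phi>] fL U\<phi>, of "1/2" 1 0 0] show ?thesis
    by (simp add: R)
qed

section \<open>A nonseparable analysis and its wavelet\<close>

definition skew_abs :: "real^2 \<Rightarrow> real" where
  "skew_abs v = (if 0 < v $ 1 * v $ 2 then 4 / 3 * \<bar>v $ 1\<bar> else 4 * \<bar>v $ 1\<bar>)"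

definition scaling_set :: "real \<Rightarrow> real \<Rightarrow> (real^2) set" where
  "scaling_set s t = {v. skew_abs v < s \<and> 2 * \<bar>v $ 2\<bar> < t}"

text \<open>The half-open ranges make the dyadic dilates disjoint without exception and turn the
  later difference of scaling sets into an exact equality. The two parameters keep preimages under
  dilations inside the family.\<close>

definition wavelet_set :: "real \<Rightarrow> real \<Rightarrow> (real^2) set" where
  "wavelet_set s t = {v. s \<le> skew_abs v \<and> skew_abs v < 2 * s \<and> t \<le> 2 * \<bar>v $ 2\<bar> \<and> 2 * \<bar>v $ 2\<bar> < 2 * t}"

lemma skew_abs_measurable [measurable]: "skew_abs \<in> borel_measurable borel"
  unfolding skew_abs_def[abs_def] by measurable

lemma scaling_set_borel [measurable]: "scaling_set s t \<in> sets borel"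
  unfolding scaling_set_def by measurable

lemma wavelet_set_borel [measurable]: "wavelet_set s t \<in> sets borel"
  unfolding wavelet_set_def by measurable

text \<open>Positive scalings keep the sign of the product of the coordinates, so the same branch
  applies before and after.\<close>

lemma skew_abs_axis_scale: "s > 0 \<Longrightarrow> t > 0 \<Longrightarrow> skew_abs (axis_scale s t v) = s * skew_abs v"
proof -
  assume "s > 0" "t > 0"
  then have "0 < s * t" by simp
  moreover have "s * v $ 1 * (t * v $ 2) = (s * t) * (v $ 1 * v $ 2)" by simp
  ultimately have "0 < s * v $ 1 * (t * v $ 2) \<longleftrightarrow> 0 < v $ 1 * v $ 2"
    by (metis mult_pos_pos zero_less_mult_pos)
  then show ?thesis using \<open>s > 0\<close> by (simp add: skew_abs_def abs_mult)
qed

lemma scaling_set_vimage: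
  "s > 0 \<Longrightarrow> t > 0 \<Longrightarrow> axis_scale s t -` scaling_set a b = scaling_set (a / s) (b / t)"
  by (auto simp: scaling_set_def skew_abs_axis_scale abs_mult field_simps)

lemma wavelet_set_vimage:
  "s > 0 \<Longrightarrow> t > 0 \<Longrightarrow> axis_scale s t -` wavelet_set a b = wavelet_set (a / s) (b / t)"
  by (auto simp: wavelet_set_def skew_abs_axis_scale abs_mult field_simps)

text \<open>Corners of open boxes that replace the scaling set up to a null set: boxes have explicit
  transforms, while the set itself has the simple scaling rule.\<close>

definition scaling_lo :: "nat \<Rightarrow> real^2" where
  "scaling_lo i = [vector [-1/4, 0], vector [-3/4, -1/2]] ! i"

definition scaling_hi :: "nat \<Rightarrow> real^2" where
  "scaling_hi i = [vector [3/4, 1/2], vector [1/4, 0]] ! i"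

definition wavelet_lo :: "nat \<Rightarrow> real^2" where
  "wavelet_lo i = [vector [3/4, 1/2], vector [-1/2, 1/2], vector [-3/2, -1], vector [1/4, -1]] ! i"

definition wavelet_hi :: "nat \<Rightarrow> real^2" where
  "wavelet_hi i = [vector [3/2, 1], vector [-1/4, 1], vector [-3/4, -1/2], vector [1/2, -1/2]] ! i"

definition scaling_boxes :: "(real^2) set" where
  "scaling_boxes = (\<Union>i\<in>{0, 1}. box (scaling_lo i) (scaling_hi i))"

definition wavelet_boxes :: "(real^2) set" where
  "wavelet_boxes = (\<Union>i\<in>{0, 1, 2, 3}. box (wavelet_lo i) (wavelet_hi i))"

lemma mem_scaling_boxes: "v \<in> scaling_boxes \<longleftrightarrow>
    v $ 1 \<in> {-1/4<..<3/4} \<and> v $ 2 \<in> {0<..<1/2} \<or> v $ 1 \<in> {-3/4<..<1/4} \<and> v $ 2 \<in> {-1/2<..<0}"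
  by (simp add: scaling_boxes_def scaling_lo_def scaling_hi_def mem_box_2)

lemma mem_wavelet_boxes: "v \<in> wavelet_boxes \<longleftrightarrow>
    (v $ 1 \<in> {3/4<..<3/2} \<or> v $ 1 \<in> {-1/2<..<-1/4}) \<and> v $ 2 \<in> {1/2<..<1} \<or>
    (v $ 1 \<in> {-3/2<..<-3/4} \<or> v $ 1 \<in> {1/4<..<1/2}) \<and> v $ 2 \<in> {-1<..<-1/2}"
  by (auto simp: wavelet_boxes_def wavelet_lo_def wavelet_hi_def mem_box_2)

lemma scaling_boxes_borel: "scaling_boxes \<in> sets borel" "bounded scaling_boxes"
  unfolding scaling_boxes_def by (auto intro!: bounded_UN)

lemma wavelet_boxes_borel: "wavelet_boxes \<in> sets borel" "bounded wavelet_boxes"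
  unfolding wavelet_boxes_def by (auto intro!: bounded_UN)

lemma AE_scaling_boxes: "AE v in lborel. v \<in> scaling_boxes \<longleftrightarrow> v \<in> scaling_set 1 1"
  \<comment> \<open>The set and the boxes differ only on the line where the second coordinate is 0,
    which the open boxes omit.\<close>
  using AE_coordinate_neq[of 2 0]
proof eventually_elim
  case (elim v)
  then consider "v $ 2 > 0" | "v $ 2 < 0" by linarith
  then show ?case
    by cases (auto simp: mem_scaling_boxes scaling_set_def skew_abs_def zero_less_mult_iff abs_if split: if_splits)
qed

lemma AE_wavelet_boxes: "AE v in lborel. v \<in> wavelet_boxes \<longleftrightarrow> v \<in> wavelet_set 1 1"
  \<comment> \<open>These lines contain the edges that belong to the half-open set but not to the
    open boxes.\<close>
  using AE_coordinate_neq[of 1 "3/4"] AE_coordinate_neq[of 1 "-3/4"] AE_coordinate_neq[of 1 "1/4"] AE_coordinate_neq[of 1 "-1/4"]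
    AE_coordinate_neq[of 2 "1/2"] AE_coordinate_neq[of 2 "-1/2"]
proof eventually_elim
  case (elim v)
  consider "v $ 2 > 0" | "v $ 2 = 0" | "v $ 2 < 0" by linarith
  then show ?case
    using elim
    by cases (auto simp: mem_wavelet_boxes wavelet_set_def skew_abs_def zero_less_mult_iff abs_if split: if_splits)
qed

lemma Ints_abs_less_1: "z \<in> \<int> \<Longrightarrow> \<bar>z\<bar> < 1 \<Longrightarrow> z = (0::real)"
proof -
  assume "z \<in> \<int>" "\<bar>z\<bar> < 1"
  then obtain n where n: "z = of_int n" by (auto elim: Ints_cases)
  with \<open>\<bar>z\<bar> < 1\<close> have "real_of_int \<bar>n\<bar> < real_of_int 1" by simp
  then have "\<bar>n\<bar> < 1" by (simp only: of_int_less_iff)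
  then show ?thesis using n by simp
qed

lemma not_Ints_between_1_2: "1 < \<bar>z\<bar> \<Longrightarrow> \<bar>z\<bar> < 2 \<Longrightarrow> (z::real) \<notin> \<int>"
proof
  assume "1 < \<bar>z\<bar>" "\<bar>z\<bar> < 2" "z \<in> \<int>"
  then obtain n where n: "z = of_int n" by (auto elim: Ints_cases)
  with \<open>1 < \<bar>z\<bar>\<close> \<open>\<bar>z\<bar> < 2\<close> have "real_of_int 1 < real_of_int \<bar>n\<bar>" "real_of_int \<bar>n\<bar> < real_of_int 2" by simp_all
  then show False unfolding of_int_less_iff by simp
qed

text \<open>All second coordinates lie within distance less than 1 of each other, so they agree.
  Both points are then in the same box, whose x-extent is an open interval of length 1.\<close>

lemma scaling_boxes_packing:
  assumes "x \<in> scaling_boxes" "y \<in> scaling_boxes" "x - y \<in> int_lattice"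
  shows "x = y"
proof -
  have i: "x $ 1 - y $ 1 \<in> \<int>" "x $ 2 - y $ 2 \<in> \<int>" using assms(3) by (auto simp: int_lattice_iff)
  have "\<bar>x $ 2 - y $ 2\<bar> < 1" using assms(1,2) by (auto simp: mem_scaling_boxes)
  then have 2: "x $ 2 = y $ 2" using Ints_abs_less_1[OF i(2)] by simp
  then have "\<bar>x $ 1 - y $ 1\<bar> < 1" using assms(1,2) by (auto simp: mem_scaling_boxes)
  then have "x $ 1 = y $ 1" using Ints_abs_less_1[OF i(1)] by simp
  then show ?thesis using 2 by (simp add: vec_eq_2)
qed

text \<open>Within one piece coordinates differ by less than 1, across two pieces by a number
  strictly between 1 and 2; so an integer difference is 0. The second coordinate is treated first
  because it decides which pair of x-intervals occurs.\<close>

lemma wavelet_boxes_packing: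
  assumes "x \<in> wavelet_boxes" "y \<in> wavelet_boxes" "x - y \<in> int_lattice"
  shows "x = y"
proof -
  have i: "x $ 1 - y $ 1 \<in> \<int>" "x $ 2 - y $ 2 \<in> \<int>" using assms(3) by (auto simp: int_lattice_iff)
  have "\<bar>x $ 2 - y $ 2\<bar> < 1 \<or> 1 < \<bar>x $ 2 - y $ 2\<bar> \<and> \<bar>x $ 2 - y $ 2\<bar> < 2"
    using assms(1,2) by (auto simp: mem_wavelet_boxes)
  then have 2: "x $ 2 = y $ 2" using Ints_abs_less_1[OF i(2)] not_Ints_between_1_2[of "x $ 2 - y $ 2"] i(2) by auto
  then have "\<bar>x $ 1 - y $ 1\<bar> < 1 \<or> 1 < \<bar>x $ 1 - y $ 1\<bar> \<and> \<bar>x $ 1 - y $ 1\<bar> < 2"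
    using assms(1,2) by (auto simp: mem_wavelet_boxes)
  then have "x $ 1 = y $ 1" using Ints_abs_less_1[OF i(1)] not_Ints_between_1_2[of "x $ 1 - y $ 1"] i(1) by auto
  then show ?thesis using 2 by (simp add: vec_eq_2)
qed

lemma scaling_boxes_disjoint: "disjoint_family_on (\<lambda>i. box (scaling_lo i) (scaling_hi i)) {0, 1}"
  by (auto simp: disjoint_family_on_def scaling_lo_def scaling_hi_def mem_box_2)

lemma wavelet_boxes_disjoint: "disjoint_family_on (\<lambda>i. box (wavelet_lo i) (wavelet_hi i)) {0, 1, 2, 3}"
  by (auto simp: disjoint_family_on_def wavelet_lo_def wavelet_hi_def mem_box_2)

text \<open>Over a full period an exponential of nonzero integer frequency integrates to 0.\<close>

lemma interval_ift_unit:
  assumes "k \<in> \<int>"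
  shows "interval_ift a (a + 1) k = (if k = 0 then 1 else 0)"
proof (cases "k = 0")
  case False
  have "cis (2 * pi * (k * (a + 1))) = cis (2 * pi * (k * a)) * cis (2 * pi * k)"
    by (simp add: cis_mult algebra_simps)
  then have "cis (2 * pi * (k * (a + 1))) = cis (2 * pi * (k * a))"
    using cis_multiple_2pi[OF assms] by simp
  then show ?thesis using False by (simp add: interval_ift_eq)
qed (simp add: interval_ift_0)

lemma interval_ift_join:
  assumes "a \<le> b" "b \<le> c"
  shows "interval_ift a b x + interval_ift b c x = interval_ift a c x"
proof (cases "x = 0")
  case False
  then show ?thesis using assms by (simp add: interval_ift_eq diff_divide_distrib)
qed (use assms in \<open>simp add: interval_ift_0\<close>)

lemma interval_ift_shift:
  assumes "k \<in> \<int>"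
  shows "interval_ift (a + 1) (b + 1) k = interval_ift a b k"
  using interval_ift_translate[of a 1 b k] cis_multiple_2pi[OF assms] by simp

text \<open>Both boxes have length 1 in the x direction and so share that factor; their y-intervals
  join to one of length 1.\<close>

lemma scaling_boxes_orthonormal:
  assumes k: "k \<in> int_lattice"
  shows "l2_inner (indicator scaling_boxes) (modulate k (indicator scaling_boxes)) = (if k = 0 then 1 else 0)"
proof -
  have i: "k $ 1 \<in> \<int>" "k $ 2 \<in> \<int>" using k by (auto simp: int_lattice_iff)
  have x: "interval_ift (-1/4) (3/4) (k $ 1) = (if k $ 1 = 0 then 1 else 0)"
    "interval_ift (-3/4) (1/4) (k $ 1) = (if k $ 1 = 0 then 1 else 0)"
    using interval_ift_unit[OF i(1), of "-1/4"] interval_ift_unit[OF i(1), of "-3/4"] by simp_all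
  have y: "interval_ift 0 (1/2) (k $ 2) + interval_ift (-1/2) 0 (k $ 2) = (if k $ 2 = 0 then 1 else 0)"
    using interval_ift_join[of "-1/2" 0 "1/2" "k $ 2"] interval_ift_unit[OF i(2), of "-1/2"] by (simp add: add.commute)
  have "l2_inner (indicator scaling_boxes) (modulate k (indicator scaling_boxes))
      = (\<Sum>i\<in>{0, 1}. box_ift (scaling_lo i) (scaling_hi i) k)"
    unfolding scaling_boxes_def by (rule l2_inner_indicator_modulate_boxes[OF _ scaling_boxes_disjoint]) simp
  also have "\<dots> = (if k $ 1 = 0 then 1 else 0) * (interval_ift 0 (1/2) (k $ 2) + interval_ift (-1/2) 0 (k $ 2))"
    using x by (simp add: box_ift_def tensor_fun_def scaling_lo_def scaling_hi_def distrib_left)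
  finally show ?thesis unfolding y by (simp add: vec_eq_2)
qed

lemma wavelet_boxes_orthonormal:
  assumes k: "k \<in> int_lattice"
  shows "l2_inner (indicator wavelet_boxes) (modulate k (indicator wavelet_boxes)) = (if k = 0 then 1 else 0)"
proof -
  have i: "k $ 1 \<in> \<int>" "k $ 2 \<in> \<int>" using k by (auto simp: int_lattice_iff)
  \<comment> \<open>At integer frequencies a shift by 1 is invisible. It moves (-1/2, -1/4) to (1/2,
    3/4), which completes (3/4, 3/2) to an interval of length 1; the next two identities are of the
    same kind.\<close>
  have x: "interval_ift (3/4) (3/2) (k $ 1) + interval_ift (-1/2) (-1/4) (k $ 1) = (if k $ 1 = 0 then 1 else 0)"
    using interval_ift_join[of "1/2" "3/4" "3/2" "k $ 1"] interval_ift_unit[OF i(1), of "1/2"]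
      interval_ift_shift[OF i(1), of "-1/2" "-1/4"] by (simp add: add.commute)
  have x': "interval_ift (-3/2) (-3/4) (k $ 1) + interval_ift (1/4) (1/2) (k $ 1) = (if k $ 1 = 0 then 1 else 0)"
    using interval_ift_join[of "-3/2" "-3/4" "-1/2" "k $ 1"] interval_ift_unit[OF i(1), of "-3/2"]
      interval_ift_shift[OF i(1), of "-3/4" "-1/2"] by simp
  have y: "interval_ift (1/2) 1 (k $ 2) + interval_ift (-1) (-1/2) (k $ 2) = (if k $ 2 = 0 then 1 else 0)"
    using interval_ift_join[of 0 "1/2" 1 "k $ 2"] interval_ift_unit[OF i(2), of 0]
      interval_ift_shift[OF i(2), of "-1" "-1/2"] by (simp add: add.commute)
  have "l2_inner (indicator wavelet_boxes) (modulate k (indicator wavelet_boxes))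
      = (\<Sum>i\<in>{0, 1, 2, 3}. box_ift (wavelet_lo i) (wavelet_hi i) k)"
    unfolding wavelet_boxes_def by (rule l2_inner_indicator_modulate_boxes[OF _ wavelet_boxes_disjoint]) simp
  also have "\<dots> = (interval_ift (3/4) (3/2) (k $ 1) + interval_ift (-1/2) (-1/4) (k $ 1)) * interval_ift (1/2) 1 (k $ 2)
      + (interval_ift (-3/2) (-3/4) (k $ 1) + interval_ift (1/4) (1/2) (k $ 1)) * interval_ift (-1) (-1/2) (k $ 2)"
    by (simp add: box_ift_def tensor_fun_def wavelet_lo_def wavelet_hi_def algebra_simps)
  also have "\<dots> = (if k $ 1 = 0 then 1 else 0) * (interval_ift (1/2) 1 (k $ 2) + interval_ift (-1) (-1/2) (k $ 2))"
    unfolding x x' by (simp add: distrib_left)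
  finally show ?thesis unfolding y by (simp add: vec_eq_2)
qed

lemma scaling_boxes_side: "p \<in> {0, 1} \<Longrightarrow> scaling_hi p $ i - scaling_lo p $ i \<le> 1"
  using exhaust_2[of i] by (auto simp: scaling_lo_def scaling_hi_def)

lemma wavelet_boxes_side: "p \<in> {0, 1, 2, 3} \<Longrightarrow> wavelet_hi p $ i - wavelet_lo p $ i \<le> 1"
  using exhaust_2[of i] by (auto simp: wavelet_lo_def wavelet_hi_def)

lemma scaling_exponentials:
  "l2_orthonormal_basis (\<lambda>k. modulate k (indicator scaling_boxes)) int_lattice (L2_on scaling_boxes)"
proof (rule exponential_orthonormal_basis[OF scaling_boxes_borel _ _ scaling_boxes_def scaling_boxes_disjoint])
  show "finite {0, 1 :: nat}" by simp
qed (rule scaling_boxes_packing scaling_boxes_side scaling_boxes_orthonormal; assumption)+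

lemma wavelet_exponentials:
  "l2_orthonormal_basis (\<lambda>k. modulate k (indicator wavelet_boxes)) int_lattice (L2_on wavelet_boxes)"
proof (rule exponential_orthonormal_basis[OF wavelet_boxes_borel _ _ wavelet_boxes_def wavelet_boxes_disjoint])
  show "finite {0, 1, 2, 3 :: nat}" by simp
qed (rule wavelet_boxes_packing wavelet_boxes_side wavelet_boxes_orthonormal; assumption)+

definition scaling_function :: "real^2 \<Rightarrow> complex" where
  "scaling_function x = (\<Sum>i\<in>{0, 1}. box_ift (scaling_lo i) (scaling_hi i) x)"

definition wavelet_function :: "real^2 \<Rightarrow> complex" where
  "wavelet_function x = (\<Sum>i\<in>{0, 1, 2, 3}. box_ift (wavelet_lo i) (wavelet_hi i) x)"

lemma scaling_function_L2: "scaling_function \<in> L2"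
  unfolding scaling_function_def[abs_def] by (intro L2_sum box_ift_L2)

lemma wavelet_function_L2: "wavelet_function \<in> L2"
  unfolding wavelet_function_def[abs_def] by (intro L2_sum box_ift_L2)

lemma l2_ft_scaling_function: "l2_eq (l2_ft scaling_function) (indicator scaling_boxes)"
  unfolding scaling_function_def[abs_def] scaling_boxes_def
  by (rule l2_ft_sum_box_ift[OF _ scaling_boxes_disjoint]) simp

lemma l2_ft_wavelet_function: "l2_eq (l2_ft wavelet_function) (indicator wavelet_boxes)"
  unfolding wavelet_function_def[abs_def] wavelet_boxes_def
  by (rule l2_ft_sum_box_ift[OF _ wavelet_boxes_disjoint]) simp

text \<open>Conjugation exchanges a box with its reflection in the origin, and the four boxes form
  two such pairs, 0 with 2 and 1 with 3.\<close>

lemma wavelet_function_real: "wavelet_function x \<in> \<real>"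
proof -
  have v: "- (vector [a, b] :: real^2) = vector [- a, - b]" for a b by (simp add: vec_eq_2)
  show ?thesis
    unfolding Reals_cnj_iff wavelet_function_def wavelet_lo_def wavelet_hi_def
    by (simp add: cnj_box_ift v)
qed

text \<open>The squared modulus of the transform is the same indicator, so the autocorrelation is
  the function itself; questions about it become evaluations at a point.\<close>

lemma scaling_function_autocorrelation:
  "l2_inner scaling_function (translate t scaling_function) = scaling_function t"
  unfolding autocorrelation_indicator[OF scaling_function_L2 l2_ft_scaling_function scaling_boxes_borel]
  unfolding scaling_boxes_def scaling_function_def
  by (rule l2_inner_indicator_modulate_boxes[OF _ scaling_boxes_disjoint]) simp

lemma wavelet_function_autocorrelation:
  "l2_inner wavelet_function (translate t wavelet_function) = wavelet_function t"
  unfolding autocorrelation_indicator[OF wavelet_function_L2 l2_ft_wavelet_function wavelet_boxes_borel]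
  unfolding wavelet_boxes_def wavelet_function_def
  by (rule l2_inner_indicator_modulate_boxes[OF _ wavelet_boxes_disjoint]) simp

lemma scaling_function_at_lattice: "k \<in> int_lattice \<Longrightarrow> scaling_function k = (if k = 0 then 1 else 0)"
  using scaling_boxes_orthonormal scaling_function_autocorrelation
    autocorrelation_indicator[OF scaling_function_L2 l2_ft_scaling_function scaling_boxes_borel] by metis

lemma wavelet_function_at_lattice: "k \<in> int_lattice \<Longrightarrow> wavelet_function k = (if k = 0 then 1 else 0)"
  using wavelet_boxes_orthonormal wavelet_function_autocorrelation
    autocorrelation_indicator[OF wavelet_function_L2 l2_ft_wavelet_function wavelet_boxes_borel] by metis

text \<open>In both cases the boxes in the upper half-plane contribute \<open>z\<close> and those in
  the lower one its conjugate. The common value is twice the real part of \<open>z\<close>, that is,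
  \<open>- 2 * sqrt 2 / pi\<^sup>2\<close>.\<close>

lemma
  fixes t :: "real^2"
  defines "t \<equiv> vector [1/2, 1]"
  shows scaling_function_half_neq_0: "scaling_function t \<noteq> 0"
    and wavelet_function_half_neq_0: "wavelet_function t \<noteq> 0"
proof -
  have v: "- (vector [a, b] :: real^2) = vector [- a, - b]" for a b by (simp add: vec_eq_2)
  define z where "z = 2 * cis (- (pi / 4)) / (pi * \<i>)\<^sup>2"
  have "z = of_real (- 2 / pi\<^sup>2) * cis (- (pi / 4))" by (simp add: z_def power_mult_distrib)
  then have "Re z = - 2 / pi\<^sup>2 * (sqrt 2 / 2)" by (simp add: cos_45)
  then have z: "z + cnj z \<noteq> 0" by (simp add: complex_add_cnj)
  have c1: "cis (3 * pi / 4) = - cis (- (pi / 4))"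
  proof -
    have "cis (3 * pi / 4) = cis pi * cis (- (pi / 4))" by (simp add: cis_mult del: cis_pi)
    then show ?thesis by simp
  qed
  have c2: "cis (3 * pi / 2) = cis (- (pi / 2))"
  proof -
    have "cis (2 * pi + - (pi / 2)) = cis (2 * pi) * cis (- (pi / 2))" by (rule cis_mult[symmetric])
    moreover have "2 * pi + - (pi / 2) = 3 * pi / 2" by simp
    ultimately show ?thesis by (simp only: cis_2pi) simp
  qed
  have "interval_ift (-1/4) (3/4) (1/2) = - 2 * cis (- (pi / 4)) / (pi * \<i>)"
  proof -
    have "interval_ift (-1/4) (3/4) (1/2) = (cis (3 * pi / 4) - cis (- (pi / 4))) / (pi * \<i>)"
      by (subst interval_ift_eq) (simp_all add: mult.commute[of _ pi])
    moreover have "- c - c = - 2 * c" for c :: complex by simp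
    ultimately show ?thesis by (simp only: c1)
  qed
  moreover have "interval_ift 0 (1/2) 1 = - 1 / (pi * \<i>)"
    by (subst interval_ift_eq) simp_all
  ultimately have "box_ift (scaling_lo 0) (scaling_hi 0) t = z"
    by (simp add: box_ift_def tensor_fun_def scaling_lo_def scaling_hi_def t_def z_def power2_eq_square)
  moreover have "box_ift (scaling_lo 1) (scaling_hi 1) t = cnj (box_ift (scaling_lo 0) (scaling_hi 0) t)"
    by (simp add: cnj_box_ift scaling_lo_def scaling_hi_def v)
  ultimately show "scaling_function t \<noteq> 0"
    using z by (simp add: scaling_function_def)
  have x: "interval_ift (3/4) (3/2) (1/2) + interval_ift (-1/2) (-1/4) (1/2) = 2 * cis (- (pi / 4)) / (pi * \<i>)"
  proof -
    have "interval_ift (3/4) (3/2) (1/2) = (cis (3 * pi / 2) - cis (3 * pi / 4)) / (pi * \<i>)"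
      by (subst interval_ift_eq) (simp_all add: mult.commute[of _ pi])
    moreover have "interval_ift (-1/2) (-1/4) (1/2) = (cis (- (pi / 4)) - cis (- (pi / 2))) / (pi * \<i>)"
      by (subst interval_ift_eq) (simp_all add: mult.commute[of _ pi])
    ultimately show ?thesis by (simp add: c1 c2 add_divide_distrib[symmetric] del: cis_minus_pi_half)
  qed
  have y: "interval_ift (1/2) 1 1 = 1 / (pi * \<i>)"
    by (subst interval_ift_eq) simp_all
  have "box_ift (wavelet_lo 0) (wavelet_hi 0) t + box_ift (wavelet_lo 1) (wavelet_hi 1) t
      = (interval_ift (3/4) (3/2) (1/2) + interval_ift (-1/2) (-1/4) (1/2)) * interval_ift (1/2) 1 1"
    by (simp add: box_ift_def tensor_fun_def wavelet_lo_def wavelet_hi_def t_def distrib_right)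
  also have "\<dots> = z"
    unfolding x y z_def by (simp add: power2_eq_square)
  finally have "box_ift (wavelet_lo 0) (wavelet_hi 0) t + box_ift (wavelet_lo 1) (wavelet_hi 1) t = z" .
  moreover have "box_ift (wavelet_lo 2) (wavelet_hi 2) t + box_ift (wavelet_lo 3) (wavelet_hi 3) t
      = cnj (box_ift (wavelet_lo 0) (wavelet_hi 0) t + box_ift (wavelet_lo 1) (wavelet_hi 1) t)"
    by (simp add: cnj_box_ift wavelet_lo_def wavelet_hi_def v)
  moreover have "wavelet_function t = (box_ift (wavelet_lo 0) (wavelet_hi 0) t + box_ift (wavelet_lo 1) (wavelet_hi 1) t)
      + (box_ift (wavelet_lo 2) (wavelet_hi 2) t + box_ift (wavelet_lo 3) (wavelet_hi 3) t)"
    by (simp add: wavelet_function_def)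
  ultimately show "wavelet_function t \<noteq> 0"
    using z by (simp only: simp_thms)
qed

section \<open>The multiresolution analysis and its wavelet\<close>

definition scaling_space :: "int \<Rightarrow> int \<Rightarrow> (real^2 \<Rightarrow> complex) set" where
  "scaling_space i j = band (scaling_set (2 powi i) (2 powi j))"

text \<open>Dyadic intervals partition the positive reals. Uniqueness of \<open>m\<close> makes the
  dilated wavelet sets disjoint, its existence makes them cover the plane off the axes.\<close>

lemma dyadic_floor_log:
  assumes "r > 0"
  shows "2 powi m \<le> r \<and> r < 2 * 2 powi m \<longleftrightarrow> m = \<lfloor>log 2 r\<rfloor>"
proof -
  have "2 powr real_of_int (m + 1) = 2 * 2 powi m"
    using powr_real_of_int'[of "2::real" m] by (simp add: powr_add)
  then have "2 powi m \<le> r \<and> r < 2 * 2 powi m \<longleftrightarrow> 2 powr real_of_int m \<le> r \<and> r < 2 powr real_of_int (m + 1)"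
    by (simp add: powr_real_of_int')
  also have "\<dots> \<longleftrightarrow> \<lfloor>log 2 r\<rfloor> = m"
    using assms by (intro floor_log_eq_powr_iff[symmetric]) auto
  finally show ?thesis by auto
qed

lemma wavelet_set_dyadic_disjoint:
  assumes "(m, n) \<noteq> (m', n')"
  shows "wavelet_set (2 powi m) (2 powi n) \<inter> wavelet_set (2 powi m') (2 powi n') = {}"
proof (rule ccontr)
  assume "wavelet_set (2 powi m) (2 powi n) \<inter> wavelet_set (2 powi m') (2 powi n') \<noteq> {}"
  then obtain v where v: "v \<in> wavelet_set (2 powi m) (2 powi n)" "v \<in> wavelet_set (2 powi m') (2 powi n')" by blast
  have "skew_abs v \<ge> 2 powi m" "2 * \<bar>v $ 2\<bar> \<ge> 2 powi n" using v(1) by (auto simp: wavelet_set_def)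
  moreover have "(2::real) powi m > 0" "(2::real) powi n > 0" by auto
  ultimately have pos: "skew_abs v > 0" "2 * \<bar>v $ 2\<bar> > 0" by linarith+
  have "m = m'" using v dyadic_floor_log[OF pos(1), of m] dyadic_floor_log[OF pos(1), of m'] by (simp add: wavelet_set_def)
  moreover have "n = n'" using v dyadic_floor_log[OF pos(2), of n] dyadic_floor_log[OF pos(2), of n'] by (simp add: wavelet_set_def)
  ultimately show False using assms by simp
qed

lemma wavelet_set_dyadic_cover:
  assumes "v $ 1 \<noteq> 0" "v $ 2 \<noteq> 0"
  shows "\<exists>m n. v \<in> wavelet_set (2 powi m) (2 powi n)"
proof -
  have "skew_abs v > 0" "2 * \<bar>v $ 2\<bar> > 0" using assms by (auto simp: skew_abs_def)
  from dyadic_floor_log[OF this(1)] dyadic_floor_log[OF this(2)] show ?thesis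
    unfolding wavelet_set_def mem_Collect_eq by blast
qed

lemma bmra_scaling_space:
  "bmra (vector [vector [2, 0], vector [0, 1]]) (vector [vector [1, 0], vector [0, 2]]) scaling_function scaling_space"
  unfolding bmra_def
proof (intro conjI allI impI ballI)
  show "scaling_function \<in> L2" by (rule scaling_function_L2)
  show "closed_l2_subspace (scaling_space i j)" for i j
    unfolding scaling_space_def by (rule closed_l2_subspace_band[OF scaling_set_borel])
  show "scaling_space i j \<subseteq> scaling_space l m" if "i \<le> l" "j \<le> m" for i j l m
  proof -
    have "(2::real) powi i \<le> 2 powi l" "(2::real) powi j \<le> 2 powi m"
      using that by (auto intro!: power_int_increasing)
    then show ?thesis unfolding scaling_space_def by (intro band_mono) (auto simp: scaling_set_def)
  qed
  show "fun_powi (dilate (vector [vector [2, 0], vector [0, 1]])) i `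
      (fun_powi (dilate (vector [vector [1, 0], vector [0, 2]])) j ` scaling_space 0 0) = scaling_space i j" for i j
  proof -
    have "axis_dilate 1 (2 powi j) ` band (scaling_set 1 1) = band (scaling_set 1 (2 powi j))"
      by (subst axis_dilate_band) (auto simp: scaling_set_vimage)
    moreover have "axis_dilate (2 powi i) 1 ` band (scaling_set 1 (2 powi j)) = band (scaling_set (2 powi i) (2 powi j))"
      by (subst axis_dilate_band) (auto simp: scaling_set_vimage)
    ultimately show ?thesis
      by (simp add: fun_powi_dilate_1 fun_powi_dilate_2 scaling_space_def)
  qed
  show "(\<Inter>i. \<Inter>j. scaling_space i j) = l2_zero"
    unfolding scaling_space_def
  proof (rule INT_band)
    show "AE x in lborel. x \<notin> (\<Inter>i. \<Inter>j. scaling_set (2 powi i) (2 powi j))"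
      using AE_coordinate_neq[of 1 0]
    proof eventually_elim
      case (elim x)
      then have "skew_abs x > 0" by (auto simp: skew_abs_def)
      \<comment> \<open>This power of 2 does not exceed \<open>skew_abs x\<close>, so a single set,
        at level 0 in the second index, already omits the point.\<close>
      then have "x \<notin> scaling_set (2 powi \<lfloor>log 2 (skew_abs x)\<rfloor>) (2 powi 0)"
        using dyadic_floor_log[of "skew_abs x" "\<lfloor>log 2 (skew_abs x)\<rfloor>"] by (simp add: scaling_set_def)
      then show ?case by blast
    qed
  qed
  show "l2_closure (\<Union>i. \<Union>j. scaling_space i j) = L2"
    unfolding scaling_space_def
  proof (rule l2_closure_UN_band[OF scaling_set_borel], rule AE_I2)
    fix x :: "real^2"
    obtain N where N: "max (skew_abs x) (2 * \<bar>x $ 2\<bar>) < 2 ^ N"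
      using real_arch_pow[of 2 "max (skew_abs x) (2 * \<bar>x $ 2\<bar>)"] by auto
    show "\<forall>\<^sub>F n in sequentially. x \<in> scaling_set (2 powi int n) (2 powi int n)"
    proof (rule eventually_sequentiallyI[of N])
      fix n assume "N \<le> n"
      then have "(2::real) ^ N \<le> 2 ^ n" by (intro power_increasing) auto
      then have "skew_abs x < 2 ^ n" "2 * \<bar>x $ 2\<bar> < 2 ^ n" using N by linarith+
      then show "x \<in> scaling_set (2 powi int n) (2 powi int n)"
        by (simp add: scaling_set_def)
    qed
  qed
  show "l2_eq (l2_proj (scaling_space i j) (l2_proj (scaling_space l m) f)) (l2_proj (scaling_space l m) (l2_proj (scaling_space i j) f))"
    if "f \<in> L2" for i j l m f
    unfolding scaling_space_def by (rule l2_proj_band_commute[OF scaling_set_borel scaling_set_borel that])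
  have "l2_orthonormal_basis (\<lambda>k. translate k scaling_function) int_lattice (band scaling_boxes)"
    by (rule translates_orthonormal_basis_band[OF scaling_function_L2 l2_ft_scaling_function scaling_boxes_borel scaling_exponentials])
  also have "band scaling_boxes = scaling_space 0 0"
    unfolding scaling_space_def band_def L2_on_cong_set[OF AE_scaling_boxes] by simp
  finally show "l2_orthonormal_basis (\<lambda>k. translate k scaling_function) int_lattice (scaling_space 0 0)" .
qed

lemma associated_wavelet_function: "associated_wavelet scaling_space wavelet_function"
  unfolding associated_wavelet_def
proof
  let ?S = "\<lambda>i j. scaling_set (2 powi i) (2 powi j)"
  note [measurable] = scaling_set_borel
  \<comment> \<open>The first spectral difference lies in \<open>skew_abs v \<ge> 1\<close>, the
    second in \<open>skew_abs v < 1\<close>.\<close>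
  show "l2_orthogonal (l2_ominus (scaling_space 1 0) (scaling_space 0 0)) (l2_ominus (scaling_space 0 1) (scaling_space 0 0))"
    unfolding scaling_space_def l2_ominus_band[OF scaling_set_borel scaling_set_borel]
    by (rule l2_orthogonal_band) (auto simp: scaling_set_def)
  have "bmra_wavelet_space scaling_space = band (?S 1 1 - (((?S 1 0 - ?S 0 0) \<union> (?S 0 1 - ?S 0 0)) \<union> ?S 0 0))"
    unfolding bmra_wavelet_space_def scaling_space_def
    by (simp add: l2_ominus_band l2_sum_band)
  also have "?S 1 1 - (((?S 1 0 - ?S 0 0) \<union> (?S 0 1 - ?S 0 0)) \<union> ?S 0 0) = wavelet_set 1 1"
    by (auto simp: scaling_set_def wavelet_set_def)
  also have "band (wavelet_set 1 1) = band wavelet_boxes"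
    unfolding band_def L2_on_cong_set[OF AE_wavelet_boxes] ..
  finally show "l2_orthonormal_basis (\<lambda>k. translate k wavelet_function) int_lattice (bmra_wavelet_space scaling_space)"
    using translates_orthonormal_basis_band[OF wavelet_function_L2 l2_ft_wavelet_function wavelet_boxes_borel wavelet_exponentials]
    by simp
qed

lemma is_wavelet_function:
  "is_wavelet (vector [vector [2, 0], vector [0, 1]]) (vector [vector [1, 0], vector [0, 2]]) wavelet_function"
  unfolding is_wavelet_def
proof (rule conjI[OF wavelet_function_L2])
  note TL = l2_isometryD(1)[OF l2_isometry_translate wavelet_function_L2]
  \<comment> \<open>Adding \<open>k\<close> to the argument is translation by \<open>- k\<close>,
    hence modulation by \<open>- k\<close> of the transform.\<close>
  define e where "e k = modulate (- k) (indicator wavelet_boxes)" for k :: "real^2"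
  have WL: "(indicator wavelet_boxes :: real^2 \<Rightarrow> complex) \<in> L2" by (rule L2_indicator_bounded[OF wavelet_boxes_borel])
  note modL = l2_isometryD(1)[OF l2_isometry_modulate]
  have "l2_orthonormal_basis e int_lattice (L2_on (wavelet_set 1 1))"
    unfolding e_def L2_on_cong_set[OF AE_wavelet_boxes, symmetric]
    by (rule l2_orthonormal_basis_uminus_index[OF _ wavelet_exponentials]) (auto simp: int_lattice_iff)
  then have onb: "l2_orthonormal_basis (\<lambda>(m, n, k). axis_dilate (2 powi (- m)) (2 powi (- n)) (e k)) (UNIV \<times> UNIV \<times> int_lattice) L2"
  proof (rule dyadic_dilates_orthonormal_basis[OF wavelet_set_borel])
    have X: "axis_scale (2 powi - m) (2 powi - n) -` wavelet_set 1 1 = wavelet_set (2 powi m) (2 powi n)" for m n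
      by (subst wavelet_set_vimage) (auto simp: power_int_minus divide_inverse)
    show "axis_scale (2 powi - m) (2 powi - n) -` wavelet_set 1 1 \<inter> axis_scale (2 powi - m') (2 powi - n') -` wavelet_set 1 1 = {}"
      if "(m, n) \<noteq> (m', n')" for m n m' n'
      unfolding X by (rule wavelet_set_dyadic_disjoint[OF that])
    show "AE x in lborel. \<exists>m n. x \<in> axis_scale (2 powi - m) (2 powi - n) -` wavelet_set 1 1"
      unfolding X using AE_coordinate_neq[of 1 0] AE_coordinate_neq[of 2 0]
      by eventually_elim (rule wavelet_set_dyadic_cover)
  qed
  define f where "f = (\<lambda>(m, n, k). axis_dilate (2 powi m) (2 powi n) (translate (- k) wavelet_function))"
  have D: "l2_isometry (axis_dilate (2 powi m) (2 powi n))" for m n :: int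
    by (rule l2_isometry_axis_dilate) auto
  have "l2_orthonormal_basis f (UNIV \<times> UNIV \<times> int_lattice) {g \<in> L2. l2_ft g \<in> L2}"
  proof (rule l2_isometry_transfer_onb[OF l2_isometry_ft onb])
    fix i :: "int \<times> int \<times> (real^2)"
    obtain m n k where i: "i = (m, n, k)" by (cases i) auto
    show "f i \<in> L2" by (simp add: f_def i l2_isometryD(1)[OF D TL])
    have "l2_eq (l2_ft (axis_dilate (2 powi m) (2 powi n) (translate (- k) wavelet_function)))
        (axis_dilate (1 / 2 powi m) (1 / 2 powi n) (l2_ft (translate (- k) wavelet_function)))"
      by (rule l2_ft_axis_dilate[OF _ _ TL]) auto
    also have "l2_eq \<dots> (axis_dilate (1 / 2 powi m) (1 / 2 powi n) (e k))"
    proof (rule l2_isometry_cong[OF l2_isometry_axis_dilate])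
      have "l2_eq (l2_ft (translate (- k) wavelet_function)) (modulate (- k) (l2_ft wavelet_function))"
        by (rule l2_ft_translate[OF wavelet_function_L2])
      also have "l2_eq \<dots> (e k)"
        unfolding e_def
        by (rule l2_isometry_cong[OF l2_isometry_modulate l2_ft_L2[OF wavelet_function_L2] WL l2_ft_wavelet_function])
      finally show "l2_eq (l2_ft (translate (- k) wavelet_function)) (e k)" .
    qed (simp_all add: l2_ft_L2[OF TL] e_def modL[OF WL])
    finally show "l2_eq (l2_ft (f i)) (case i of (m, n, k) \<Rightarrow> axis_dilate (2 powi (- m)) (2 powi (- n)) (e k))"
      by (simp add: f_def i power_int_minus divide_inverse)
  qed
  also have "{g \<in> L2. l2_ft g \<in> L2} = (L2 :: (real^2 \<Rightarrow> complex) set)" by (auto intro: l2_ft_L2)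
  also have "f = (\<lambda>(m, n, k) x. complex_of_real (2 powr (real_of_int (m + n) / 2)) *
      wavelet_function (fun_powi ((*v) (vector [vector [2, 0], vector [0, 1]])) m (fun_powi ((*v) (vector [vector [1, 0], vector [0, 2]])) n x) + k))"
  proof -
    \<comment> \<open>The square root of the determinant of the combined dilation is the normalizing
      factor in the definition of a wavelet.\<close>
    have "sqrt (2 powi m * 2 powi n) = 2 powr (real_of_int (m + n) / 2)" for m n
    proof -
      have "2 powi m * 2 powi n = 2 powr real_of_int (m + n)"
        using powr_real_of_int'[of "2::real" "m + n"] by (simp add: power_int_add)
      then show ?thesis by (simp add: powr_half_sqrt[symmetric] powr_powr)
    qed
    then show ?thesis
      by (simp add: f_def fun_eq_iff axis_dilate_def translate_def fun_powi_matrix_1 fun_powi_matrix_2)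
  qed
  finally show "l2_orthonormal_basis (\<lambda>(m, n, k) x. complex_of_real (2 powr (real_of_int (m + n) / 2)) *
      wavelet_function (fun_powi ((*v) (vector [vector [2, 0], vector [0, 1]])) m (fun_powi ((*v) (vector [vector [1, 0], vector [0, 2]])) n x) + k))
    (UNIV \<times> UNIV \<times> int_lattice) L2" .
qed

lemma lattice_vectors_01: "(vector [0, 0] :: real^2) \<in> int_lattice" "(vector [0, 1] :: real^2) \<in> int_lattice"
  "(vector [0, 0] :: real^2) = 0" "(vector [0, 1] :: real^2) \<noteq> 0"
  by (simp_all add: int_lattice_iff vec_eq_2)

lemma not_separable_scaling_space:
  "\<not> separable_bmra (vector [vector [2, 0], vector [0, 1]]) B scaling_function scaling_space"
proof
  assume "separable_bmra (vector [vector [2, 0], vector [0, 1]]) B scaling_function scaling_space"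
  from bmra_separable_autocorrelation[OF refl scaling_function_L2 this]
  moreover have "scaling_function (vector [0, 0]) = 1" "scaling_function (vector [0, 1]) = 0"
    by (simp_all add: scaling_function_at_lattice lattice_vectors_01(1,2), simp_all add: lattice_vectors_01)
  ultimately have "scaling_function (vector [1/2, 1]) = 0"
    by (simp add: scaling_function_autocorrelation)
  then show False using scaling_function_half_neq_0 by simp
qed

lemma not_separable_wavelet_function: "\<not> separable_fun wavelet_function"
proof
  assume "separable_fun wavelet_function"
  then obtain f g where "f \<in> L2" "g \<in> L2" "l2_eq wavelet_function (tensor_fun f g)"
    by (auto simp: separable_fun_def)
  from autocorrelation_separable[OF wavelet_function_L2 this, of "1/2" 1 0 0]
  moreover have "wavelet_function (vector [0, 0]) = 1" "wavelet_function (vector [0, 1]) = 0"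
    by (simp_all add: wavelet_function_at_lattice lattice_vectors_01(1,2), simp_all add: lattice_vectors_01)
  ultimately have "wavelet_function (vector [1/2, 1]) = 0"
    by (simp add: wavelet_function_autocorrelation)
  then show False using wavelet_function_half_neq_0 by simp
qed

lemma has_fourier_transform_wavelet_function: "has_fourier_transform wavelet_function (indicator wavelet_boxes)"
proof (rule has_fourier_transform_indicator[OF wavelet_function_L2 l2_ft_wavelet_function wavelet_boxes_borel])
  show "AE \<xi> in lborel. \<exists>d>0. \<forall>\<eta>. \<bar>\<eta> $ 1\<bar> < d \<and> \<bar>\<eta> $ 2\<bar> < d \<longrightarrow> (\<eta> + \<xi> \<in> wavelet_boxes \<longleftrightarrow> \<xi> \<in> wavelet_boxes)"
    unfolding wavelet_boxes_def by (rule boxes_AE_locally_constant) simp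
qed

lemma compactly_supported_indicator_wavelet_boxes: "ae_compactly_supported (indicator wavelet_boxes)"
  unfolding ae_compactly_supported_def
proof (intro exI[of _ "closure wavelet_boxes"] conjI AE_I2 impI)
  show "compact (closure wavelet_boxes)" using wavelet_boxes_borel(2) by simp
  show "indicator wavelet_boxes \<xi> = (0::complex)" if "\<xi> \<notin> closure wavelet_boxes" for \<xi>
    using that closure_subset[of wavelet_boxes] by (auto simp: indicator_def)
qed

theorem theorem7p3:
  fixes A B :: "real^2^2"
  assumes "A = vector [vector [2, 0], vector [0, 1]]"
    and "B = vector [vector [1, 0], vector [0, 2]]"
  shows "\<exists>\<phi> V. bmra A B \<phi> V \<and> \<not> separable_bmra A B \<phi> V \<and>
           (\<exists>\<psi> \<psi>hat. \<psi> \<in> L2 \<and> (\<forall>x. \<psi> x \<in> \<real>) \<and> \<not> separable_fun \<psi> \<and>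
              is_wavelet A B \<psi> \<and> associated_wavelet V \<psi> \<and>
              has_fourier_transform \<psi> \<psi>hat \<and> ae_compactly_supported \<psi>hat)"
  unfolding assms
  by (intro exI[of _ scaling_function] exI[of _ scaling_space] exI[of _ wavelet_function]
      exI[of _ "indicator wavelet_boxes"] conjI allI bmra_scaling_space not_separable_scaling_space
      wavelet_function_L2 wavelet_function_real not_separable_wavelet_function is_wavelet_function
      associated_wavelet_function has_fourier_transform_wavelet_function
      compactly_supported_indicator_wavelet_boxes)

end
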